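(* Let $(f_n)$ be a sequence of complex rational maps of degree $d\ge2$ and $M=(M_n)$ a sequence of complex Möbius transformations. The following are equivalent: (1) $\varepsilon(M\cdot f\cdot M^{-1})=\varepsilon_\star(f)$; (2) $(M\cdot f\cdot M^{-1})_{\varepsilon(M\cdot f\cdot M^{-1})}$ does not have potential good reduction; (3) for every sequence $L=(L_n)$ of complex Möbius transformations, the limit $(L\cdot M^{-1})_{\varepsilon(L\cdot f\cdot L^{-1})}$ has degree $1$.
   Context: Fix a non-principal ultrafilter $\omega$ on $\mathbb N$; $\lim$ denotes the limit along $\omega$. A scale is an equivalence class of bounded sequences of positive reals, $(\varepsilon_n)\sim(\eta_n)$ iff $\lim\varepsilon_n/\eta_n\in(0,\infty)$, totally ordered by $\varepsilon\le\eta$ iff $\lim \varepsilon_n/\eta_n<\infty$, with maximum the trivial scale $(1)$. For a scale $\varepsilon$, $\mathscr H_\varepsilon$ is the quotient of $\{(z_n)\in\mathbb C^{\mathbb N}:\lim|z_n|^{\varepsilon_n}<\infty\}$ by $\{(z_n):\lim|z_n|^{\varepsilon_n}=0\}$ with norm $\lim|z_n|^{\min(1,\varepsilon_n)}$; $\mathscr H_{(1)}\cong\mathbb C$ and for $\varepsilon<(1)$ it is an algebraically closed complete non-Archimedean field with residue characteristic $0$. For a sequence $(g_n)$ of complex rational maps (or Möbius transformations) of degree $d$, write $g_n=[P_n:Q_n]$ with coefficients of maximal modulus $1$; the coefficient sequences define $P_\varepsilon,Q_\varepsilon$ over $\mathscr H_\varepsilon$, and the limit $g_\varepsilon$ is $[P_\varepsilon:Q_\varepsilon]$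 after dividing by their gcd (a possibly constant rational map of degree $\le d$). $M\cdot f\cdot M^{-1}$ denotes $(M_n\circ f_n\circ M_n^{-1})$, $L\cdot M^{-1}$ denotes $(L_n\circ M_n^{-1})$. For $g=[P:Q]$ of degree $d$ over a normed field $k$ with $P=\sum a_iz_0^iz_1^{d-i}$, $Q=\sum b_iz_0^iz_1^{d-i}$, $|\mathrm{Res}(g)|=|\mathrm{Res}(P,Q)|/\max(|a_i|,|b_j|)^{2d}$ and $|\mathrm{res}(g)|=\sup_{M\in\mathrm{PGL}(2,k)}|\mathrm{Res}(MgM^{-1})|$. Let $\theta(s)=-1/\log s$ for $0<s\le1/e$, $\theta(s)=1$ for $s\ge 1/e$. Define the scales $\varepsilon(f)=(\theta(|\mathrm{Res}(f_n)|))$ and $\varepsilon_\star(f)=(\theta(|\mathrm{res}(f_n)|))$ (the fundamental scale). Over a non-Archimedean field, $g$ has good reduction iff $|\mathrm{Res}(g)|=1$, and potential good reduction if it is conjugate by a Möbius transformation over that field to a map with good reduction; by convention, a rational map over $\mathscr H_{(1)}=\mathbb C$ never has potential good reduction. *)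

theory Defs
  imports "Subresultants.Resultant_Prelim" "HOL-Library.Extended_Real"
begin

definition nonprincipal_ultrafilter :: "nat filter \<Rightarrow> bool" where
  "nonprincipal_ultrafilter \<omega> \<longleftrightarrow> \<omega> \<noteq> bot
     \<and> (\<forall>P. eventually P \<omega> \<or> eventually (\<lambda>n. \<not> P n) \<omega>)
     \<and> (\<forall>m. eventually (\<lambda>n. n \<noteq> m) \<omega>)"

text \<open>Limit along the ultrafilter, taken in the extended reals (where it always exists).\<close>
definition ulim :: "nat filter \<Rightarrow> (nat \<Rightarrow> real) \<Rightarrow> ereal" where
  "ulim \<omega> x = Lim \<omega> (\<lambda>n. ereal (x n))"

text \<open>Scales are represented by sequences of positive reals; equality of scales:\<close>
definition scale_eq :: "nat filter \<Rightarrow> (nat \<Rightarrow> real) \<Rightarrow> (nat \<Rightarrow> real) \<Rightarrow> bool" where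
  "scale_eq \<omega> \<epsilon> \<eta> \<longleftrightarrow> 0 < ulim \<omega> (\<lambda>n. \<epsilon> n / \<eta> n) \<and> ulim \<omega> (\<lambda>n. \<epsilon> n / \<eta> n) < \<infinity>"

definition scale_trivial :: "nat filter \<Rightarrow> (nat \<Rightarrow> real) \<Rightarrow> bool" where
  "scale_trivial \<omega> \<epsilon> \<longleftrightarrow> scale_eq \<omega> \<epsilon> (\<lambda>_. 1)"

definition theta :: "real \<Rightarrow> real" where
  "theta s = (if s \<le> exp (-1) then - 1 / ln s else 1)"

text \<open>A binary form of (formal) degree k, P(z0,z1) = sum a_i z0^i z1^(k-i), is represented by
  the polynomial p with coeff p i = a_i and degree p \<le> k.  A rational map of degree k is a pair (p,q).
  A Moebius transformation is a matrix (a,b,c,e), acting by [z0:z1] \<mapsto> [a z0 + b z1 : c z0 + e z1].\<close>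

type_synonym 'a mob = "'a \<times> 'a \<times> 'a \<times> 'a"

fun mob_det :: "'a::comm_ring_1 mob \<Rightarrow> 'a" where
  "mob_det (a, b, c, e) = a * e - b * c"

fun mob_adj :: "'a::comm_ring_1 mob \<Rightarrow> 'a mob" where
  "mob_adj (a, b, c, e) = (e, - b, - c, a)"

fun mob_mul :: "'a::comm_ring_1 mob \<Rightarrow> 'a mob \<Rightarrow> 'a mob" where
  "mob_mul (a, b, c, e) (a', b', c', e') =
     (a * a' + b * c', a * b' + b * e', c * a' + e * c', c * b' + e * e')"

fun mob_pair :: "'a::comm_ring_1 mob \<Rightarrow> 'a poly \<times> 'a poly" where
  "mob_pair (a, b, c, e) = ([:b, a:], [:e, c:])"

definition hsubst :: "nat \<Rightarrow> 'a::comm_ring_1 poly \<Rightarrow> 'a mob \<Rightarrow> 'a poly" where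
  "hsubst k p N = (case N of (a, b, c, e) \<Rightarrow>
     (\<Sum>i\<le>k. smult (coeff p i) ([:b, a:] ^ i * [:e, c:] ^ (k - i))))"

text \<open>Conjugation N \<circ> g \<circ> N^{-1} (N^{-1} represented projectively by the adjugate).\<close>
fun mconj :: "nat \<Rightarrow> 'a::comm_ring_1 mob \<Rightarrow> 'a poly \<times> 'a poly \<Rightarrow> 'a poly \<times> 'a poly" where
  "mconj k (a, b, c, e) (p, q) =
     (let p' = hsubst k p (mob_adj (a, b, c, e)); q' = hsubst k q (mob_adj (a, b, c, e))
      in (smult a p' + smult b q', smult c p' + smult e q'))"

text \<open>Homogeneous resultant of two forms of degree k (Sylvester determinant with formal degrees).\<close>
definition hres :: "nat \<Rightarrow> 'a::comm_ring_1 poly \<Rightarrow> 'a poly \<Rightarrow> 'a" where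
  "hres k p q = resultant_sub k k p q"

definition cmax :: "nat \<Rightarrow> complex poly \<times> complex poly \<Rightarrow> real" where
  "cmax k g = Max ((\<lambda>i. cmod (coeff (fst g) i)) ` {..k} \<union> (\<lambda>i. cmod (coeff (snd g) i)) ` {..k})"

definition absRes :: "nat \<Rightarrow> complex poly \<times> complex poly \<Rightarrow> real" where
  "absRes k g = cmod (hres k (fst g) (snd g)) / cmax k g ^ (2 * k)"

definition absres :: "nat \<Rightarrow> complex poly \<times> complex poly \<Rightarrow> real" where
  "absres k g = Sup {absRes k (mconj k M g) | M. mob_det M \<noteq> 0}"

definition is_ratmap :: "nat \<Rightarrow> complex poly \<times> complex poly \<Rightarrow> bool" where
  "is_ratmap d g \<longleftrightarrow> degree (fst g) \<le> d \<and> degree (snd g) \<le> d \<and> hres d (fst g) (snd g) \<noteq> 0"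

definition normalize_map :: "nat \<Rightarrow> complex poly \<times> complex poly \<Rightarrow> complex poly \<times> complex poly" where
  "normalize_map k g = (smult (inverse (complex_of_real (cmax k g))) (fst g),
                        smult (inverse (complex_of_real (cmax k g))) (snd g))"

definition mconjs :: "nat \<Rightarrow> (nat \<Rightarrow> complex mob) \<Rightarrow> (nat \<Rightarrow> complex poly \<times> complex poly)
    \<Rightarrow> nat \<Rightarrow> complex poly \<times> complex poly" where
  "mconjs d M f = (\<lambda>n. mconj d (M n) (f n))"

definition eps :: "nat \<Rightarrow> (nat \<Rightarrow> complex poly \<times> complex poly) \<Rightarrow> nat \<Rightarrow> real" where
  "eps d f = (\<lambda>n. theta (absRes d (f n)))"

definition eps_star :: "nat \<Rightarrow> (nat \<Rightarrow> complex poly \<times> complex poly) \<Rightarrow> nat \<Rightarrow> real" where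
  "eps_star d f = (\<lambda>n. theta (absres d (f n)))"

section \<open>The field H_\<epsilon>, via representative sequences\<close>

definition Hring :: "nat filter \<Rightarrow> (nat \<Rightarrow> real) \<Rightarrow> (nat \<Rightarrow> complex) \<Rightarrow> bool" where
  "Hring \<omega> \<epsilon> x \<longleftrightarrow> ulim \<omega> (\<lambda>n. cmod (x n) powr \<epsilon> n) < \<infinity>"

definition Hzero :: "nat filter \<Rightarrow> (nat \<Rightarrow> real) \<Rightarrow> (nat \<Rightarrow> complex) \<Rightarrow> bool" where
  "Hzero \<omega> \<epsilon> x \<longleftrightarrow> ulim \<omega> (\<lambda>n. cmod (x n) powr \<epsilon> n) = 0"

definition Hnorm :: "nat filter \<Rightarrow> (nat \<Rightarrow> real) \<Rightarrow> (nat \<Rightarrow> complex) \<Rightarrow> real" where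
  "Hnorm \<omega> \<epsilon> x = real_of_ereal (ulim \<omega> (\<lambda>n. cmod (x n) powr min 1 (\<epsilon> n)))"

definition Hform :: "nat filter \<Rightarrow> (nat \<Rightarrow> real) \<Rightarrow> nat \<Rightarrow> (nat \<Rightarrow> complex poly) \<Rightarrow> bool" where
  "Hform \<omega> \<epsilon> k P \<longleftrightarrow> (\<forall>n. degree (P n) \<le> k) \<and> (\<forall>i. Hring \<omega> \<epsilon> (\<lambda>n. coeff (P n) i))"

definition Heqf :: "nat filter \<Rightarrow> (nat \<Rightarrow> real) \<Rightarrow> (nat \<Rightarrow> complex poly) \<Rightarrow> (nat \<Rightarrow> complex poly) \<Rightarrow> bool" where
  "Heqf \<omega> \<epsilon> P Q \<longleftrightarrow> (\<forall>i. Hzero \<omega> \<epsilon> (\<lambda>n. coeff (P n) i - coeff (Q n) i))"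

definition Hcoprime :: "nat filter \<Rightarrow> (nat \<Rightarrow> real) \<Rightarrow> nat \<Rightarrow> (nat \<Rightarrow> complex poly) \<Rightarrow> (nat \<Rightarrow> complex poly) \<Rightarrow> bool" where
  "Hcoprime \<omega> \<epsilon> k P Q \<longleftrightarrow> \<not> (Heqf \<omega> \<epsilon> P (\<lambda>_. 0) \<and> Heqf \<omega> \<epsilon> Q (\<lambda>_. 0))
     \<and> \<not> (\<exists>j D A B. 0 < j \<and> j \<le> k \<and> Hform \<omega> \<epsilon> j D \<and> \<not> Heqf \<omega> \<epsilon> D (\<lambda>_. 0)
           \<and> Hform \<omega> \<epsilon> (k - j) A \<and> Hform \<omega> \<epsilon> (k - j) B
           \<and> Heqf \<omega> \<epsilon> P (\<lambda>n. D n * A n) \<and> Heqf \<omega> \<epsilon> Q (\<lambda>n. D n * B n))"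

definition Hreduced :: "nat filter \<Rightarrow> (nat \<Rightarrow> real) \<Rightarrow> nat \<Rightarrow> (nat \<Rightarrow> complex poly) \<Rightarrow> (nat \<Rightarrow> complex poly)
    \<Rightarrow> nat \<Rightarrow> (nat \<Rightarrow> complex poly) \<Rightarrow> (nat \<Rightarrow> complex poly) \<Rightarrow> bool" where
  "Hreduced \<omega> \<epsilon> d P Q k P' Q' \<longleftrightarrow> k \<le> d \<and> Hform \<omega> \<epsilon> k P' \<and> Hform \<omega> \<epsilon> k Q' \<and> Hcoprime \<omega> \<epsilon> k P' Q'
     \<and> (\<exists>G. Hform \<omega> \<epsilon> (d - k) G \<and> Heqf \<omega> \<epsilon> P (\<lambda>n. G n * P' n) \<and> Heqf \<omega> \<epsilon> Q (\<lambda>n. G n * Q' n))"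

definition limit_map :: "nat filter \<Rightarrow> (nat \<Rightarrow> real) \<Rightarrow> nat \<Rightarrow> (nat \<Rightarrow> complex poly \<times> complex poly)
    \<Rightarrow> nat \<Rightarrow> (nat \<Rightarrow> complex poly) \<Rightarrow> (nat \<Rightarrow> complex poly) \<Rightarrow> bool" where
  "limit_map \<omega> \<epsilon> d g k P' Q' \<longleftrightarrow>
     Hreduced \<omega> \<epsilon> d (\<lambda>n. fst (normalize_map d (g n))) (\<lambda>n. snd (normalize_map d (g n))) k P' Q'"

definition limit_degree_is :: "nat filter \<Rightarrow> (nat \<Rightarrow> real) \<Rightarrow> nat \<Rightarrow> (nat \<Rightarrow> complex poly \<times> complex poly) \<Rightarrow> nat \<Rightarrow> bool" where
  "limit_degree_is \<omega> \<epsilon> d g k \<longleftrightarrow> (\<exists>P' Q'. limit_map \<omega> \<epsilon> d g k P' Q')"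

definition HabsRes :: "nat filter \<Rightarrow> (nat \<Rightarrow> real) \<Rightarrow> nat \<Rightarrow> (nat \<Rightarrow> complex poly) \<Rightarrow> (nat \<Rightarrow> complex poly) \<Rightarrow> real" where
  "HabsRes \<omega> \<epsilon> k P Q = Hnorm \<omega> \<epsilon> (\<lambda>n. hres k (P n) (Q n)) /
     Max ((\<lambda>i. Hnorm \<omega> \<epsilon> (\<lambda>n. coeff (P n) i)) ` {..k} \<union> (\<lambda>i. Hnorm \<omega> \<epsilon> (\<lambda>n. coeff (Q n) i)) ` {..k}) ^ (2 * k)"

definition HPGL :: "nat filter \<Rightarrow> (nat \<Rightarrow> real) \<Rightarrow> (nat \<Rightarrow> complex mob) \<Rightarrow> bool" where
  "HPGL \<omega> \<epsilon> N \<longleftrightarrow> Hring \<omega> \<epsilon> (\<lambda>n. fst (N n)) \<and> Hring \<omega> \<epsilon> (\<lambda>n. fst (snd (N n)))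
     \<and> Hring \<omega> \<epsilon> (\<lambda>n. fst (snd (snd (N n)))) \<and> Hring \<omega> \<epsilon> (\<lambda>n. snd (snd (snd (N n))))
     \<and> \<not> Hzero \<omega> \<epsilon> (\<lambda>n. mob_det (N n))"

text \<open>The limit g_\<epsilon> has potential good reduction (never over H_(1) = C, by convention).\<close>
definition limit_PGR :: "nat filter \<Rightarrow> (nat \<Rightarrow> real) \<Rightarrow> nat \<Rightarrow> (nat \<Rightarrow> complex poly \<times> complex poly) \<Rightarrow> bool" where
  "limit_PGR \<omega> \<epsilon> d g \<longleftrightarrow> \<not> scale_trivial \<omega> \<epsilon> \<and>
     (\<exists>k P' Q'. limit_map \<omega> \<epsilon> d g k P' Q' \<and>
        (\<exists>N. HPGL \<omega> \<epsilon> N \<and>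
           HabsRes \<omega> \<epsilon> k (\<lambda>n. fst (mconj k (N n) (P' n, Q' n))) (\<lambda>n. snd (mconj k (N n) (P' n, Q' n))) = 1))"

end

(* Write g = M f M^-1, rho = |Res g|, and for a Moebius transformation K write sigma = |Res (K g K^-1)|
   and nd(K) = |det K| / max(K)^2, the resultant of K. Two polynomial inequalities over C suffice:
     sigma * rho^(2d-1) <= C * nd(K)^(d^2-d)    and    sigma * nd(K)^(d^2+d) <= C * rho.
   Since s^theta(s) >= 1/e, raising them to the power of a scale compares the sizes of rho, sigma and nd(K)
   over the field H of that scale: nd(K) stays nonzero over H whenever rho and sigma do, and rho does
   whenever sigma and nd(K) do.  If the scale of g is not the fundamental one, a conjugation K realising the
   supremum up to a factor 2 has sigma^eps(g) tending to 1, which is potential good reduction, while rho is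
   zero over the field at the scale of sigma, so that K degenerates there. *)
theory Submission
  imports Defs "HOL-Computational_Algebra.Fundamental_Theorem_Algebra"
begin

section \<open>Resultants of binary forms under substitution\<close>

text \<open>Statements over the field become statements about complex sequences along the
  ultrafilter: being nonzero is an eventual positive lower bound for |x|^eps. As scales are at most
  1, fixed constants stay bounded under this power, and the resultant, being a determinant, respects
  the congruence. The theory of gcds over the field is avoided. Coprimality is defined there by
  factorisations, and only two links with the resultant are needed: a common factor makes it vanish
  in every degree, by an exact computation on complex representatives, and in degree 1 the converse
  is linear algebra.

  The first inequality rests on a lower bound for the coefficients of K g K^-1: the adjugate of the
  Sylvester matrix keeps the two forms of g from being small at the same point. The second applies
  the elementary upper bound for coefficients to the conjugation back. In both, the factor |det
  K|^(d^2+d) in the resultant of K g K^-1 is exact; its main part comes from determinants of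
  symmetric powers. Conditions (2) and (3) are each compared with (1).\<close>

definition form_eval :: "nat \<Rightarrow> 'a::comm_ring_1 poly \<Rightarrow> 'a \<Rightarrow> 'a \<Rightarrow> 'a" where
  "form_eval k p z w = (\<Sum>i\<le>k. coeff p i * z ^ i * w ^ (k - i))"

lemma form_eval_add: "form_eval k (p + q) z w = form_eval k p z w + form_eval k q z w"
  by (simp add: form_eval_def algebra_simps sum.distrib)

lemma form_eval_smult: "form_eval k (smult a p) z w = a * form_eval k p z w"
  by (simp add: form_eval_def sum_distrib_left algebra_simps)

lemma form_eval_sum: "form_eval k (\<Sum>i\<in>A. p i) z w = (\<Sum>i\<in>A. form_eval k (p i) z w)"
proof -
  have "form_eval k 0 z w = 0" by (simp add: form_eval_def)
  then show ?thesis by (induction A rule: infinite_finite_induct) (simp_all add: form_eval_add)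
qed

lemma form_eval_right_0: "form_eval k p z 0 = coeff p k * z ^ k"
proof -
  have "form_eval k p z 0 = (\<Sum>i\<in>{k}. coeff p i * z ^ i * 0 ^ (k - i))"
    unfolding form_eval_def by (rule sum.mono_neutral_right) (auto simp: power_0_left split: if_splits)
  then show ?thesis by simp
qed

lemma form_eval_left_0: "form_eval k p 0 w = coeff p 0 * w ^ k"
proof -
  have "form_eval k p 0 w = (\<Sum>i\<in>{0}. coeff p i * 0 ^ i * w ^ (k - i))"
    unfolding form_eval_def by (rule sum.mono_neutral_right) (auto simp: power_0_left split: if_splits)
  then show ?thesis by simp
qed

lemma form_eval_scale: "form_eval k p (t * z) (t * w) = t ^ k * form_eval k p z w"
proof -
  have "coeff p i * (t * z) ^ i * (t * w) ^ (k - i) = t ^ k * (coeff p i * z ^ i * w ^ (k - i))"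
    if "i \<le> k" for i
  proof -
    have "t ^ k = t ^ i * t ^ (k - i)" using that by (simp flip: power_add)
    then show ?thesis by (simp add: power_mult_distrib mult_ac)
  qed
  then show ?thesis by (simp add: form_eval_def sum_distrib_left)
qed

lemma form_eval_right_1:
  assumes "degree p \<le> k"
  shows "form_eval k p z 1 = poly p z"
proof -
  have "(\<Sum>i\<le>k. coeff p i * z ^ i) = (\<Sum>i\<le>degree p. coeff p i * z ^ i)"
    using assms by (intro sum.mono_neutral_right) (auto simp: coeff_eq_0)
  then show ?thesis by (simp add: form_eval_def poly_altdef)
qed

lemma coeff_mult_top:
  fixes p q :: "'a::comm_ring_1 poly"
  assumes "degree p \<le> j" "degree q \<le> k"
  shows "coeff (p * q) (j + k) = coeff p j * coeff q k"
proof -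
  have "(\<Sum>i\<le>j + k. coeff p i * coeff q (j + k - i)) = (\<Sum>i\<in>{j}. coeff p i * coeff q (j + k - i))"
  proof (rule sum.mono_neutral_right)
    show "\<forall>i\<in>{..j + k} - {j}. coeff p i * coeff q (j + k - i) = 0"
    proof
      fix i assume "i \<in> {..j + k} - {j}"
      then consider "i > j" | "j + k - i > k" by force
      then show "coeff p i * coeff q (j + k - i) = 0"
        using assms by cases (simp_all add: coeff_eq_0)
    qed
  qed auto
  then show ?thesis by (simp add: coeff_mult)
qed

text \<open>Off w = 0 a form is a homogenised polynomial. At the point at infinity only the
  coefficients of formal top degree survive, and these multiply even if they vanish.\<close>

lemma form_eval_mult:
  fixes p q :: "'a::field poly"
  assumes "degree p \<le> j" "degree q \<le> k"
  shows "form_eval (j + k) (p * q) z w = form_eval j p z w * form_eval k q z w"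
proof (cases "w = 0")
  case True
  then show ?thesis using assms by (simp add: form_eval_right_0 coeff_mult_top power_add)
next
  case False
  have *: "form_eval n r z w = w ^ n * poly r (z / w)" if "degree r \<le> n" for n r
    using form_eval_scale[of n r w "z / w" 1] form_eval_right_1[OF that] False by simp
  have "degree (p * q) \<le> j + k"
    using assms degree_mult_le[of p q] by linarith
  then show ?thesis using assms by (simp add: * power_add)
qed

lemma form_eval_power:
  fixes p :: "'a::field poly"
  assumes "degree p \<le> 1"
  shows "form_eval i (p ^ i) z w = form_eval 1 p z w ^ i"
proof (induction i)
  case 0
  show ?case by (simp add: form_eval_def)
next
  case (Suc i)
  have "degree (p ^ i) \<le> i"
    by (rule order_trans[OF degree_power_le[of p i] mult_le_mono1[OF assms, of i, unfolded mult_1]])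
  then show ?case using form_eval_mult[of p 1 "p ^ i" i] assms Suc by simp
qed

lemma form_eval_linear: "form_eval 1 [:b, a:] z w = a * z + b * w"
  by (simp add: form_eval_def)

lemma degree_linear: "degree [:b, a:] \<le> 1"
  using degree_pCons_le[of b "[:a:]"] by simp

lemma degree_linear_power_mult:
  fixes a b c e :: "'a::comm_ring_1"
  shows "degree ([:b, a:] ^ i * [:e, c:] ^ j) \<le> i + j"
proof -
  have *: "degree ([:v, u:] ^ n) \<le> n" for u v :: 'a and n
    by (rule order_trans[OF degree_power_le mult_le_mono1[OF degree_linear, unfolded mult_1]])
  show ?thesis using degree_mult_le[of "[:b, a:] ^ i" "[:e, c:] ^ j"] *[of b a i] *[of e c j] by linarith
qed

section \<open>Linear substitutions in binary forms\<close>

lemma degree_hsubst: "degree (hsubst k p N) \<le> k"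
  unfolding hsubst_def
  by (auto split: prod.splits intro!: degree_sum_le order_trans[OF degree_smult_le]
      order_trans[OF degree_linear_power_mult])

text \<open>Substitution is composition with the linear map. A form over an infinite field is
  determined by its values, so composition and product rules for \<open>hsubst\<close> can be
  checked pointwise.\<close>

lemma form_eval_hsubst:
  fixes p :: "'a::field poly"
  shows "form_eval k (hsubst k p (a, b, c, e)) z w = form_eval k p (a * z + b * w) (c * z + e * w)"
proof -
  have *: "form_eval n ([:v, u:] ^ n) z w = (u * z + v * w) ^ n" for u v :: 'a and n
    using form_eval_power[OF degree_linear] by (simp only: form_eval_linear)
  have d: "degree ([:v, u:] ^ n) \<le> n" for u v :: 'a and n
    using degree_linear_power_mult[where j = 0] by simp
  have "form_eval k ([:b, a:] ^ i * [:e, c:] ^ (k - i)) z w = (a * z + b * w) ^ i * (c * z + e * w) ^ (k - i)"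
    if "i \<le> k" for i
    using form_eval_mult[OF d[of b a i] d[of e c "k - i"], of z w] that by (simp add: *)
  then show ?thesis
    by (simp add: hsubst_def form_eval_sum form_eval_smult)
      (simp add: form_eval_def algebra_simps)
qed

lemma poly_eqI_form_eval:
  fixes p q :: "'a::field_char_0 poly"
  assumes "degree p \<le> k" "degree q \<le> k" "\<And>z w. form_eval k p z w = form_eval k q z w"
  shows "p = q"
  using assms by (metis form_eval_right_1 poly_eq_poly_eq_iff ext)

text \<open>Substitution is a right action, so the order of the matrix product is kept when forms
  are written as row vectors.\<close>

lemma hsubst_hsubst:
  fixes p :: "'a::field_char_0 poly"
  shows "hsubst k (hsubst k p N) N' = hsubst k p (mob_mul N N')"
proof (rule poly_eqI_form_eval)
  fix z w :: 'a
  obtain a b c e where N: "N = (a, b, c, e)" by (cases N)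
  obtain a' b' c' e' where N': "N' = (a', b', c', e')" by (cases N')
  show "form_eval k (hsubst k (hsubst k p N) N') z w = form_eval k (hsubst k p (mob_mul N N')) z w"
    by (simp add: N N' form_eval_hsubst algebra_simps)
qed (rule degree_hsubst)+

lemma hsubst_mult:
  fixes p q :: "'a::field_char_0 poly"
  assumes "degree p \<le> j" "degree q \<le> k"
  shows "hsubst (j + k) (p * q) N = hsubst j p N * hsubst k q N"
proof (rule poly_eqI_form_eval)
  show "degree (hsubst j p N * hsubst k q N) \<le> j + k"
    by (rule order_trans[OF degree_mult_le add_mono[OF degree_hsubst degree_hsubst]])
  fix z w :: 'a
  obtain a b c e where N: "N = (a, b, c, e)" by (cases N)
  show "form_eval (j + k) (hsubst (j + k) (p * q) N) z w = form_eval (j + k) (hsubst j p N * hsubst k q N) z w"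
    using assms by (simp add: form_eval_mult degree_hsubst) (simp add: N form_eval_hsubst form_eval_mult)
qed (rule degree_hsubst)

lemma hsubst_add: "hsubst k (p + q) N = hsubst k p N + hsubst k q N"
  by (simp add: hsubst_def smult_add_left sum.distrib split: prod.splits)

lemma hsubst_smult: "hsubst k (smult a p) N = smult a (hsubst k p N)"
  by (cases N) (simp add: hsubst_def smult_sum2)

section \<open>The matrix of a substitution and its determinant\<close>

lemma hsubst_monom:
  assumes "i \<le> k"
  shows "hsubst k (monom 1 i) (a, b, c, e) = [:b, a:] ^ i * [:e, c:] ^ (k - i)"
proof -
  have "hsubst k (monom 1 i) (a, b, c, e)
      = (\<Sum>j\<le>k. if j = i then [:b, a:] ^ j * [:e, c:] ^ (k - j) else 0)"
    unfolding hsubst_def prod.case by (rule sum.cong) auto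
  then show ?thesis using assms by simp
qed

lemma hsubst_conv_monom: "hsubst k p N = (\<Sum>i\<le>k. smult (coeff p i) (hsubst k (monom 1 i) N))"
  by (cases N) (simp add: hsubst_monom, simp add: hsubst_def)

text \<open>The matrix of the symmetric power of the substitution, on forms of degree n - 1 with
  coefficients listed from the top, as in the Sylvester matrix.\<close>
definition sym_mat :: "nat \<Rightarrow> 'a::comm_ring_1 mob \<Rightarrow> 'a mat" where
  "sym_mat n N = mat n n (\<lambda>(i, j). coeff (hsubst (n - 1) (monom 1 (n - 1 - i)) N) (n - 1 - j))"

lemma sym_mat_carrier[simp]: "sym_mat n N \<in> carrier_mat n n"
  and dim_sym_mat[simp]: "dim_row (sym_mat n N) = n" "dim_col (sym_mat n N) = n"
  by (simp_all add: sym_mat_def)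

text \<open>With forms as row vectors, right multiplication by \<open>sym_mat\<close> performs the
  substitution.\<close>

lemma sym_mat_row_sum:
  assumes "j < n"
  shows "(\<Sum>i<n. coeff p (n - 1 - i) * sym_mat n N $$ (i, j)) = coeff (hsubst (n - 1) p N) (n - 1 - j)"
proof -
  have "coeff (hsubst (n - 1) p N) (n - 1 - j)
      = (\<Sum>i<n. coeff p i * coeff (hsubst (n - 1) (monom 1 i) N) (n - 1 - j))"
    using assms by (subst hsubst_conv_monom) (simp add: coeff_sum lessThan_Suc_atMost[symmetric])
  also have "\<dots> = (\<Sum>i<n. coeff p (n - 1 - i) * sym_mat n N $$ (i, j))"
    using assms by (subst sum.nat_diff_reindex[symmetric]) (auto simp: sym_mat_def intro!: sum.cong)
  finally show ?thesis by simp
qed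

lemma sym_mat_mult:
  fixes N N' :: "'a::field_char_0 mob"
  shows "sym_mat n N * sym_mat n N' = sym_mat n (mob_mul N N')"
proof (rule eq_matI)
  fix i j assume "i < dim_row (sym_mat n (mob_mul N N'))" "j < dim_col (sym_mat n (mob_mul N N'))"
  then have ij: "i < n" "j < n" by simp_all
  have "(sym_mat n N * sym_mat n N') $$ (i, j) = (\<Sum>l<n. sym_mat n N $$ (i, l) * sym_mat n N' $$ (l, j))"
    using ij by (simp add: scalar_prod_def atLeast0LessThan)
  also have "\<dots> = (\<Sum>l<n. coeff (hsubst (n - 1) (monom 1 (n - 1 - i)) N) (n - 1 - l) * sym_mat n N' $$ (l, j))"
    using ij by (intro sum.cong) (auto simp: sym_mat_def)
  also have "\<dots> = sym_mat n (mob_mul N N') $$ (i, j)"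
    unfolding sym_mat_row_sum[OF ij(2)] hsubst_hsubst using ij by (simp add: sym_mat_def)
  finally show "(sym_mat n N * sym_mat n N') $$ (i, j) = sym_mat n (mob_mul N N') $$ (i, j)" .
qed simp_all

lemma coeff_linear_power_mult_low:
  fixes a c e :: "'a::comm_ring_1"
  shows "coeff ([:0, a:] ^ i * [:e, c:] ^ j) l = (if l < i then 0 else a ^ i * coeff ([:e, c:] ^ j) (l - i))"
proof -
  have "[:0, a:] ^ i = monom (a ^ i) i"
    by (metis monom_0 monom_Suc monom_power mult_1 One_nat_def)
  then show ?thesis by (simp add: coeff_monom_mult)
qed

text \<open>The exponents of x run down and those of y run up through 0, ..., n - 1, so both add up
  to n(n-1)/2.\<close>

lemma prod_list_diag_sym_mat:
  fixes x y :: "'a::comm_ring_1"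
  assumes "\<And>i. i < n \<Longrightarrow> A $$ (i, i) = x ^ (n - 1 - i) * y ^ i" "A \<in> carrier_mat n n"
  shows "prod_list (diag_mat A) = (x * y) ^ (n * (n - 1) div 2)"
proof -
  have g: "(\<Sum>i<n. i) = n * (n - 1) div 2"
  proof -
    have "2 * (\<Sum>i<n. i) = n * (n - 1)"
    proof (induction n)
      case (Suc n)
      then show ?case by (cases n) auto
    qed simp
    then show ?thesis by linarith
  qed
  have "prod_list (diag_mat A) = (\<Prod>i<n. A $$ (i, i))"
    using assms(2) by (simp add: diag_mat_def prod.list_conv_set_nth atLeast0LessThan)
  also have "\<dots> = (\<Prod>i<n. x ^ (n - 1 - i)) * (\<Prod>i<n. y ^ i)"
    using assms(1) by (simp add: prod.distrib)
  also have "(\<Prod>i<n. x ^ (n - 1 - i)) = (\<Prod>i<n. x ^ i)"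
    using prod.nat_diff_reindex[of "\<lambda>i. x ^ i" n] by simp
  finally show ?thesis by (simp add: power_sum[symmetric] g power_mult_distrib)
qed

text \<open>For c = 0 the second variable is only rescaled. The image of z0^(n-1-i) z1^i is then
  still divisible by z1^i, which makes the matrix triangular.\<close>

lemma det_sym_mat_upper: "det (sym_mat n (a, b, 0, e :: 'a::comm_ring_1)) = (a * e) ^ (n * (n - 1) div 2)"
proof -
  have c: "sym_mat n (a, b, 0, e) $$ (i, j) = coeff ([:b, a:] ^ (n - 1 - i)) (n - 1 - j) * e ^ i"
    if "i < n" "j < n" for i j
  proof -
    have "[:e:] ^ i = [:e ^ i:]" by (induction i) (auto simp: one_pCons)
    then show ?thesis using that by (simp add: sym_mat_def hsubst_monom mult.commute)
  qed
  have deg: "degree ([:b, a:] ^ i) \<le> i" for i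
    using degree_linear_power_mult[where j = 0] by simp
  have "det (sym_mat n (a, b, 0, e)) = prod_list (diag_mat (sym_mat n (a, b, 0, e)))"
  proof (rule det_upper_triangular[where n = n])
    show "upper_triangular (sym_mat n (a, b, 0, e))"
      unfolding upper_triangular_def
    proof (intro allI impI)
      fix i j assume "i < dim_row (sym_mat n (a, b, 0, e))" "j < i"
      then have "i < n" "j < i" by simp_all
      then have "degree ([:b, a:] ^ (n - 1 - i)) < n - 1 - j"
        using deg[of "n - 1 - i"] by linarith
      then show "sym_mat n (a, b, 0, e) $$ (i, j) = 0"
        using c \<open>i < n\<close> \<open>j < i\<close> by (simp add: coeff_eq_0)
    qed
  qed simp
  also have "\<dots> = (a * e) ^ (n * (n - 1) div 2)"
  proof (rule prod_list_diag_sym_mat)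
    have "coeff ([:b, a:] ^ i) i = a ^ i" for i
    proof (induction i)
      case (Suc i)
      have "coeff ([:b, a:] * [:b, a:] ^ i) (1 + i) = coeff [:b, a:] 1 * coeff ([:b, a:] ^ i) i"
        by (rule coeff_mult_top[OF degree_linear deg])
      with Suc show ?case by (simp del: mult_pCons_left)
    qed simp
    then show "sym_mat n (a, b, 0, e) $$ (i, i) = a ^ (n - 1 - i) * e ^ i" if "i < n" for i
      using c that by simp
  qed simp
  finally show ?thesis .
qed

lemma det_sym_mat_lower: "det (sym_mat n (a, 0, c, e :: 'a::comm_ring_1)) = (a * e) ^ (n * (n - 1) div 2)"
proof -
  have c: "sym_mat n (a, 0, c, e) $$ (i, j) =
      (if i < j then 0 else a ^ (n - 1 - i) * coeff ([:e, c:] ^ i) (i - j))"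
    if "i < n" "j < n" for i j
  proof -
    have "n - Suc j < n - Suc i \<longleftrightarrow> i < j" "n - Suc j - (n - Suc i) = i - j"
      using that by linarith+
    then show ?thesis using that by (simp add: sym_mat_def hsubst_monom coeff_linear_power_mult_low)
  qed
  have "det (sym_mat n (a, 0, c, e)) = prod_list (diag_mat (sym_mat n (a, 0, c, e)))"
    by (rule det_lower_triangular[where n = n]) (simp_all add: c)
  also have "\<dots> = (a * e) ^ (n * (n - 1) div 2)"
    by (rule prod_list_diag_sym_mat) (simp_all add: c coeff_0_power)
  finally show ?thesis .
qed

text \<open>Multiplicativity reduces the claim to an upper times lower triangular factorisation of
  N, available when its last entry is nonzero.\<close>

lemma det_sym_mat:
  fixes N :: "'a::field_char_0 mob"
  assumes "mob_det N \<noteq> 0"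
  shows "det (sym_mat n N) = mob_det N ^ (n * (n - 1) div 2)"
proof -
  have mult: "det (sym_mat n (mob_mul N N')) = det (sym_mat n N) * det (sym_mat n N')" for N N' :: "'a mob"
    by (simp add: det_mult[of _ n] flip: sym_mat_mult)
  have nz: "det (sym_mat n (a, b, c, e)) = (a * e - b * c) ^ (n * (n - 1) div 2)" if "e \<noteq> 0" for a b c e :: 'a
  proof -
    have "mob_mul (a - b * c / e, b / e, 0, 1) (1, 0, c, e) = (a, b, c, e)"
      using that by simp
    then have "det (sym_mat n (a, b, c, e)) = (a - b * c / e) ^ (n * (n - 1) div 2) * e ^ (n * (n - 1) div 2)"
      using mult[of "(a - b * c / e, b / e, 0, 1)" "(1, 0, c, e)"]
      by (simp add: det_sym_mat_upper det_sym_mat_lower)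
    also have "\<dots> = ((a - b * c / e) * e) ^ (n * (n - 1) div 2)"
      by (rule power_mult_distrib[symmetric])
    also have "(a - b * c / e) * e = a * e - b * c"
      using that by (simp add: field_simps)
    finally show ?thesis .
  qed
  obtain a b c e where N: "N = (a, b, c, e)" by (cases N)
  show ?thesis
  proof (cases "e = 0")
    case True
    then have "c \<noteq> 0" using assms N by auto
    \<comment> \<open>A unipotent factor moves c, nonzero here, into the last entry and leaves both
      determinants unchanged.\<close>
    moreover have "det (sym_mat n (mob_mul N (1, 1, 0, 1))) = det (sym_mat n N)"
      by (simp add: mult det_sym_mat_upper)
    ultimately show ?thesis using True nz[of c a "a + b" c] by (simp add: N algebra_simps)
  qed (simp add: N nz)
qed

section \<open>Transformation of the Sylvester matrix and the resultant\<close>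

lemma sylvester_upper:
  fixes p q :: "'a::comm_ring_1 poly"
  assumes "degree p \<le> d" "i < d" "j < d + d"
  shows "sylvester_mat_sub d d p q $$ (i, j) = coeff (monom 1 (d - 1 - i) * p) (2 * d - 1 - j)"
proof -
  have "2 * d - 1 - j < d - 1 - i \<longleftrightarrow> \<not> j - i \<le> d \<and> i \<le> j"
       "i \<le> j \<Longrightarrow> j - i \<le> d \<Longrightarrow> 2 * d - 1 - j - (d - 1 - i) = d + i - j"
       "\<not> i \<le> j \<Longrightarrow> degree p < 2 * d - 1 - j - (d - 1 - i)"
    using assms by linarith+
  then show ?thesis
    using assms by (auto simp: sylvester_mat_sub_index coeff_monom_mult coeff_eq_0)
qed

lemma sylvester_lower:
  fixes p q :: "'a::comm_ring_1 poly"
  assumes "degree q \<le> d" "i < d" "j < d + d"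
  shows "sylvester_mat_sub d d p q $$ (i + d, j) = coeff (monom 1 (d - 1 - i) * q) (2 * d - 1 - j)"
proof -
  have "2 * d - 1 - j < d - 1 - i \<longleftrightarrow> \<not> j \<le> i + d"
       "i \<le> j \<Longrightarrow> j \<le> i + d \<Longrightarrow> 2 * d - 1 - j - (d - 1 - i) = i + d - j"
       "\<not> i \<le> j \<Longrightarrow> degree q < 2 * d - 1 - j - (d - 1 - i)"
    using assms by linarith+
  then show ?thesis
    using assms by (auto simp: sylvester_mat_sub_index coeff_monom_mult coeff_eq_0)
qed

lemma sum_lessThan_double:
  fixes g :: "nat \<Rightarrow> 'a::comm_monoid_add"
  shows "(\<Sum>l<d + d. g l) = (\<Sum>l<d. g l) + (\<Sum>l<d. g (l + d))"
proof -
  have "sum g {0..<d + d} = sum g {0..<d} + sum g {0 + d..<d + d}"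
    by (simp add: sum.atLeastLessThan_concat)
  then show ?thesis
    by (simp only: sum.shift_bounds_nat_ivl atLeast0LessThan)
qed

text \<open>The rows of the Sylvester matrix are p and q times the monomials of degree d - 1, as
  forms of degree 2d - 1. Substituting in a product substitutes in both factors: the change of the
  monomials is a block diagonal matrix on the left, the change of p and q a new Sylvester
  matrix.\<close>

lemma sylvester_hsubst:
  fixes p q :: "'a::field_char_0 poly"
  assumes "degree p \<le> d" "degree q \<le> d"
  shows "sylvester_mat_sub d d p q * sym_mat (d + d) N
    = four_block_mat (sym_mat d N) (0\<^sub>m d d) (0\<^sub>m d d) (sym_mat d N)
      * sylvester_mat_sub d d (hsubst d p N) (hsubst d q N)" (is "?S * _ = ?B * ?T")
proof (rule eq_matI)
  have key: "(\<Sum>l<d + d. coeff (monom 1 (d - 1 - i) * r) (d + d - 1 - l) * sym_mat (d + d) N $$ (l, j))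
      = (\<Sum>l<d. sym_mat d N $$ (i, l) * coeff (monom 1 (d - 1 - l) * hsubst d r N) (2 * d - 1 - j))"
    if i: "i < d" and j: "j < d + d" and r: "degree r \<le> d" for r i j
  proof -
    let ?m = "monom (1::'a) (d - 1 - i)"
    have "(\<Sum>l<d + d. coeff (?m * r) (d + d - 1 - l) * sym_mat (d + d) N $$ (l, j))
        = coeff (hsubst (d - 1 + d) (?m * r) N) (2 * d - 1 - j)"
      using sym_mat_row_sum[OF j, of "?m * r" N] i by (simp add: mult_2 add.commute)
    also have "\<dots> = coeff (hsubst (d - 1) ?m N * hsubst d r N) (2 * d - 1 - j)"
      using r by (subst hsubst_mult) (simp_all add: degree_monom_eq)
    also have "hsubst (d - 1) ?m N = (\<Sum>l\<le>d - 1. monom (coeff (hsubst (d - 1) ?m N) l) l)"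
      by (rule poly_as_sum_of_monoms'[symmetric]) (rule degree_hsubst)
    also have "\<dots> = (\<Sum>l<d. monom (coeff (hsubst (d - 1) ?m N) l) l)"
      using i by (simp add: lessThan_Suc_atMost[symmetric])
    also have "\<dots> = (\<Sum>l<d. smult (sym_mat d N $$ (i, l)) (monom 1 (d - 1 - l)))"
      using i by (subst sum.nat_diff_reindex[symmetric]) (auto simp: sym_mat_def smult_monom intro!: sum.cong)
    finally show ?thesis by (simp add: sum_distrib_right coeff_sum)
  qed
  fix i j assume "i < dim_row (?B * ?T)" "j < dim_col (?B * ?T)"
  then have ij: "i < d + d" "j < d + d" by simp_all
  have L: "(?S * sym_mat (d + d) N) $$ (i, j) = (\<Sum>l<d + d. ?S $$ (i, l) * sym_mat (d + d) N $$ (l, j))"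
    using ij by (simp add: scalar_prod_def atLeast0LessThan)
  have R: "(?B * ?T) $$ (i, j) = (\<Sum>l<d. ?B $$ (i, l) * ?T $$ (l, j)) + (\<Sum>l<d. ?B $$ (i, l + d) * ?T $$ (l + d, j))"
    using ij by (simp add: scalar_prod_def atLeast0LessThan sum_lessThan_double)
  show "(?S * sym_mat (d + d) N) $$ (i, j) = (?B * ?T) $$ (i, j)"
  proof (cases "i < d")
    case True
    then show ?thesis unfolding L R
      using ij key[of i j p] assms by (simp add: sylvester_upper degree_hsubst mult_2)
  next
    case False
    then obtain i' where i': "i = i' + d" "i' < d" using ij by (metis add.commute le_add_diff_inverse not_less nat_add_left_cancel_less)
    then show ?thesis unfolding L R
      using ij key[of i' j q] assms by (simp add: sylvester_lower degree_hsubst mult_2)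
  qed
qed simp_all

text \<open>Taking determinants in \<open>sylvester_hsubst\<close> gives the exponent d(2d-1) on one
  side and twice d(d-1)/2 on the other; the difference is d^2.\<close>

lemma hres_hsubst:
  fixes p q :: "'a::field_char_0 poly"
  assumes "degree p \<le> d" "degree q \<le> d" "mob_det N \<noteq> 0"
  shows "hres d (hsubst d p N) (hsubst d q N) = mob_det N ^ (d * d) * hres d p q"
proof -
  let ?D = "mob_det N"
  define t where "t = d * (d - 1)"
  have "hres d p q * det (sym_mat (d + d) N)
      = det (four_block_mat (sym_mat d N) (0\<^sub>m d d) (0\<^sub>m d d) (sym_mat d N)) * hres d (hsubst d p N) (hsubst d q N)"
    unfolding hres_def resultant_sub_def
    using arg_cong[OF sylvester_hsubst[OF assms(1,2), of N], of det]
    by (simp add: det_mult[of _ "d + d"] sylvester_mat_sub_carrier)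
  moreover have "det (four_block_mat (sym_mat d N) (0\<^sub>m d d) (0\<^sub>m d d) (sym_mat d N)) = ?D ^ t"
  proof -
    have "even t" unfolding t_def by (cases d) auto
    then have "t div 2 + t div 2 = t" by presburger
    then show ?thesis
      by (subst det_four_block_mat_lower_left_zero[of _ d _ d])
        (simp_all add: det_sym_mat assms t_def flip: power_add)
  qed
  moreover have "det (sym_mat (d + d) N) = ?D ^ t * ?D ^ (d * d)"
  proof -
    have "(d + d) * (d + d - 1) div 2 = t + d * d"
      by (cases d) (simp_all add: t_def algebra_simps)
    then show ?thesis by (simp add: det_sym_mat assms power_add)
  qed
  ultimately show ?thesis using assms(3) by (simp add: mult.commute)
qed

text \<open>Mixing p and q mixes the two halves of the rows of the Sylvester matrix, by a block
  matrix whose four blocks are commuting scalar matrices.\<close>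

lemma hres_mix:
  fixes p q :: "'a::idom poly"
  shows "hres d (smult a p + smult b q) (smult c p + smult e q) = (a * e - b * c) ^ d * hres d p q"
proof -
  let ?I = "1\<^sub>m d :: 'a mat"
  let ?B = "four_block_mat (a \<cdot>\<^sub>m ?I) (b \<cdot>\<^sub>m ?I) (c \<cdot>\<^sub>m ?I) (e \<cdot>\<^sub>m ?I)"
  let ?S = "sylvester_mat_sub d d p q"
  let ?T = "sylvester_mat_sub d d (smult a p + smult b q) (smult c p + smult e q)"
  have "?T = ?B * ?S"
  proof (rule eq_matI)
    fix i j assume "i < dim_row (?B * ?S)" "j < dim_col (?B * ?S)"
    then have ij: "i < d + d" "j < d + d" by simp_all
    have R: "(?B * ?S) $$ (i, j) = (\<Sum>l<d. ?B $$ (i, l) * ?S $$ (l, j)) + (\<Sum>l<d. ?B $$ (i, l + d) * ?S $$ (l + d, j))"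
      using ij by (simp add: scalar_prod_def atLeast0LessThan sum_lessThan_double)
    have delta: "(\<Sum>l<d. (x * (if i' = l then 1 else 0)) * g l) = x * g i'" if "i' < d" for i' x and g :: "nat \<Rightarrow> 'a"
    proof -
      have "(\<Sum>l<d. (x * (if i' = l then 1 else 0)) * g l) = (\<Sum>l<d. if l = i' then x * g l else 0)"
        by (rule sum.cong) auto
      then show ?thesis using that by simp
    qed
    show "?T $$ (i, j) = (?B * ?S) $$ (i, j)"
    proof (cases "i < d")
      case True
      then show ?thesis unfolding R using ij
        by (simp add: delta) (auto simp: sylvester_mat_sub_index add.commute)
    next
      case False
      then obtain i' where i': "i = i' + d" "i' < d" using ij by (metis add.commute le_add_diff_inverse not_less nat_add_left_cancel_less)
      then show ?thesis unfolding R using ij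
        by (simp add: delta) (auto simp: sylvester_mat_sub_index add.commute)
    qed
  qed simp_all
  then have "hres d (smult a p + smult b q) (smult c p + smult e q) = det ?B * hres d p q"
    unfolding hres_def resultant_sub_def by (simp add: det_mult[of _ "d + d"] sylvester_mat_sub_carrier)
  moreover have "det ?B = det ((a * e - b * c) \<cdot>\<^sub>m ?I)"
  proof -
    have "(a \<cdot>\<^sub>m ?I) * (e \<cdot>\<^sub>m ?I) - (b \<cdot>\<^sub>m ?I) * (c \<cdot>\<^sub>m ?I) = (a * e - b * c) \<cdot>\<^sub>m ?I"
      by (rule eq_matI) auto
    moreover have "(c \<cdot>\<^sub>m ?I) * (e \<cdot>\<^sub>m ?I) = (e \<cdot>\<^sub>m ?I) * (c \<cdot>\<^sub>m ?I)"
      by (rule eq_matI) auto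
    ultimately show ?thesis by (subst det_four_block_mat[of _ d]) simp_all
  qed
  ultimately show ?thesis by simp
qed

lemma hres_smult: "hres d (smult (a::'a::idom) p) (smult a q) = a ^ (2 * d) * hres d p q"
  using hres_mix[of d a p 0 q 0 a] by (simp add: power_mult power2_eq_square)

section \<open>Conjugation of pairs of forms\<close>

lemma mob_det_adj[simp]: "mob_det (mob_adj N) = mob_det N"
  by (cases N) (simp add: mult.commute)

lemma mob_det_mul: "mob_det (mob_mul N N') = mob_det N * mob_det N'"
  by (cases N; cases N') (simp add: algebra_simps)

lemma degree_mconj: "degree (fst (mconj k N g)) \<le> k" "degree (snd (mconj k N g)) \<le> k"
  by (cases N; cases g; auto simp: Let_def
      intro!: degree_add_le order_trans[OF degree_smult_le] degree_hsubst)+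

text \<open>The precomposition with the adjugate, which has the same determinant, contributes d^2 to
  the exponent and the postcomposition contributes d.\<close>

lemma hres_mconj:
  fixes g :: "'a::field_char_0 poly \<times> 'a poly"
  assumes "degree (fst g) \<le> d" "degree (snd g) \<le> d" "mob_det N \<noteq> 0"
  shows "hres d (fst (mconj d N g)) (snd (mconj d N g)) = mob_det N ^ (d * d + d) * hres d (fst g) (snd g)"
proof -
  obtain a b c e where N: "N = (a, b, c, e)" by (cases N)
  obtain p q where g: "g = (p, q)" by (cases g)
  have "mob_det (mob_adj N) \<noteq> 0" using assms(3) by simp
  from hres_hsubst[OF assms(1,2) this] show ?thesis
    by (simp add: N g Let_def hres_mix power_add mult_ac)
qed

lemma mconj_smult: "mconj k N (smult t p, smult t q)
    = (smult t (fst (mconj k N (p, q))), smult t (snd (mconj k N (p, q))))"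
  by (cases N) (simp add: Let_def hsubst_smult smult_add_right mult.commute)

lemma mconj_mconj:
  fixes g :: "'a::field_char_0 poly \<times> 'a poly"
  shows "mconj k N (mconj k N' g) = mconj k (mob_mul N N') g"
proof -
  obtain a b c e where N: "N = (a, b, c, e)" by (cases N)
  obtain a' b' c' e' where N': "N' = (a', b', c', e')" by (cases N')
  obtain p q where g: "g = (p, q)" by (cases g)
  have "mob_mul (mob_adj N') (mob_adj N) = mob_adj (mob_mul N N')"
    by (simp add: N N' algebra_simps)
  then have *: "hsubst k (hsubst k r (mob_adj N')) (mob_adj N) = hsubst k r (mob_adj (mob_mul N N'))" for r
    by (simp add: hsubst_hsubst)
  show ?thesis
    using *[of p] *[of q]
    by (simp add: N N' g Let_def hsubst_add hsubst_smult smult_add_right smult_add_left algebra_simps)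
qed

text \<open>Because \<open>mob_adj\<close> inverts only up to the scalar \<open>mob_det\<close>,
  conjugating back does not return the same pair of forms. The factor is t^k from the substitution
  times t from the postcomposition.\<close>

lemma mconj_scalar:
  assumes "degree p \<le> k" "degree q \<le> k"
  shows "mconj k (t, 0, 0, t) (p, q) = (smult (t ^ (k + 1)) p, smult (t ^ (k + 1)) q)"
proof -
  have *: "hsubst k r (t, 0, 0, t) = smult (t ^ k) r" if "degree r \<le> k" for r
  proof -
    have m: "[:0, t:] ^ i * [:t, 0:] ^ (k - i) = monom (t ^ k) i" if "i \<le> k" for i
    proof -
      have "[:0, t:] ^ i = monom (t ^ i) i" "[:t:] ^ (k - i) = monom (t ^ (k - i)) 0"
        by (metis monom_0 monom_Suc monom_power mult_1 One_nat_def, metis monom_0 monom_power mult_0)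
      then show ?thesis using that by (simp add: mult_monom flip: power_add)
    qed
    have "hsubst k r (t, 0, 0, t) = (\<Sum>i\<le>k. smult (t ^ k) (monom (coeff r i) i))"
      unfolding hsubst_def prod.case
      by (rule sum.cong) (simp_all only: m atMost_iff smult_monom mult.commute)
    also have "\<dots> = smult (t ^ k) r"
      by (simp add: poly_as_sum_of_monoms'[OF that] flip: smult_sum2)
    finally show ?thesis .
  qed
  show ?thesis using assms by (simp add: * mult.commute)
qed

lemma mob_mul_scalar: "mob_mul (t, 0, 0, t) (a, b, c, e) = (t * a, t * b, t * c, t * e)"
  by simp

lemma mob_mul_adj_left: "mob_mul (mob_adj N) N = (mob_det N, 0, 0, mob_det N)"
  by (cases N) (simp add: algebra_simps)

lemma mob_mul_assoc: "mob_mul (mob_mul N N') N'' = mob_mul N (mob_mul N' N'')"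
  by (cases N; cases N'; cases N'') (simp add: algebra_simps)

lemma mob_mul_scalar_commute: "mob_mul N (t, 0, 0, t) = mob_mul (t, 0, 0, t) N"
  by (cases N) (simp add: mult.commute)

text \<open>The Sylvester matrix maps the vector of monomials at (z, w) to multiples of the values of p and q,
  so its adjugate expresses the resultant through these values.\<close>
lemma hres_eval:
  fixes p q :: "'a::field poly"
  assumes "degree p \<le> d" "degree q \<le> d" "l < d + d"
  defines "A \<equiv> adj_mat (sylvester_mat_sub d d p q)"
  shows "hres d p q * (z ^ (2 * d - 1 - l) * w ^ l) =
    (\<Sum>i<d. A $$ (l, i) * (z ^ (d - 1 - i) * w ^ i * form_eval d p z w))
    + (\<Sum>i<d. A $$ (l, i + d) * (z ^ (d - 1 - i) * w ^ i * form_eval d q z w))"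
proof -
  let ?S = "sylvester_mat_sub d d p q"
  let ?v = "vec (d + d) (\<lambda>j. z ^ (2 * d - 1 - j) * w ^ j)"
  have S: "?S \<in> carrier_mat (d + d) (d + d)" by (rule sylvester_mat_sub_carrier)
  note A = adj_mat[OF S, folded A_def]
  have row: "(\<Sum>j<d + d. coeff (monom 1 (d - 1 - i) * r) (2 * d - 1 - j) * (z ^ (2 * d - 1 - j) * w ^ j))
      = z ^ (d - 1 - i) * w ^ i * form_eval d r z w" if "i < d" "degree r \<le> d" for r i
  proof -
    let ?m = "monom (1::'a) (d - 1 - i)"
    have "(\<Sum>j<d + d. coeff (?m * r) (2 * d - 1 - j) * (z ^ (2 * d - 1 - j) * w ^ j))
        = (\<Sum>j<d + d. coeff (?m * r) j * z ^ j * w ^ (d - 1 + d - j))"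
    proof -
      have "d - 1 + d - (d + d - Suc j) = j" if "j < d + d" for j using that \<open>i < d\<close> by linarith
      then show ?thesis
        unfolding mult_2
        by (subst (2) sum.nat_diff_reindex[symmetric]) (auto simp: mult_ac intro!: sum.cong)
    qed
    also have "\<dots> = form_eval (d - 1 + d) (?m * r) z w"
      using that by (simp add: form_eval_def lessThan_Suc_atMost[symmetric])
    also have "\<dots> = form_eval (d - 1) ?m z w * form_eval d r z w"
      using that by (subst form_eval_mult) (auto simp: degree_monom_eq)
    also have "form_eval (d - 1) ?m z w = (\<Sum>j\<in>{d - 1 - i}. coeff ?m j * z ^ j * w ^ (d - 1 - j))"
      unfolding form_eval_def by (rule sum.mono_neutral_right) auto
    finally show ?thesis using that by simp
  qed
  have Sv: "(?S *\<^sub>v ?v) $ i = (\<Sum>j<d + d. ?S $$ (i, j) * (z ^ (2 * d - 1 - j) * w ^ j))" if "i < d + d" for i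
    using that by (simp add: scalar_prod_def atLeast0LessThan)
  have up: "(?S *\<^sub>v ?v) $ i = z ^ (d - 1 - i) * w ^ i * form_eval d p z w" if "i < d" for i
    unfolding row[OF that assms(1), symmetric] using that assms(1) by (subst Sv) (auto simp: sylvester_upper intro!: sum.cong)
  have lo: "(?S *\<^sub>v ?v) $ (i + d) = z ^ (d - 1 - i) * w ^ i * form_eval d q z w" if "i < d" for i
    unfolding row[OF that assms(2), symmetric] using that assms(2) by (subst Sv) (auto simp: sylvester_lower intro!: sum.cong)
  have "(hres d p q \<cdot>\<^sub>m 1\<^sub>m (d + d)) *\<^sub>v ?v = A *\<^sub>v (?S *\<^sub>v ?v)"
    unfolding hres_def resultant_sub_def A(3)[symmetric]
    using A(1) S by (intro assoc_mult_mat_vec) auto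
  then have "((hres d p q \<cdot>\<^sub>m 1\<^sub>m (d + d)) *\<^sub>v ?v) $ l = (A *\<^sub>v (?S *\<^sub>v ?v)) $ l" by simp
  moreover have "(A *\<^sub>v (?S *\<^sub>v ?v)) $ l = (\<Sum>i<d + d. A $$ (l, i) * (?S *\<^sub>v ?v) $ i)"
    using A(1) assms(3) by (simp add: scalar_prod_def atLeast0LessThan)
  moreover have "((hres d p q \<cdot>\<^sub>m 1\<^sub>m (d + d)) *\<^sub>v ?v) $ l = hres d p q * (z ^ (2 * d - 1 - l) * w ^ l)"
  proof -
    have "((hres d p q \<cdot>\<^sub>m 1\<^sub>m (d + d)) *\<^sub>v ?v) $ l
        = (\<Sum>j<d + d. hres d p q * (if j = l then 1 else 0) * (z ^ (2 * d - 1 - j) * w ^ j))"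
      using assms(3) by (simp add: scalar_prod_def atLeast0LessThan)
    also have "\<dots> = (\<Sum>j<d + d. if j = l then hres d p q * (z ^ (2 * d - 1 - j) * w ^ j) else 0)"
      by (rule sum.cong) auto
    finally show ?thesis using assms(3) by simp
  qed
  moreover have "(\<Sum>i<d + d. A $$ (l, i) * (?S *\<^sub>v ?v) $ i)
      = (\<Sum>i<d. A $$ (l, i) * (z ^ (d - 1 - i) * w ^ i * form_eval d p z w))
    + (\<Sum>i<d. A $$ (l, i + d) * (z ^ (d - 1 - i) * w ^ i * form_eval d q z w))"
    unfolding sum_lessThan_double
    by (intro arg_cong2[where f = "(+)"] sum.cong refl) (simp_all only: up lo lessThan_iff)
  ultimately show ?thesis by (simp only:)
qed

section \<open>Limits along the ultrafilter\<close>

lemma powr_add_subadditive: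
  fixes a b e :: real
  assumes "0 \<le> a" "0 \<le> b" "0 < e" "e \<le> 1"
  shows "(a + b) powr e \<le> a powr e + b powr e"
proof (cases "a + b = 0")
  case True
  then show ?thesis using assms by simp
next
  case False
  define s where "s = a + b"
  have s: "s > 0" using False assms by (simp add: s_def)
  \<comment> \<open>After division by a + b both summands lie in [0, 1], where a power with exponent
    at most 1 only increases them.\<close>
  have *: "x \<le> x powr e" if "0 \<le> x" "x \<le> 1" for x :: real
    using powr_mono'[OF assms(4) that] that by simp
  have "1 = a / s + b / s" using s by (simp add: s_def flip: add_divide_distrib)
  also have "\<dots> \<le> (a / s) powr e + (b / s) powr e"
    using s assms by (intro add_mono *) (auto simp: s_def)
  also have "\<dots> = (a powr e + b powr e) / s powr e"
    using s assms by (simp add: powr_divide add_divide_distrib)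
  finally show ?thesis using s by (simp add: s_def field_simps)
qed

lemma tendsto_Max:
  fixes f :: "'i \<Rightarrow> 'b \<Rightarrow> real"
  assumes "finite I" "I \<noteq> {}" "\<And>i. i \<in> I \<Longrightarrow> (f i \<longlongrightarrow> l i) F"
  shows "((\<lambda>x. Max ((\<lambda>i. f i x) ` I)) \<longlongrightarrow> Max (l ` I)) F"
  using assms
proof (induction I rule: finite_ne_induct)
  case (insert i I)
  then have "((\<lambda>x. max (f i x) (Max ((\<lambda>i. f i x) ` I))) \<longlongrightarrow> max (l i) (Max (l ` I))) F"
    by (intro tendsto_max) auto
  then show ?case using insert by simp
qed simp

lemma cmax_ge:
  assumes "i \<le> k"
  shows "cmod (coeff (fst g) i) \<le> cmax k g" "cmod (coeff (snd g) i) \<le> cmax k g"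
  using assms unfolding cmax_def by (auto intro!: Max_ge)

lemma cmax_nonneg: "0 \<le> cmax k g"
  using cmax_ge(1)[of 0 k g] norm_ge_zero order_trans by blast

lemma cmax_le:
  assumes "\<And>i. i \<le> k \<Longrightarrow> cmod (coeff (fst g) i) \<le> B" "\<And>i. i \<le> k \<Longrightarrow> cmod (coeff (snd g) i) \<le> B"
  shows "cmax k g \<le> B"
  unfolding cmax_def using assms by (subst Max_le_iff) auto

text \<open>A power with nonnegative exponent is monotone and so commutes with the maximum. This
  links \<open>cmax\<close> to the maximum of the norms of the coefficients over the field.\<close>

lemma cmax_powr:
  assumes "0 \<le> e"
  shows "cmax k g powr e = Max ((\<lambda>i. cmod (coeff (fst g) i) powr e) ` {..k} \<union> (\<lambda>i. cmod (coeff (snd g) i) powr e) ` {..k})"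
proof -
  let ?S = "(\<lambda>i. cmod (coeff (fst g) i)) ` {..k} \<union> (\<lambda>i. cmod (coeff (snd g) i)) ` {..k}"
  have "cmax k g \<in> ?S" unfolding cmax_def by (rule Max_in) auto
  then have "cmax k g powr e \<in> (\<lambda>x. x powr e) ` ?S" by blast
  then have "cmax k g powr e = Max ((\<lambda>x. x powr e) ` ?S)"
    using assms by (intro Max_eqI[symmetric]) (auto intro!: powr_mono2 cmax_ge)
  then show ?thesis by (simp add: image_Un image_image)
qed

lemma theta_pos: "0 < s \<Longrightarrow> 0 < theta s"
  and theta_le_1: "0 < s \<Longrightarrow> theta s \<le> 1"
proof -
  have "ln s \<le> -1" if "0 < s" "s \<le> exp (-1)" using that
    by (metis ln_exp ln_mono exp_gt_zero)
  moreover have "0 < - 1 / x \<and> - 1 / x \<le> 1" if "x \<le> -1" for x :: real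
    using that divide_neg_neg[of "-1" x] neg_divide_le_eq[of x "-1" 1] by simp
  ultimately have *: "0 < - 1 / ln s \<and> - 1 / ln s \<le> 1" if "0 < s" "s \<le> exp (-1)"
    using that by blast
  show "0 < s \<Longrightarrow> 0 < theta s" "0 < s \<Longrightarrow> theta s \<le> 1"
    using * by (auto simp: theta_def)
qed

lemma theta_small:
  assumes "0 < s" "s \<le> exp (-1)"
  shows "s = exp (- 1 / theta s)"
  using assms by (simp add: theta_def)

lemma theta_less_1_imp: "theta s < 1 \<Longrightarrow> s \<le> exp (-1)"
  by (auto simp: theta_def split: if_splits)

lemma exp_theta_le:
  assumes "0 < s"
  shows "exp (- 1 / theta s) \<le> s"
  using theta_small[OF assms] by (cases "s \<le> exp (-1)") (auto simp: theta_def)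

lemma theta_mono:
  assumes "0 < s" "s \<le> t"
  shows "theta s \<le> theta t"
proof (cases "t \<le> exp (-1)")
  case True
  then have "exp (- 1 / theta s) \<le> exp (- 1 / theta t)"
    using theta_small[of s] theta_small[of t] assms by simp
  then have "1 / theta t \<le> 1 / theta s" by simp
  then show ?thesis using theta_pos[of s] theta_pos[of t] assms by (simp add: field_simps)
next
  case False
  then show ?thesis using theta_le_1[OF assms(1)] by (simp add: theta_def)
qed

text \<open>Losing a factor 2 in the resultant costs at most a factor 2 in the scale: exp(-2/\<tau>)
  is the square of exp(-1/\<tau>), hence at most s/e, and e is at least 2. A conjugation optimal up
  to 2 thus realises the fundamental scale.\<close>

lemma theta_half:
  assumes "0 < s" "s / 2 < t"
  shows "theta s / 2 \<le> theta t"
proof -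
  define \<tau> where "\<tau> = theta s"
  have \<tau>: "0 < \<tau>" "\<tau> \<le> 1" using theta_pos theta_le_1 assms by (auto simp: \<tau>_def)
  show ?thesis
  proof (cases "t \<le> exp (-1)")
    case True
    have t: "0 < t" using assms by linarith
    have e2: "exp 1 \<ge> (2::real)" using exp_ge_add_one_self[of 1] by simp
    have "exp (- 2 / \<tau>) = exp (- 1 / \<tau>) * exp (- 1 / \<tau>)" by (simp flip: exp_add)
    also have "\<dots> \<le> s * exp (- 1)"
      using exp_theta_le[OF assms(1)] \<tau> assms(1) by (intro mult_mono) (auto simp: \<tau>_def)
    also have "\<dots> \<le> s * (1 / 2)"
      using e2 assms(1) by (intro mult_left_mono) (auto simp: exp_minus field_simps)
    also have "\<dots> < exp (- 1 / theta t)" using theta_small[OF t True] assms by simp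
    finally have "1 / theta t < 2 / \<tau>" by simp
    then show ?thesis using theta_pos[OF t] \<tau> by (simp add: field_simps flip: \<tau>_def)
  next
    case False
    then show ?thesis using \<tau> by (simp add: theta_def \<tau>_def)
  qed
qed

text \<open>With \<eta> = \<open>theta s\<close> the bound is 1/e, so a resultant is never zero at
  its own scale. For other \<eta> only the ratio of the two scales enters.\<close>

lemma exp_le_powr_theta:
  assumes "0 < s" "0 \<le> \<eta>"
  shows "exp (- \<eta> / theta s) \<le> s powr \<eta>"
proof -
  have "exp (- 1 / theta s) powr \<eta> \<le> s powr \<eta>"
    using exp_theta_le[OF assms(1)] assms(2) by (intro powr_mono2) auto
  then show ?thesis by (simp add: powr_def)
qed

lemma powr_theta_small:
  assumes "0 < s" "s \<le> exp (-1)"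
  shows "s powr \<eta> = exp (- \<eta> / theta s)"
  by (subst theta_small[OF assms]) (simp add: powr_def)

section \<open>Ultrafilter limits and sequences modulo null sequences\<close>

locale nat_ultrafilter =
  fixes \<omega> :: "nat filter"
  assumes uf: "nonprincipal_ultrafilter \<omega>"
begin

lemma uf_neq_bot: "\<omega> \<noteq> bot"
  using uf by (simp add: nonprincipal_ultrafilter_def)

text \<open>One direction is maximality, the other properness. Negated eventual statements thereby
  become eventual ones and can be combined with further ones.\<close>

lemma not_eventually_uf: "\<not> eventually P \<omega> \<longleftrightarrow> eventually (\<lambda>n. \<not> P n) \<omega>"
proof
  show "\<not> eventually P \<omega> \<Longrightarrow> eventually (\<lambda>n. \<not> P n) \<omega>"
    using uf unfolding nonprincipal_ultrafilter_def by blast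
  show "eventually (\<lambda>n. \<not> P n) \<omega> \<Longrightarrow> \<not> eventually P \<omega>"
    using eventually_happens'[OF uf_neq_bot, of "\<lambda>n. P n \<and> \<not> P n"] eventually_conj by fastforce
qed

text \<open>\<open>ulim\<close> is given through \<open>Lim\<close>, so an actual limit has to be
  exhibited. The supremum of the eventual lower bounds works: a larger a is no eventual lower bound,
  and by maximality the sequence is then eventually below a.\<close>

lemma ulim_tendsto: "((\<lambda>n. ereal (x n)) \<longlongrightarrow> ulim \<omega> x) \<omega>"
proof -
  define l where "l = Sup {a. eventually (\<lambda>n. a \<le> ereal (x n)) \<omega>}"
  have "((\<lambda>n. ereal (x n)) \<longlongrightarrow> l) \<omega>"
  proof (rule order_tendstoI)
    fix a assume "a < l"
    then obtain b where "a < b" "eventually (\<lambda>n. b \<le> ereal (x n)) \<omega>"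
      unfolding l_def less_Sup_iff by blast
    from this(2) show "eventually (\<lambda>n. a < ereal (x n)) \<omega>"
      by eventually_elim (rule order_less_le_trans[OF \<open>a < b\<close>])
  next
    fix a assume "l < a"
    have "\<not> eventually (\<lambda>n. a \<le> ereal (x n)) \<omega>"
    proof
      assume "eventually (\<lambda>n. a \<le> ereal (x n)) \<omega>"
      then have "a \<le> l" unfolding l_def by (intro Sup_upper) simp
      with \<open>l < a\<close> show False by simp
    qed
    then show "eventually (\<lambda>n. ereal (x n) < a) \<omega>"
      unfolding not_eventually_uf by (simp add: not_le)
  qed
  then show ?thesis unfolding ulim_def by (simp add: tendsto_Lim[OF uf_neq_bot])
qed

lemma ulim_less_PInf_iff: "ulim \<omega> x < \<infinity> \<longleftrightarrow> (\<exists>B. eventually (\<lambda>n. x n \<le> B) \<omega>)"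
proof
  assume "ulim \<omega> x < \<infinity>"
  then obtain B where "ulim \<omega> x < ereal B" using ereal_dense2 by blast
  from order_tendstoD(2)[OF ulim_tendsto this] show "\<exists>B. eventually (\<lambda>n. x n \<le> B) \<omega>"
    by (auto intro!: exI[of _ B] elim!: eventually_mono)
next
  assume "\<exists>B. eventually (\<lambda>n. x n \<le> B) \<omega>"
  then obtain B where "eventually (\<lambda>n. ereal (x n) \<le> ereal B) \<omega>" by auto
  then have "ulim \<omega> x \<le> ereal B"
    using tendsto_upperbound[OF ulim_tendsto _ uf_neq_bot] by blast
  then show "ulim \<omega> x < \<infinity>" by (rule order_le_less_trans) simp
qed

lemma ulim_pos_iff: "0 < ulim \<omega> x \<longleftrightarrow> (\<exists>c>0. eventually (\<lambda>n. c \<le> x n) \<omega>)"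
proof
  assume "0 < ulim \<omega> x"
  then obtain c where c: "0 < ereal c" "ereal c < ulim \<omega> x" using ereal_dense2 by blast
  from order_tendstoD(1)[OF ulim_tendsto c(2)] show "\<exists>c>0. eventually (\<lambda>n. c \<le> x n) \<omega>"
    using c(1) by (auto intro!: exI[of _ c] elim!: eventually_mono)
next
  assume "\<exists>c>0. eventually (\<lambda>n. c \<le> x n) \<omega>"
  then obtain c where c: "c > 0" "eventually (\<lambda>n. ereal c \<le> ereal (x n)) \<omega>" by auto
  then have "ereal c \<le> ulim \<omega> x"
    using tendsto_lowerbound[OF ulim_tendsto _ uf_neq_bot] by blast
  moreover have "0 < ereal c" using c by simp
  ultimately show "0 < ulim \<omega> x" by (rule order_less_le_trans[rotated])
qed

lemma ulim_nonneg:
  assumes "\<And>n. 0 \<le> x n"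
  shows "0 \<le> ulim \<omega> x"
  by (rule tendsto_lowerbound[OF ulim_tendsto _ uf_neq_bot]) (simp add: assms)

lemma ulim_eq_0_iff:
  assumes "\<And>n. 0 \<le> x n"
  shows "ulim \<omega> x = 0 \<longleftrightarrow> (\<forall>c>0. eventually (\<lambda>n. x n < c) \<omega>)"
proof -
  have "ulim \<omega> x = 0 \<longleftrightarrow> \<not> 0 < ulim \<omega> x" using ulim_nonneg[of x] assms by auto
  also have "\<dots> \<longleftrightarrow> (\<forall>c>0. \<not> eventually (\<lambda>n. c \<le> x n) \<omega>)" unfolding ulim_pos_iff by blast
  finally show ?thesis by (simp add: not_eventually_uf not_le)
qed

lemma scale_eq_iff:
  "scale_eq \<omega> \<epsilon> \<eta> \<longleftrightarrow> (\<exists>c>0. eventually (\<lambda>n. c \<le> \<epsilon> n / \<eta> n) \<omega>) \<and> (\<exists>B. eventually (\<lambda>n. \<epsilon> n / \<eta> n \<le> B) \<omega>)"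
  unfolding scale_eq_def ulim_pos_iff ulim_less_PInf_iff by simp

lemma Hring_iff: "Hring \<omega> \<epsilon> x \<longleftrightarrow> (\<exists>B. eventually (\<lambda>n. cmod (x n) powr \<epsilon> n \<le> B) \<omega>)"
  unfolding Hring_def ulim_less_PInf_iff ..

lemma Hzero_iff: "Hzero \<omega> \<epsilon> x \<longleftrightarrow> (\<forall>c>0. eventually (\<lambda>n. cmod (x n) powr \<epsilon> n < c) \<omega>)"
  unfolding Hzero_def by (rule ulim_eq_0_iff) simp

text \<open>A nonzero class is bounded away from 0 along the ultrafilter, not merely nonzero
  termwise; hence products of nonzero classes are nonzero and inverses lie in the ring.\<close>

lemma not_Hzero_iff: "\<not> Hzero \<omega> \<epsilon> x \<longleftrightarrow> (\<exists>c>0. eventually (\<lambda>n. c \<le> cmod (x n) powr \<epsilon> n) \<omega>)"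
  unfolding Hzero_iff by (auto simp: not_eventually_uf not_less)

lemma Hzero_0[simp]: "Hzero \<omega> \<epsilon> (\<lambda>_. 0)"
  by (simp add: Hzero_iff)

lemma not_Hzero_imp_nonzero:
  assumes "\<not> Hzero \<omega> \<epsilon> x"
  shows "eventually (\<lambda>n. x n \<noteq> 0) \<omega>"
proof -
  obtain c where "c > 0" "eventually (\<lambda>n. c \<le> cmod (x n) powr \<epsilon> n) \<omega>" using assms not_Hzero_iff by blast
  then show ?thesis by (auto elim!: eventually_mono)
qed

lemma not_Hzero_mult:
  assumes "\<not> Hzero \<omega> \<epsilon> x" "\<not> Hzero \<omega> \<epsilon> y"
  shows "\<not> Hzero \<omega> \<epsilon> (\<lambda>n. x n * y n)"
proof -
  obtain a b where ab: "a > 0" "b > 0" and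
    "eventually (\<lambda>n. a \<le> cmod (x n) powr \<epsilon> n) \<omega>" "eventually (\<lambda>n. b \<le> cmod (y n) powr \<epsilon> n) \<omega>"
    using assms not_Hzero_iff by metis
  from this(3,4) have "eventually (\<lambda>n. a * b \<le> cmod (x n * y n) powr \<epsilon> n) \<omega>"
  proof eventually_elim
    case (elim n)
    then show ?case using ab by (simp add: norm_mult powr_mult mult_mono)
  qed
  then show ?thesis unfolding not_Hzero_iff using ab by (intro exI[of _ "a * b"]) auto
qed

lemma Hring_mult:
  assumes "Hring \<omega> \<epsilon> x" "Hring \<omega> \<epsilon> y"
  shows "Hring \<omega> \<epsilon> (\<lambda>n. x n * y n)"
proof -
  obtain A B where "eventually (\<lambda>n. cmod (x n) powr \<epsilon> n \<le> A) \<omega>" "eventually (\<lambda>n. cmod (y n) powr \<epsilon> n \<le> B) \<omega>"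
    using assms Hring_iff by metis
  then have "eventually (\<lambda>n. cmod (x n * y n) powr \<epsilon> n \<le> A * B) \<omega>"
  proof eventually_elim
    case (elim n)
    moreover have "0 \<le> A" using elim(1) powr_ge_zero order_trans by blast
    ultimately show ?case by (simp add: norm_mult powr_mult mult_mono)
  qed
  then show ?thesis unfolding Hring_iff by blast
qed

lemma Hzero_mult:
  assumes "Hzero \<omega> \<epsilon> x" "Hring \<omega> \<epsilon> y"
  shows "Hzero \<omega> \<epsilon> (\<lambda>n. x n * y n)"
  unfolding Hzero_iff
proof (intro allI impI)
  fix c :: real assume c: "c > 0"
  obtain B where B: "eventually (\<lambda>n. cmod (y n) powr \<epsilon> n \<le> B) \<omega>" using assms Hring_iff by metis
  have "eventually (\<lambda>n. cmod (x n) powr \<epsilon> n < c / (\<bar>B\<bar> + 1)) \<omega>" using assms(1) c unfolding Hzero_iff by simp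
  then show "eventually (\<lambda>n. cmod (x n * y n) powr \<epsilon> n < c) \<omega>" using B
  proof eventually_elim
    case (elim n)
    have "cmod (x n) powr \<epsilon> n * cmod (y n) powr \<epsilon> n \<le> cmod (x n) powr \<epsilon> n * (\<bar>B\<bar> + 1)"
      using elim by (intro mult_left_mono) auto
    also have "\<dots> < c" using elim by (simp add: field_simps)
    finally show ?case by (simp add: norm_mult powr_mult)
  qed
qed

lemma Hzero_mult': "Hring \<omega> \<epsilon> x \<Longrightarrow> Hzero \<omega> \<epsilon> y \<Longrightarrow> Hzero \<omega> \<epsilon> (\<lambda>n. x n * y n)"
  using Hzero_mult[of \<epsilon> y x] by (simp add: mult.commute)

lemma Hring_uminus: "Hring \<omega> \<epsilon> x \<Longrightarrow> Hring \<omega> \<epsilon> (\<lambda>n. - x n)"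
  and Hzero_uminus: "Hzero \<omega> \<epsilon> x \<Longrightarrow> Hzero \<omega> \<epsilon> (\<lambda>n. - x n)"
  by (simp_all add: Hring_iff Hzero_iff)

end

text \<open>Scales obtained from \<open>theta\<close> at positive arguments satisfy both bounds. The
  upper one makes powers subadditive, puts bounded sequences into the ring and turns the exponent
  \<open>min 1 (\<epsilon> n)\<close> of the norm into \<open>\<epsilon> n\<close>.\<close>

locale ultrafilter_scale = nat_ultrafilter +
  fixes \<epsilon> :: "nat \<Rightarrow> real"
  assumes eps_pos: "\<And>n. 0 < \<epsilon> n" and eps_le_1: "\<And>n. \<epsilon> n \<le> 1"
begin

text \<open>This is what makes the constants of the complex inequalities harmless at every
  scale.\<close>

lemma powr_eps_le:
  assumes "0 \<le> x" "x \<le> B"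
  shows "x powr \<epsilon> n \<le> max 1 B"
proof -
  have "x powr \<epsilon> n \<le> max 1 B powr \<epsilon> n"
    using assms eps_pos[of n] by (intro powr_mono2) auto
  also have "\<dots> \<le> max 1 B powr 1" using eps_le_1 by (intro powr_mono) auto
  finally show ?thesis by simp
qed

lemma Hring_bounded:
  assumes "\<And>n. cmod (x n) \<le> B"
  shows "Hring \<omega> \<epsilon> x"
  unfolding Hring_iff using powr_eps_le[OF norm_ge_zero assms] by (auto intro!: exI[of _ "max 1 B"])

lemma Hring_const: "Hring \<omega> \<epsilon> (\<lambda>_. a)"
  by (rule Hring_bounded[of _ "cmod a"]) simp

lemma Hring_0: "Hring \<omega> \<epsilon> (\<lambda>_. 0)"
  by (rule Hring_const)

lemma norm_add_powr_le: "cmod (a + b) powr \<epsilon> n \<le> cmod a powr \<epsilon> n + cmod b powr \<epsilon> n"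
proof -
  have "cmod (a + b) powr \<epsilon> n \<le> (cmod a + cmod b) powr \<epsilon> n"
    using eps_pos[of n] by (intro powr_mono2 norm_triangle_ineq) auto
  then show ?thesis
    using powr_add_subadditive[OF norm_ge_zero norm_ge_zero eps_pos eps_le_1] order_trans by blast
qed

lemma Hring_add:
  assumes "Hring \<omega> \<epsilon> x" "Hring \<omega> \<epsilon> y"
  shows "Hring \<omega> \<epsilon> (\<lambda>n. x n + y n)"
proof -
  obtain A B where "eventually (\<lambda>n. cmod (x n) powr \<epsilon> n \<le> A) \<omega>" "eventually (\<lambda>n. cmod (y n) powr \<epsilon> n \<le> B) \<omega>"
    using assms Hring_iff by metis
  then have "eventually (\<lambda>n. cmod (x n + y n) powr \<epsilon> n \<le> A + B) \<omega>"
    by eventually_elim (meson add_mono norm_add_powr_le order_trans)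
  then show ?thesis unfolding Hring_iff by blast
qed

lemma Hzero_add:
  assumes "Hzero \<omega> \<epsilon> x" "Hzero \<omega> \<epsilon> y"
  shows "Hzero \<omega> \<epsilon> (\<lambda>n. x n + y n)"
  unfolding Hzero_iff
proof (intro allI impI)
  fix c :: real assume "c > 0"
  then have "eventually (\<lambda>n. cmod (x n) powr \<epsilon> n < c / 2) \<omega>" "eventually (\<lambda>n. cmod (y n) powr \<epsilon> n < c / 2) \<omega>"
    using assms half_gt_zero unfolding Hzero_iff by blast+
  then show "eventually (\<lambda>n. cmod (x n + y n) powr \<epsilon> n < c) \<omega>"
  proof eventually_elim
    case (elim n)
    then show ?case using norm_add_powr_le[of "x n" "y n" n] by linarith
  qed
qed

lemma Hzero_diff: "Hzero \<omega> \<epsilon> x \<Longrightarrow> Hzero \<omega> \<epsilon> y \<Longrightarrow> Hzero \<omega> \<epsilon> (\<lambda>n. x n - y n)"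
  using Hzero_add[of x "\<lambda>n. - y n"] Hzero_uminus[of \<epsilon> y] by simp

lemma Hring_sum: "(\<And>i. i \<in> I \<Longrightarrow> Hring \<omega> \<epsilon> (x i)) \<Longrightarrow> Hring \<omega> \<epsilon> (\<lambda>n. \<Sum>i\<in>I. x i n)"
  by (induction I rule: infinite_finite_induct) (auto intro: Hring_0 Hring_add)

lemma Hzero_sum: "(\<And>i. i \<in> I \<Longrightarrow> Hzero \<omega> \<epsilon> (x i)) \<Longrightarrow> Hzero \<omega> \<epsilon> (\<lambda>n. \<Sum>i\<in>I. x i n)"
  by (induction I rule: infinite_finite_induct) (auto intro: Hzero_add)

lemma Hring_prod: "(\<And>i. i \<in> I \<Longrightarrow> Hring \<omega> \<epsilon> (x i)) \<Longrightarrow> Hring \<omega> \<epsilon> (\<lambda>n. \<Prod>i\<in>I. x i n)"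
  by (induction I rule: infinite_finite_induct) (auto intro: Hring_const Hring_mult)

lemma Hzero_diff_mult:
  assumes "Hzero \<omega> \<epsilon> (\<lambda>n. x n - x' n)" "Hzero \<omega> \<epsilon> (\<lambda>n. y n - y' n)" "Hring \<omega> \<epsilon> x" "Hring \<omega> \<epsilon> y'"
  shows "Hzero \<omega> \<epsilon> (\<lambda>n. x n * y n - x' n * y' n)"
proof -
  have "(\<lambda>n. x n * y n - x' n * y' n) = (\<lambda>n. x n * (y n - y' n) + (x n - x' n) * y' n)"
    by (simp add: algebra_simps)
  then show ?thesis
    using Hzero_add[OF Hzero_mult'[OF assms(3,2)] Hzero_mult[OF assms(1,4)]] by simp
qed

lemma Hzero_diff_prod:
  assumes "\<And>i. i \<in> I \<Longrightarrow> Hzero \<omega> \<epsilon> (\<lambda>n. x i n - y i n)"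
    "\<And>i. i \<in> I \<Longrightarrow> Hring \<omega> \<epsilon> (x i)" "\<And>i. i \<in> I \<Longrightarrow> Hring \<omega> \<epsilon> (y i)"
  shows "Hzero \<omega> \<epsilon> (\<lambda>n. (\<Prod>i\<in>I. x i n) - (\<Prod>i\<in>I. y i n))"
  using assms
proof (induction I rule: infinite_finite_induct)
  case (insert i I)
  then have "Hzero \<omega> \<epsilon> (\<lambda>n. x i n * (\<Prod>i\<in>I. x i n) - y i n * (\<Prod>i\<in>I. y i n))"
    by (intro Hzero_diff_mult Hring_prod) auto
  then show ?case using insert by simp
qed simp_all

section \<open>Determinants, resultants and conjugates over the field\<close>

lemma Hring_det:
  assumes "\<And>n. A n \<in> carrier_mat k k" "\<And>i j. i < k \<Longrightarrow> j < k \<Longrightarrow> Hring \<omega> \<epsilon> (\<lambda>n. A n $$ (i, j))"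
  shows "Hring \<omega> \<epsilon> (\<lambda>n. det (A n))"
  unfolding det_def'[OF assms(1)]
  by (intro Hring_sum Hring_mult Hring_const Hring_prod assms(2))
    (auto dest: permutes_in_image)

text \<open>By the Leibniz formula the determinant is a polynomial in the entries, so it depends
  only on their classes.\<close>

lemma Hzero_diff_det:
  assumes "\<And>n. A n \<in> carrier_mat k k" "\<And>n. B n \<in> carrier_mat k k"
    "\<And>i j. i < k \<Longrightarrow> j < k \<Longrightarrow> Hring \<omega> \<epsilon> (\<lambda>n. A n $$ (i, j))"
    "\<And>i j. i < k \<Longrightarrow> j < k \<Longrightarrow> Hring \<omega> \<epsilon> (\<lambda>n. B n $$ (i, j))"
    "\<And>i j. i < k \<Longrightarrow> j < k \<Longrightarrow> Hzero \<omega> \<epsilon> (\<lambda>n. A n $$ (i, j) - B n $$ (i, j))"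
  shows "Hzero \<omega> \<epsilon> (\<lambda>n. det (A n) - det (B n))"
  unfolding det_def'[OF assms(1)] det_def'[OF assms(2)] sum_subtractf[symmetric] right_diff_distrib[symmetric]
  by (intro Hzero_sum Hzero_mult' Hring_const Hzero_diff_prod assms(3-))
    (auto dest: permutes_in_image)

lemma Hring_if: "(P \<Longrightarrow> Hring \<omega> \<epsilon> x) \<Longrightarrow> (\<not> P \<Longrightarrow> Hring \<omega> \<epsilon> y) \<Longrightarrow> Hring \<omega> \<epsilon> (\<lambda>n. if P then x n else y n)"
  by (cases P) simp_all

lemma Hzero_if: "(P \<Longrightarrow> Hzero \<omega> \<epsilon> x) \<Longrightarrow> (\<not> P \<Longrightarrow> Hzero \<omega> \<epsilon> y) \<Longrightarrow> Hzero \<omega> \<epsilon> (\<lambda>n. if P then x n else y n)"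
  by (cases P) simp_all

lemma Hring_sylvester:
  assumes "\<And>i. Hring \<omega> \<epsilon> (\<lambda>n. coeff (p n) i)" "\<And>i. Hring \<omega> \<epsilon> (\<lambda>n. coeff (q n) i)" "i < k + k" "j < k + k"
  shows "Hring \<omega> \<epsilon> (\<lambda>n. sylvester_mat_sub k k (p n) (q n) $$ (i, j))"
  unfolding sylvester_mat_sub_index[OF assms(3,4)] by (intro Hring_if assms Hring_0)

lemma Hring_hres:
  assumes "\<And>i. Hring \<omega> \<epsilon> (\<lambda>n. coeff (p n) i)" "\<And>i. Hring \<omega> \<epsilon> (\<lambda>n. coeff (q n) i)"
  shows "Hring \<omega> \<epsilon> (\<lambda>n. hres k (p n) (q n))"
  unfolding hres_def resultant_sub_def
  by (rule Hring_det[OF sylvester_mat_sub_carrier Hring_sylvester[OF assms]])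

lemma Hzero_diff_hres:
  assumes "\<And>i. Hring \<omega> \<epsilon> (\<lambda>n. coeff (p n) i)" "\<And>i. Hring \<omega> \<epsilon> (\<lambda>n. coeff (q n) i)"
    "\<And>i. Hring \<omega> \<epsilon> (\<lambda>n. coeff (p' n) i)" "\<And>i. Hring \<omega> \<epsilon> (\<lambda>n. coeff (q' n) i)"
    "Heqf \<omega> \<epsilon> p p'" "Heqf \<omega> \<epsilon> q q'"
  shows "Hzero \<omega> \<epsilon> (\<lambda>n. hres k (p n) (q n) - hres k (p' n) (q' n))"
proof -
  have "Hzero \<omega> \<epsilon> (\<lambda>n. sylvester_mat_sub k k (p n) (q n) $$ (i, j) - sylvester_mat_sub k k (p' n) (q' n) $$ (i, j))"
    if ij: "i < k + k" "j < k + k" for i j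
  proof -
    \<comment> \<open>Every entry is a coefficient of one of the forms or 0, so the Sylvester matrix
      is additive in the pair.\<close>
    have "sylvester_mat_sub k k (p n) (q n) $$ (i, j) - sylvester_mat_sub k k (p' n) (q' n) $$ (i, j)
        = sylvester_mat_sub k k (p n - p' n) (q n - q' n) $$ (i, j)" for n
      by (simp add: sylvester_mat_sub_index[OF ij])
    then show ?thesis using assms(5,6)
      by (simp only: sylvester_mat_sub_index[OF ij] coeff_diff Heqf_def) (intro Hzero_if Hzero_0; blast)
  qed
  then show ?thesis unfolding hres_def resultant_sub_def
    by (intro Hzero_diff_det[OF sylvester_mat_sub_carrier sylvester_mat_sub_carrier] Hring_sylvester assms(1-4))
qed

lemma Hring_coeff_mult:
  assumes "\<And>i. Hring \<omega> \<epsilon> (\<lambda>n. coeff (p n) i)" "\<And>i. Hring \<omega> \<epsilon> (\<lambda>n. coeff (q n) i)"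
  shows "Hring \<omega> \<epsilon> (\<lambda>n. coeff (p n * q n) i)"
  unfolding coeff_mult by (intro Hring_sum Hring_mult assms)

lemma Hring_coeff_power:
  assumes "\<And>i. Hring \<omega> \<epsilon> (\<lambda>n. coeff (p n) i)"
  shows "Hring \<omega> \<epsilon> (\<lambda>n. coeff (p n ^ j) i)"
proof (induction j arbitrary: i)
  case 0
  then show ?case by (simp add: Hring_const)
next
  case (Suc j)
  then show ?case by (simp add: Hring_coeff_mult assms)
qed

lemma Hring_coeff_linear:
  assumes "Hring \<omega> \<epsilon> a" "Hring \<omega> \<epsilon> b"
  shows "Hring \<omega> \<epsilon> (\<lambda>n. coeff [:b n, a n:] i)"
proof (cases i)
  case (Suc j)
  then show ?thesis using assms by (cases j) (simp_all add: Hring_0)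
qed (simp add: assms)

lemma Hring_coeff_hsubst_basis:
  assumes "Hring \<omega> \<epsilon> a" "Hring \<omega> \<epsilon> b" "Hring \<omega> \<epsilon> c" "Hring \<omega> \<epsilon> e"
  shows "Hring \<omega> \<epsilon> (\<lambda>n. coeff ([:b n, a n:] ^ i * [:e n, c n:] ^ j) l)"
  by (intro Hring_coeff_mult Hring_coeff_power Hring_coeff_linear assms)

lemma Hring_coeff_hsubst:
  assumes "Hring \<omega> \<epsilon> a" "Hring \<omega> \<epsilon> b" "Hring \<omega> \<epsilon> c" "Hring \<omega> \<epsilon> e"
    "\<And>i. Hring \<omega> \<epsilon> (\<lambda>n. coeff (p n) i)"
  shows "Hring \<omega> \<epsilon> (\<lambda>n. coeff (hsubst k (p n) (a n, b n, c n, e n)) i)"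
  unfolding hsubst_def prod.case coeff_sum coeff_smult
  by (intro Hring_sum Hring_mult Hring_coeff_hsubst_basis assms)

lemma Hzero_coeff_hsubst:
  assumes "Hring \<omega> \<epsilon> a" "Hring \<omega> \<epsilon> b" "Hring \<omega> \<epsilon> c" "Hring \<omega> \<epsilon> e"
    "\<And>i. Hzero \<omega> \<epsilon> (\<lambda>n. coeff (p n) i)"
  shows "Hzero \<omega> \<epsilon> (\<lambda>n. coeff (hsubst k (p n) (a n, b n, c n, e n)) i)"
  unfolding hsubst_def prod.case coeff_sum coeff_smult
  by (intro Hzero_sum Hzero_mult Hring_coeff_hsubst_basis assms)

lemma mconj_components:
  "fst (mconj k N (p, q)) = smult (fst N) (hsubst k p (snd (snd (snd N)), - fst (snd N), - fst (snd (snd N)), fst N))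
     + smult (fst (snd N)) (hsubst k q (snd (snd (snd N)), - fst (snd N), - fst (snd (snd N)), fst N))"
  "snd (mconj k N (p, q)) = smult (fst (snd (snd N))) (hsubst k p (snd (snd (snd N)), - fst (snd N), - fst (snd (snd N)), fst N))
     + smult (snd (snd (snd N))) (hsubst k q (snd (snd (snd N)), - fst (snd N), - fst (snd (snd N)), fst N))"
  for N :: "complex mob"
  by (cases N; simp add: Let_def)+

lemma Hring_coeff_mconj:
  assumes "HPGL \<omega> \<epsilon> N" "\<And>i. Hring \<omega> \<epsilon> (\<lambda>n. coeff (p n) i)" "\<And>i. Hring \<omega> \<epsilon> (\<lambda>n. coeff (q n) i)"
  shows "Hring \<omega> \<epsilon> (\<lambda>n. coeff (fst (mconj k (N n) (p n, q n))) i)"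
    "Hring \<omega> \<epsilon> (\<lambda>n. coeff (snd (mconj k (N n) (p n, q n))) i)"
  using assms unfolding mconj_components HPGL_def coeff_add coeff_smult
  by (auto intro!: Hring_add Hring_mult Hring_coeff_hsubst Hring_uminus)

text \<open>Conjugation is linear in the pair of forms. Applied to a difference, this shows that
  congruent pairs have congruent conjugates.\<close>

lemma Hzero_coeff_mconj:
  assumes "HPGL \<omega> \<epsilon> N" "\<And>i. Hzero \<omega> \<epsilon> (\<lambda>n. coeff (p n) i)" "\<And>i. Hzero \<omega> \<epsilon> (\<lambda>n. coeff (q n) i)"
  shows "Hzero \<omega> \<epsilon> (\<lambda>n. coeff (fst (mconj k (N n) (p n, q n))) i)"
    "Hzero \<omega> \<epsilon> (\<lambda>n. coeff (snd (mconj k (N n) (p n, q n))) i)"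
  using assms unfolding mconj_components HPGL_def coeff_add coeff_smult
  by (auto intro!: Hzero_add Hzero_mult' Hzero_coeff_hsubst Hring_uminus)

section \<open>Norms over the field as limits\<close>

lemma Hnorm_tendsto:
  assumes "Hring \<omega> \<epsilon> x"
  shows "((\<lambda>n. cmod (x n) powr \<epsilon> n) \<longlongrightarrow> Hnorm \<omega> \<epsilon> x) \<omega>"
proof -
  have m: "min 1 (\<epsilon> n) = \<epsilon> n" for n using eps_le_1 by (simp add: min_def antisym)
  have "ulim \<omega> (\<lambda>n. cmod (x n) powr \<epsilon> n) < \<infinity>" using assms by (simp add: Hring_def)
  moreover have "0 \<le> ulim \<omega> (\<lambda>n. cmod (x n) powr \<epsilon> n)" by (rule ulim_nonneg) simp
  ultimately have "ulim \<omega> (\<lambda>n. cmod (x n) powr \<epsilon> n) = ereal (Hnorm \<omega> \<epsilon> x)"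
    unfolding Hnorm_def m by (simp add: ereal_real)
  then have "((\<lambda>n. ereal (cmod (x n) powr \<epsilon> n)) \<longlongrightarrow> ereal (Hnorm \<omega> \<epsilon> x)) \<omega>"
    using ulim_tendsto by metis
  then show ?thesis by simp
qed

lemma Hnorm_pos:
  assumes "Hring \<omega> \<epsilon> x" "\<not> Hzero \<omega> \<epsilon> x"
  shows "0 < Hnorm \<omega> \<epsilon> x"
proof -
  obtain c where c: "c > 0" "eventually (\<lambda>n. c \<le> cmod (x n) powr \<epsilon> n) \<omega>" using assms(2) not_Hzero_iff by blast
  have "c \<le> Hnorm \<omega> \<epsilon> x" by (rule tendsto_lowerbound[OF Hnorm_tendsto[OF assms(1)] c(2) uf_neq_bot])
  then show ?thesis using c(1) by linarith
qed

text \<open>Subadditivity of the power gives a reverse triangle inequality: the powers of |x| and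
  |y| differ by at most the power of |x - y|.\<close>

lemma Hnorm_tendsto_cong:
  assumes "Hzero \<omega> \<epsilon> (\<lambda>n. x n - y n)" "((\<lambda>n. cmod (y n) powr \<epsilon> n) \<longlongrightarrow> l) \<omega>"
  shows "((\<lambda>n. cmod (x n) powr \<epsilon> n) \<longlongrightarrow> l) \<omega>"
proof -
  have "((\<lambda>n. cmod (x n) powr \<epsilon> n - cmod (y n) powr \<epsilon> n) \<longlongrightarrow> 0) \<omega>"
  proof (rule tendstoI)
    fix c :: real assume "c > 0"
    then have "eventually (\<lambda>n. cmod (x n - y n) powr \<epsilon> n < c) \<omega>" using assms(1) by (simp add: Hzero_iff)
    then show "eventually (\<lambda>n. dist (cmod (x n) powr \<epsilon> n - cmod (y n) powr \<epsilon> n) 0 < c) \<omega>"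
    proof eventually_elim
      case (elim n)
      have "cmod (x n) powr \<epsilon> n \<le> cmod (y n) powr \<epsilon> n + cmod (x n - y n) powr \<epsilon> n"
        using norm_add_powr_le[of "y n" "x n - y n" n] by simp
      moreover have "cmod (y n) powr \<epsilon> n \<le> cmod (x n) powr \<epsilon> n + cmod (x n - y n) powr \<epsilon> n"
        using norm_add_powr_le[of "x n" "y n - x n" n] by (simp add: norm_minus_commute)
      ultimately show ?case using elim by (simp add: dist_real_def)
    qed
  qed
  from tendsto_add[OF this assms(2)] show ?thesis by simp
qed

lemma cmax_powr_tendsto:
  assumes "\<And>i. ((\<lambda>n. cmod (coeff (fst (g n)) i) powr \<epsilon> n) \<longlongrightarrow> u i) \<omega>"
    "\<And>i. ((\<lambda>n. cmod (coeff (snd (g n)) i) powr \<epsilon> n) \<longlongrightarrow> v i) \<omega>"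
  shows "((\<lambda>n. cmax k (g n) powr \<epsilon> n) \<longlongrightarrow> Max (u ` {..k} \<union> v ` {..k})) \<omega>"
proof -
  have "cmax k (g n) powr \<epsilon> n = max (Max ((\<lambda>i. cmod (coeff (fst (g n)) i) powr \<epsilon> n) ` {..k}))
      (Max ((\<lambda>i. cmod (coeff (snd (g n)) i) powr \<epsilon> n) ` {..k}))" for n
    using eps_pos[of n] by (subst cmax_powr) (auto intro!: Max_Un)
  moreover have "Max (u ` {..k} \<union> v ` {..k}) = max (Max (u ` {..k})) (Max (v ` {..k}))"
    by (rule Max_Un) auto
  ultimately show ?thesis by (simp only:) (intro tendsto_max tendsto_Max assms; auto)
qed

end

section \<open>Estimates for complex resultants\<close>

lemma cmod_det_le:
  assumes "A \<in> carrier_mat n n" "\<And>i j. i < n \<Longrightarrow> j < n \<Longrightarrow> cmod (A $$ (i, j)) \<le> B"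
  shows "cmod (det A) \<le> fact n * B ^ n"
proof -
  have "cmod (det A) \<le> (\<Sum>p\<in>{p. p permutes {0..<n}}. cmod (signof p * (\<Prod>i = 0..<n. A $$ (i, p i))))"
    unfolding det_def'[OF assms(1)] by (rule norm_sum)
  also have "\<dots> \<le> (\<Sum>p\<in>{p. p permutes {0..<n}}. B ^ n)"
  proof (rule sum_mono)
    fix p assume "p \<in> {p. p permutes {0..<n}}"
    then have p: "p permutes {0..<n}" by simp
    have "cmod (signof p * (\<Prod>i = 0..<n. A $$ (i, p i))) = (\<Prod>i = 0..<n. cmod (A $$ (i, p i)))"
      by (simp add: norm_mult prod_norm sign_def)
    also have "\<dots> \<le> (\<Prod>i = 0..<n. B)"
      using permutes_in_image[OF p] by (intro prod_mono) (auto intro!: assms(2))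
    finally show "cmod (signof p * (\<Prod>i = 0..<n. A $$ (i, p i))) \<le> B ^ n" by simp
  qed
  also have "\<dots> = fact n * B ^ n" by (simp add: card_permutations)
  finally show ?thesis .
qed

lemma sylvester_entry_le:
  assumes "i < d + d" "j < d + d"
  shows "cmod (sylvester_mat_sub d d p q $$ (i, j)) \<le> cmax d (p, q)"
proof -
  have "cmod (coeff p i) \<le> cmax d (p, q)" "cmod (coeff q i) \<le> cmax d (p, q)" if "i \<le> d" for i
    using cmax_ge[OF that, of "(p, q)"] by simp_all
  then show ?thesis using assms by (auto simp: sylvester_mat_sub_index cmax_nonneg)
qed

lemma cmod_hres_le: "cmod (hres d p q) \<le> fact (2 * d) * cmax d (p, q) ^ (2 * d)"
  unfolding hres_def resultant_sub_def
  using cmod_det_le[OF sylvester_mat_sub_carrier sylvester_entry_le, of d p q] by (simp add: mult_2)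

lemma cmod_adj_sylvester_le:
  assumes "i < d + d" "j < d + d"
  shows "cmod (adj_mat (sylvester_mat_sub d d p q) $$ (i, j)) \<le> fact (2 * d - 1) * cmax d (p, q) ^ (2 * d - 1)"
proof -
  let ?S = "sylvester_mat_sub d d p q"
  have S: "?S \<in> carrier_mat (d + d) (d + d)" by (rule sylvester_mat_sub_carrier)
  have "cmod (det (mat_delete ?S j i)) \<le> fact (d + d - 1) * cmax d (p, q) ^ (d + d - 1)"
  proof (rule cmod_det_le)
    show "mat_delete ?S j i \<in> carrier_mat (d + d - 1) (d + d - 1)" by (rule mat_delete_carrier[OF S])
    fix i' j' assume "i' < d + d - 1" "j' < d + d - 1"
    then show "cmod (mat_delete ?S j i $$ (i', j')) \<le> cmax d (p, q)"
      using assms by (auto simp: mat_delete_def intro!: sylvester_entry_le)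
  qed
  then show ?thesis using assms by (simp add: adj_mat_def cofactor_def norm_mult norm_power mult_2)
qed

text \<open>Both forms cannot be small at (z, w) unless the resultant is small. In
  \<open>hres_eval\<close> there are 2d summands, and each adjugate entry is a minor of size 2d - 1,
  whence the factorial.\<close>

lemma hres_eval_le:
  assumes "degree p \<le> d" "degree q \<le> d" "0 < d"
    "cmod z \<le> m" "cmod w \<le> m" "cmod z = m \<or> cmod w = m"
    "cmod (form_eval d p z w) \<le> V" "cmod (form_eval d q z w) \<le> V"
  shows "cmod (hres d p q) * m ^ d \<le> 2 * real d * fact (2 * d - 1) * cmax d (p, q) ^ (2 * d - 1) * V"
proof (cases "m = 0")
  case True
  have "0 \<le> V" using assms(7) norm_ge_zero order_trans by blast
  then show ?thesis using True assms(3) by (simp add: power_0_left cmax_nonneg)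
next
  case False
  define K where "K = fact (2 * d - 1) * cmax d (p, q) ^ (2 * d - 1)"
  have m: "m > 0" using False assms(4) norm_ge_zero[of z] by linarith
  have K: "0 \<le> K" by (simp add: K_def cmax_nonneg)
  let ?A = "adj_mat (sylvester_mat_sub d d p q)"
  have entry: "cmod (?A $$ (l, j) * (z ^ (d - 1 - i) * w ^ i * x)) \<le> K * (m ^ (d - 1) * V)"
    if "l < d + d" "j < d + d" "i < d" "cmod x \<le> V" for l j i x
  proof -
    have "cmod z ^ (d - 1 - i) * cmod w ^ i \<le> m ^ (d - 1 - i) * m ^ i"
      using assms(4,5) m by (intro mult_mono power_mono) auto
    also have "\<dots> = m ^ (d - 1)" using that(3) by (simp flip: power_add)
    finally have "cmod z ^ (d - 1 - i) * cmod w ^ i * cmod x \<le> m ^ (d - 1) * V"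
      using that(4) m by (intro mult_mono) auto
    note this and cmod_adj_sylvester_le[OF that(1,2), of p q, folded K_def]
    from mult_mono[OF this(2,1) K] show ?thesis by (simp add: norm_mult norm_power)
  qed
  have "cmod (hres d p q * (z ^ (2 * d - 1 - l) * w ^ l)) \<le> 2 * real d * (K * (m ^ (d - 1) * V))"
    if l: "l < d + d" for l
  proof -
    have "cmod (\<Sum>i<d. ?A $$ (l, i) * (z ^ (d - 1 - i) * w ^ i * form_eval d p z w)) \<le> real (card {..<d}) * (K * (m ^ (d - 1) * V))"
      using l assms(7) by (intro sum_norm_bound entry) auto
    moreover have "cmod (\<Sum>i<d. ?A $$ (l, i + d) * (z ^ (d - 1 - i) * w ^ i * form_eval d q z w)) \<le> real (card {..<d}) * (K * (m ^ (d - 1) * V))"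
      using l assms(8) by (intro sum_norm_bound entry) auto
    ultimately show ?thesis
      unfolding hres_eval[OF assms(1,2) l] by (intro order_trans[OF norm_triangle_ineq]) simp
  qed
  \<comment> \<open>The index 0 isolates z^(2d-1), the index 2d - 1 isolates w^(2d-1); one of these
    has modulus m^(2d-1).\<close>
  note * = this[of 0] this[of "2 * d - 1"]
  have "cmod (hres d p q) * m ^ (2 * d - 1) \<le> 2 * real d * (K * (m ^ (d - 1) * V))"
    using assms(6) * assms(3) by (auto simp: norm_mult norm_power)
  moreover have "m ^ (2 * d - 1) = m ^ d * m ^ (d - 1)" using assms(3) by (simp add: mult_2 flip: power_add)
  ultimately have "(cmod (hres d p q) * m ^ d) * m ^ (d - 1) \<le> (2 * real d * K * V) * m ^ (d - 1)"
    by (simp add: mult_ac)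
  then have "cmod (hres d p q) * m ^ d \<le> 2 * real d * K * V" using m by simp
  then show ?thesis by (simp add: K_def mult_ac)
qed

lemma hres_common_zero:
  fixes p q :: "complex poly"
  assumes "degree p \<le> d" "degree q \<le> d" "0 < d" "z \<noteq> 0 \<or> w \<noteq> 0"
    "form_eval d p z w = 0" "form_eval d q z w = 0"
  shows "hres d p q = 0"
proof -
  have "0 < max (cmod z) (cmod w)" using assms(4) by (auto simp: less_max_iff_disj)
  moreover have "cmod (hres d p q) * max (cmod z) (cmod w) ^ d \<le> 0"
    using hres_eval_le[OF assms(1-3), of z "max (cmod z) (cmod w)" w 0] assms(5,6) by (auto simp: max_def)
  ultimately show ?thesis
    by (metis mult_le_0_iff norm_le_zero_iff not_less zero_less_norm_iff zero_less_power)
qed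

text \<open>The factor D, of positive formal degree, has a zero on the projective line: a root over
  the complex numbers if its degree equals j, and otherwise the point at infinity.\<close>

lemma hres_common_factor:
  fixes D A B :: "complex poly"
  assumes "degree D \<le> j" "degree A \<le> k - j" "degree B \<le> k - j" "0 < j" "j \<le> k"
  shows "hres k (D * A) (D * B) = 0"
proof -
  obtain z w where zw: "z \<noteq> 0 \<or> w \<noteq> 0" "form_eval j D z w = 0"
  proof (cases "degree D = j")
    case True
    then have "\<not> constant (poly D)" using assms(4) by (simp add: constant_degree)
    then obtain z where "poly D z = 0" using fundamental_theorem_of_algebra by blast
    then show ?thesis using that[of z 1] form_eval_right_1[OF assms(1)] by simp
  next
    case False
    then show ?thesis using that[of 1 0] assms(1) by (simp add: form_eval_right_0 coeff_eq_0)
  qed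
  have "degree (D * A) \<le> k" "degree (D * B) \<le> k"
    using degree_mult_le[of D A] degree_mult_le[of D B] assms by linarith+
  moreover have "form_eval k (D * A) z w = 0" "form_eval k (D * B) z w = 0"
    using form_eval_mult[OF assms(1,2), of z w] form_eval_mult[OF assms(1,3), of z w] zw assms(5) by simp_all
  ultimately show ?thesis using hres_common_zero zw(1) assms(4,5) by (metis less_le_trans)
qed

section \<open>Size of the coefficients under substitution and conjugation\<close>

definition mob_max :: "complex mob \<Rightarrow> real" where
  "mob_max N = cmax 1 (mob_pair N)"

lemma mob_max_nonneg: "0 \<le> mob_max N"
  by (simp add: mob_max_def cmax_nonneg)

lemma mob_max_eq: "mob_max (a, b, c, e) = max (max (cmod a) (cmod b)) (max (cmod c) (cmod e))"
proof -
  have "{..1::nat} = {0, 1}" by auto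
  then show ?thesis by (simp add: mob_max_def cmax_def max_def)
qed

lemma mob_max_adj: "mob_max (mob_adj N) = mob_max N"
  by (cases N) (simp only: mob_adj.simps mob_max_eq norm_minus_cancel max.commute max.left_commute max.assoc)

lemma mob_max_pos:
  assumes "mob_det N \<noteq> 0"
  shows "0 < mob_max N"
proof -
  obtain a b c e where "N = (a, b, c, e)" by (cases N)
  with assms have "a \<noteq> 0 \<or> b \<noteq> 0" "N = (a, b, c, e)" by auto
  then show ?thesis unfolding \<open>N = _\<close> mob_max_eq by (auto simp: less_max_iff_disj)
qed

text \<open>The columns (a, c) and (b, e) of N are the images of [1:0] and [0:1], so the values of p
  and q there are the extreme coefficients of the substituted forms. One of the columns contains a
  largest entry of N, and \<open>hres_eval_le\<close> applies to it.\<close>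

lemma cmax_hsubst_ge:
  assumes "degree p \<le> d" "degree q \<le> d" "0 < d"
  shows "cmod (hres d p q) * mob_max N ^ d
    \<le> 2 * real d * fact (2 * d - 1) * cmax d (p, q) ^ (2 * d - 1) * cmax d (hsubst d p N, hsubst d q N)"
proof -
  obtain a b c e where N: "N = (a, b, c, e)" by (cases N)
  let ?V = "cmax d (hsubst d p N, hsubst d q N)"
  have top: "form_eval d r a c = coeff (hsubst d r N) d" for r
    using form_eval_hsubst[of d r a b c e 1 0] by (simp add: N form_eval_right_0)
  have bot: "form_eval d r b e = coeff (hsubst d r N) 0" for r
    using form_eval_hsubst[of d r a b c e 0 1] by (simp add: N form_eval_left_0)
  have V: "cmod (coeff (hsubst d p N) i) \<le> ?V" "cmod (coeff (hsubst d q N) i) \<le> ?V" if "i \<le> d" for i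
    using cmax_ge[OF that, of "(hsubst d p N, hsubst d q N)"] by simp_all
  have ac: "mob_max N = max (cmod a) (cmod c) \<or> mob_max N = max (cmod b) (cmod e)"
    "cmod a \<le> mob_max N" "cmod b \<le> mob_max N" "cmod c \<le> mob_max N" "cmod e \<le> mob_max N"
    unfolding N mob_max_eq by (auto simp: max_def)
  from ac(1) show ?thesis
  proof
    assume "mob_max N = max (cmod a) (cmod c)"
    then show ?thesis using V[of d] ac
      by (intro hres_eval_le[OF assms, where z = a and w = c]) (auto simp: top max_def)
  next
    assume "mob_max N = max (cmod b) (cmod e)"
    then show ?thesis using V[of 0] ac
      by (intro hres_eval_le[OF assms, where z = b and w = e]) (auto simp: bot max_def)
  qed
qed

text \<open>The postcomposition is undone with the adjugate, which recovers the substituted forms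
  times the determinant; the factor 2 counts the two terms of each entry.\<close>

lemma cmax_mconj_ge_hsubst:
  "cmod (mob_det N) * cmax d (hsubst d p (mob_adj N), hsubst d q (mob_adj N))
    \<le> 2 * mob_max N * cmax d (mconj d N (p, q))"
proof -
  obtain a b c e where N: "N = (a, b, c, e)" by (cases N)
  define p' q' where "p' = hsubst d p (mob_adj N)" and "q' = hsubst d q (mob_adj N)"
  define Y where "Y = cmax d (mconj d N (p, q))"
  have F: "mconj d N (p, q) = (smult a p' + smult b q', smult c p' + smult e q')"
    by (simp add: N p'_def q'_def Let_def)
  have m: "cmod a \<le> mob_max N" "cmod b \<le> mob_max N" "cmod c \<le> mob_max N" "cmod e \<le> mob_max N"
    unfolding N mob_max_eq by (auto simp: max_def)
  have m0: "0 \<le> mob_max N" by (rule mob_max_nonneg)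
  have comb: "cmod (x * u - y * v) \<le> 2 * mob_max N * Y"
    if "cmod x \<le> mob_max N" "cmod y \<le> mob_max N" "cmod u \<le> Y" "cmod v \<le> Y" for x y u v
  proof -
    have "cmod x * cmod u \<le> mob_max N * Y" "cmod y * cmod v \<le> mob_max N * Y"
      using that m0 by (auto intro!: mult_mono)
    then show ?thesis using norm_triangle_ineq4[of "x * u" "y * v"] by (simp add: norm_mult)
  qed
  have bound: "cmod (mob_det N) * cmod (coeff p' i) \<le> 2 * mob_max N * Y"
    "cmod (mob_det N) * cmod (coeff q' i) \<le> 2 * mob_max N * Y" if "i \<le> d" for i
  proof -
    let ?u = "a * coeff p' i + b * coeff q' i" and ?v = "c * coeff p' i + e * coeff q' i"
    have "cmod ?u \<le> Y" "cmod ?v \<le> Y"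
      using cmax_ge[OF that, of "mconj d N (p, q)"] by (simp_all add: F Y_def)
    moreover have "mob_det N * coeff p' i = e * ?u - b * ?v" "mob_det N * coeff q' i = a * ?v - c * ?u"
      by (simp_all add: N algebra_simps)
    ultimately show "cmod (mob_det N) * cmod (coeff p' i) \<le> 2 * mob_max N * Y"
      "cmod (mob_det N) * cmod (coeff q' i) \<le> 2 * mob_max N * Y"
      unfolding norm_mult[symmetric] using m by (auto intro!: comb)
  qed
  show ?thesis
  proof (cases "mob_det N = 0")
    case True
    then show ?thesis using m0 by (simp add: cmax_nonneg)
  next
    case False
    have "cmax d (p', q') \<le> 2 * mob_max N * Y / cmod (mob_det N)"
      using bound False by (intro cmax_le) (auto simp: field_simps)
    then show ?thesis using False by (simp add: field_simps p'_def q'_def Y_def)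
  qed
qed

lemma cmax_mconj_ge:
  assumes "degree (fst g) \<le> d" "degree (snd g) \<le> d" "0 < d" "mob_det N \<noteq> 0"
  shows "cmod (hres d (fst g) (snd g)) * mob_max N ^ (d - 1) * cmod (mob_det N)
    \<le> 4 * real d * fact (2 * d - 1) * cmax d g ^ (2 * d - 1) * cmax d (mconj d N g)"
proof -
  obtain p q where g: "g = (p, q)" by (cases g)
  define m V where "m = mob_max N" and "V = cmax d (hsubst d p (mob_adj N), hsubst d q (mob_adj N))"
  define K where "K = 2 * real d * fact (2 * d - 1) * cmax d g ^ (2 * d - 1)"
  have m: "0 < m" unfolding m_def by (rule mob_max_pos[OF assms(4)])
  have K: "0 \<le> K" by (simp add: K_def cmax_nonneg)
  have "cmod (hres d p q) * m ^ d * cmod (mob_det N) \<le> K * V * cmod (mob_det N)"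
    using cmax_hsubst_ge[of p d q "mob_adj N"] assms
    by (intro mult_right_mono) (auto simp: g K_def V_def m_def mob_max_adj)
  also have "\<dots> = K * (cmod (mob_det N) * V)" by simp
  also have "\<dots> \<le> K * (2 * m * cmax d (mconj d N g))"
    unfolding V_def m_def g by (rule mult_left_mono[OF cmax_mconj_ge_hsubst K])
  finally have "(cmod (hres d p q) * m ^ (d - 1) * cmod (mob_det N)) * m \<le> (2 * K * cmax d (mconj d N g)) * m"
    using assms(3) by (simp add: power_eq_if mult_ac)
  then have "cmod (hres d p q) * m ^ (d - 1) * cmod (mob_det N) \<le> 2 * K * cmax d (mconj d N g)"
    using m by simp
  then show ?thesis by (simp add: g K_def m_def)
qed

text \<open>Multiplication by a linear form with coefficients of modulus at most m enlarges a bound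
  on the coefficients by at most 2m.\<close>

lemma coeff_linear_power_mult_le:
  fixes a b c e :: complex
  assumes "cmod a \<le> m" "cmod b \<le> m" "cmod c \<le> m" "cmod e \<le> m"
  shows "cmod (coeff ([:b, a:] ^ i * [:e, c:] ^ j) l) \<le> (2 * m) ^ (i + j)"
proof -
  have m: "0 \<le> m" using assms(1) norm_ge_zero order_trans by blast
  have step: "cmod (coeff ([:v, u:] * p) l) \<le> 2 * m * B"
    if "cmod u \<le> m" "cmod v \<le> m" "\<And>l. cmod (coeff p l) \<le> B" for u v p B l
  proof -
    have "coeff ([:v, u:] * p) l = v * coeff p l + u * coeff (pCons 0 p) l"
      by (simp add: coeff_pCons split: nat.splits)
    moreover have B: "cmod (coeff (pCons 0 p) l) \<le> B"
      using that(3) order_trans[OF norm_ge_zero that(3)] by (simp add: coeff_pCons split: nat.splits)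
    from B have "cmod v * cmod (coeff p l) + cmod u * cmod (coeff (pCons 0 p) l) \<le> m * B + m * B"
      using that m by (intro add_mono mult_mono) auto
    ultimately show ?thesis
      using norm_triangle_ineq[of "v * coeff p l" "u * coeff (pCons 0 p) l"] by (simp add: norm_mult mult_ac)
  qed
  have base: "cmod (coeff ([:e, c:] ^ j) l) \<le> (2 * m) ^ j" for l
  proof (induction j arbitrary: l)
    case 0
    show ?case by (simp add: coeff_pCons split: nat.splits)
  next
    case (Suc j)
    show ?case using step[OF assms(3,4) Suc] by (simp del: mult_pCons_left)
  qed
  show ?thesis
  proof (induction i arbitrary: l)
    case 0
    then show ?case using base by simp
  next
    case (Suc i)
    show ?case using step[OF assms(1,2) Suc] by (simp del: mult_pCons_left add: mult.assoc)
  qed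
qed

text \<open>The constant collects d + 1 monomials, 2^d from products of d linear forms and 2 from
  the postcomposition.\<close>

lemma cmax_mconj_le:
  "cmax d (mconj d N g) \<le> 2 * (real d + 1) * 2 ^ d * mob_max N ^ (d + 1) * cmax d g"
proof -
  obtain a b c e where N: "N = (a, b, c, e)" by (cases N)
  obtain p q where g: "g = (p, q)" by (cases g)
  define m X where "m = mob_max N" and "X = cmax d g"
  have m: "cmod a \<le> m" "cmod b \<le> m" "cmod c \<le> m" "cmod e \<le> m"
    unfolding m_def N mob_max_eq by (auto simp: max_def)
  have m0: "0 \<le> m" unfolding m_def by (rule mob_max_nonneg)
  have X: "cmod (coeff p i) \<le> X" "cmod (coeff q i) \<le> X" if "i \<le> d" for i
    using cmax_ge[OF that, of g] by (simp_all add: g X_def)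
  define B where "B = real (d + 1) * (X * (2 * m) ^ d)"
  have sub: "cmod (coeff (hsubst d r (mob_adj N)) l) \<le> B" if "\<And>i. i \<le> d \<Longrightarrow> cmod (coeff r i) \<le> X" for r l
  proof -
    have "cmod (coeff r i * coeff ([:- b, e:] ^ i * [:a, - c:] ^ (d - i)) l) \<le> X * (2 * m) ^ d" if "i \<le> d" for i
      using coeff_linear_power_mult_le[of e m "- b" "- c" a i "d - i" l] m that \<open>\<And>i. i \<le> d \<Longrightarrow> cmod (coeff r i) \<le> X\<close>[OF that]
      unfolding norm_mult by (intro mult_mono) (auto intro: order_trans[OF norm_ge_zero])
    then have "cmod (\<Sum>i\<le>d. coeff r i * coeff ([:- b, e:] ^ i * [:a, - c:] ^ (d - i)) l) \<le> real (card {..d}) * (X * (2 * m) ^ d)"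
      by (intro sum_norm_bound) auto
    then show ?thesis by (simp add: N hsubst_def coeff_sum B_def)
  qed
  have B: "0 \<le> B" using sub[OF X(1), of 0] norm_ge_zero order_trans by blast
  have comb: "cmod (x * u + y * v) \<le> 2 * m * B" if "cmod x \<le> m" "cmod y \<le> m" "cmod u \<le> B" "cmod v \<le> B" for x y u v
  proof -
    have "cmod x * cmod u \<le> m * B" "cmod y * cmod v \<le> m * B" using that m0 by (auto intro!: mult_mono)
    then show ?thesis using norm_triangle_ineq[of "x * u" "y * v"] by (simp add: norm_mult)
  qed
  have "mconj d N g = (smult a (hsubst d p (mob_adj N)) + smult b (hsubst d q (mob_adj N)),
      smult c (hsubst d p (mob_adj N)) + smult e (hsubst d q (mob_adj N)))"
    by (simp add: N g Let_def)
  then have "cmax d (mconj d N g) \<le> 2 * m * B"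
    using sub[OF X(1)] sub[OF X(2)] m by (intro cmax_le) (auto intro!: comb)
  also have "2 * m * B = 2 * (real d + 1) * 2 ^ d * m ^ (d + 1) * X"
    by (simp add: B_def power_mult_distrib algebra_simps)
  finally show ?thesis by (simp only: m_def X_def)
qed

section \<open>The normalised resultant and the two inequalities\<close>

lemma cmax_smult: "cmax k (smult t p, smult t q) = cmod t * cmax k (p, q)"
proof (rule antisym)
  show "cmax k (smult t p, smult t q) \<le> cmod t * cmax k (p, q)"
    using cmax_ge[of _ k "(p, q)"] by (intro cmax_le) (auto simp: norm_mult intro!: mult_left_mono)
  show "cmod t * cmax k (p, q) \<le> cmax k (smult t p, smult t q)"
  proof (cases "t = 0")
    case False
    have "cmax k (p, q) \<le> cmax k (smult t p, smult t q) / cmod t"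
      using cmax_ge[of _ k "(smult t p, smult t q)"] False
      by (intro cmax_le) (auto simp: norm_mult field_simps)
    then show ?thesis using False by (simp add: field_simps)
  qed (simp add: cmax_nonneg)
qed

text \<open>Numerator and denominator are both homogeneous of degree 2d, so the quotient depends on
  the projective pair only.\<close>

lemma absRes_smult:
  assumes "t \<noteq> 0"
  shows "absRes d (smult t p, smult t q) = absRes d (p, q)"
  using assms by (simp add: absRes_def hres_smult cmax_smult norm_mult norm_power power_mult_distrib)

lemma absRes_mconj_smult:
  assumes "t \<noteq> 0"
  shows "absRes d (mconj d N (smult t p, smult t q)) = absRes d (mconj d N (p, q))"
  using assms absRes_smult[OF assms] by (simp add: mconj_smult)

lemma absRes_mconj_scale:
  assumes "t \<noteq> 0"
  shows "absRes d (mconj d (mob_mul (t, 0, 0, t) N) g) = absRes d (mconj d N g)"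
proof -
  obtain p q where h: "mconj d N g = (p, q)" by (cases "mconj d N g")
  then have "degree p \<le> d" "degree q \<le> d" using degree_mconj[of d N g] by simp_all
  then have "mconj d (t, 0, 0, t) (p, q) = (smult (t ^ (d + 1)) p, smult (t ^ (d + 1)) q)"
    by (rule mconj_scalar)
  then show ?thesis using assms absRes_smult[of "t ^ (d + 1)" d p q] h
    by (simp add: mconj_mconj[symmetric])
qed

lemma absRes_le: "absRes d g \<le> fact (2 * d)"
proof (cases "cmax d g ^ (2 * d) = 0")
  case True
  show ?thesis unfolding absRes_def True by simp
next
  case False
  then have "0 < cmax d g ^ (2 * d)" using zero_le_power[OF cmax_nonneg, of d g "2 * d"] by linarith
  then show ?thesis using cmod_hres_le[of d "fst g" "snd g"]
    by (simp add: absRes_def divide_le_eq)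
qed

lemma cmax_pos:
  assumes "is_ratmap d g" "0 < d"
  shows "0 < cmax d g"
proof (rule ccontr)
  assume "\<not> 0 < cmax d g"
  then have "cmax d g = 0" using cmax_nonneg[of d g] by simp
  then have "cmod (hres d (fst g) (snd g)) \<le> 0" using cmod_hres_le[of d "fst g" "snd g"] assms(2) by (simp add: power_0_left)
  then show False using assms(1) by (simp add: is_ratmap_def)
qed

lemma absRes_pos:
  assumes "is_ratmap d g" "0 < d"
  shows "0 < absRes d g"
  using cmax_pos[OF assms] assms by (simp add: absRes_def is_ratmap_def)

lemma is_ratmap_mconj:
  assumes "is_ratmap d g" "mob_det N \<noteq> 0"
  shows "is_ratmap d (mconj d N g)"
  using assms by (simp add: is_ratmap_def degree_mconj hres_mconj)

text \<open>Small exactly when the transformation, once normalized, is close to a constant map.\<close>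
definition mob_ndet :: "complex mob \<Rightarrow> real" where
  "mob_ndet N = cmod (mob_det N) / mob_max N ^ 2"

lemma mob_ndet_pos: "mob_det N \<noteq> 0 \<Longrightarrow> 0 < mob_ndet N"
  using mob_max_pos[of N] by (simp add: mob_ndet_def)

lemma absRes_mconj:
  assumes "is_ratmap d g" "mob_det N \<noteq> 0"
  shows "absRes d (mconj d N g)
    = cmod (mob_det N) ^ (d * d + d) * cmod (hres d (fst g) (snd g)) / cmax d (mconj d N g) ^ (2 * d)"
  using assms by (simp add: absRes_def hres_mconj is_ratmap_def norm_mult norm_power)

text \<open>Since \<open>absRes_mconj\<close> is exact, a lower bound for the largest coefficient of
  the conjugate suffices: the 2d-th power of \<open>cmax_mconj_ge\<close>. It consumes 2d copies of
  the resultant of g, one from the conjugate and 2d - 1 from \<open>absRes d g\<close>, and 2d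
  copies of |det N|, which leaves d^2 - d of the d^2 + d.\<close>

lemma absRes_mconj_le_mob_ndet:
  assumes "is_ratmap d g" "mob_det N \<noteq> 0" "0 < d"
  shows "absRes d (mconj d N g) * absRes d g ^ (2 * d - 1)
    \<le> (4 * real d * fact (2 * d - 1)) ^ (2 * d) * mob_ndet N ^ (d * d - d)"
proof -
  define C where "C = 4 * real d * fact (2 * d - 1)"
  define D m X Y R where "D = cmod (mob_det N)" and "m = mob_max N" and "X = cmax d g"
    and "Y = cmax d (mconj d N g)" and "R = cmod (hres d (fst g) (snd g))"
  have pos: "0 < D" "0 < m" "0 < X" "0 < Y" "0 < R"
    using assms cmax_pos[OF assms(1,3)] cmax_pos[OF is_ratmap_mconj[OF assms(1,2)] assms(3)] mob_max_pos[OF assms(2)]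
    by (simp_all add: D_def m_def X_def Y_def R_def is_ratmap_def)
  have "R * m ^ (d - 1) * D \<le> C * X ^ (2 * d - 1) * Y"
    unfolding R_def m_def D_def C_def X_def Y_def
    using assms by (intro cmax_mconj_ge) (auto simp: is_ratmap_def)
  then have "(R * m ^ (d - 1) * D) ^ (2 * d) \<le> (C * X ^ (2 * d - 1) * Y) ^ (2 * d)"
    using pos by (intro power_mono) auto
  then have le: "R ^ (2 * d) * m ^ ((d - 1) * (2 * d)) * D ^ (2 * d) \<le> C ^ (2 * d) * X ^ ((2 * d - 1) * (2 * d)) * Y ^ (2 * d)"
    by (simp add: power_mult_distrib power_mult)
  have e: "2 * (d * d - d) = (d - 1) * (2 * d)" "d * d + d = (d * d - d) + 2 * d" "R ^ (2 * d) = R * R ^ (2 * d - 1)"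
    using assms(3) by (cases d; simp add: algebra_simps)+
  have X2: "(X ^ (2 * d)) ^ (2 * d - 1) = X ^ ((2 * d - 1) * (2 * d))"
    by (simp add: mult.commute flip: power_mult)
  have D2: "D ^ (d * d + d) = D ^ (d * d - d) * D ^ (2 * d)"
    by (subst e(2)) (rule power_add)
  have "absRes d (mconj d N g) * absRes d g ^ (2 * d - 1)
      = D ^ (d * d - d) * (R ^ (2 * d) * D ^ (2 * d)) / (Y ^ (2 * d) * X ^ ((2 * d - 1) * (2 * d)))"
    unfolding absRes_mconj[OF assms(1,2)]
    unfolding absRes_def D_def[symmetric] R_def[symmetric] X_def[symmetric] Y_def[symmetric] power_divide X2 D2 e(3)
    by (simp add: mult_ac)
  also have "\<dots> \<le> C ^ (2 * d) * (D ^ (d * d - d) / m ^ ((d - 1) * (2 * d)))"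
    using le pos by (simp add: field_simps)
  also have "D ^ (d * d - d) / m ^ ((d - 1) * (2 * d)) = mob_ndet N ^ (d * d - d)"
    unfolding mob_ndet_def power_divide power_mult[symmetric] e(1) by (simp add: D_def m_def)
  finally show ?thesis by (simp add: C_def)
qed

text \<open>Conjugating back with the adjugate gives g times det^(d+1), so the upper bound
  \<open>cmax_mconj_le\<close> for this second conjugation is a lower bound for the coefficients of
  the first. Its 2d-th power contains |det N| to the exponent 2(d^2+d), twice the one in the
  resultant.\<close>

lemma absRes_ge_mconj_mob_ndet:
  assumes "is_ratmap d g" "mob_det N \<noteq> 0" "0 < d"
  shows "absRes d (mconj d N g) * mob_ndet N ^ (d * d + d)
    \<le> (2 * (real d + 1) * 2 ^ d) ^ (2 * d) * absRes d g"
proof -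
  define C where "C = 2 * (real d + 1) * 2 ^ d"
  define D m X Y R where "D = cmod (mob_det N)" and "m = mob_max N" and "X = cmax d g"
    and "Y = cmax d (mconj d N g)" and "R = cmod (hres d (fst g) (snd g))"
  have pos: "0 < D" "0 < m" "0 < X" "0 < Y" "0 < R"
    using assms cmax_pos[OF assms(1,3)] cmax_pos[OF is_ratmap_mconj[OF assms(1,2)] assms(3)] mob_max_pos[OF assms(2)]
    by (simp_all add: D_def m_def X_def Y_def R_def is_ratmap_def)
  obtain p q where g: "g = (p, q)" by (cases g)
  have "mconj d (mob_adj N) (mconj d N g) = (smult (mob_det N ^ (d + 1)) p, smult (mob_det N ^ (d + 1)) q)"
    unfolding mconj_mconj mob_mul_adj_left g using assms(1)
    by (intro mconj_scalar) (auto simp: g is_ratmap_def)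
  then have "cmax d (mconj d (mob_adj N) (mconj d N g)) = D ^ (d + 1) * X"
    by (simp add: cmax_smult norm_mult norm_power D_def X_def g)
  then have "D ^ (d + 1) * X \<le> C * m ^ (d + 1) * Y"
    using cmax_mconj_le[of d "mob_adj N" "mconj d N g"]
    by (simp only: mob_max_adj C_def m_def Y_def)
  then have "(D ^ (d + 1) * X) ^ (2 * d) \<le> (C * m ^ (d + 1) * Y) ^ (2 * d)"
    using pos by (intro power_mono) auto
  moreover have "(d + 1) * (2 * d) = 2 * (d * d + d)" by (simp add: algebra_simps)
  ultimately have le: "D ^ (2 * (d * d + d)) * X ^ (2 * d) \<le> C ^ (2 * d) * m ^ (2 * (d * d + d)) * Y ^ (2 * d)"
    by (simp only: power_mult_distrib flip: power_mult)
  have D2: "D ^ (2 * (d * d + d)) = D ^ (d * d + d) * D ^ (d * d + d)"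
    by (simp only: mult_2 power_add)
  have "absRes d (mconj d N g) * mob_ndet N ^ (d * d + d)
      = R * (D ^ (2 * (d * d + d)) / (m ^ (2 * (d * d + d)) * Y ^ (2 * d)))"
    unfolding absRes_mconj[OF assms(1,2)] mob_ndet_def power_divide power_mult[symmetric]
    unfolding D_def[symmetric] R_def[symmetric] m_def[symmetric] Y_def[symmetric]
    unfolding D2 by (simp only: times_divide_eq_left times_divide_eq_right divide_divide_eq_left mult_ac)
  also have "\<dots> \<le> R * (C ^ (2 * d) / X ^ (2 * d))"
    using le pos by (intro mult_left_mono) (auto simp: field_simps)
  finally show ?thesis
    by (simp add: absRes_def C_def R_def X_def mult_ac)
qed

section \<open>The supremum over conjugations\<close>

lemma bdd_above_absRes: "bdd_above {absRes d (mconj d M g) | M. mob_det M \<noteq> 0}"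
  by (rule bdd_aboveI[of _ "fact (2 * d)"]) (use absRes_le in blast)

lemma absRes_le_absres:
  assumes "mob_det M \<noteq> 0"
  shows "absRes d (mconj d M g) \<le> absres d g"
  unfolding absres_def using assms by (intro cSup_upper bdd_above_absRes) blast

text \<open>The identity matrix already contributes a positive value. Half the supremum is therefore
  strictly below it.\<close>

lemma absres_attained_half:
  assumes "is_ratmap d g" "0 < d"
  obtains M where "mob_det M \<noteq> 0" "absres d g / 2 < absRes d (mconj d M g)"
proof -
  let ?S = "{absRes d (mconj d M g) | M. mob_det M \<noteq> 0}"
  have M1: "mob_det (1, 0, 0, 1 :: complex) \<noteq> 0" by simp
  have "0 < absRes d (mconj d (1, 0, 0, 1) g)"
    by (rule absRes_pos[OF is_ratmap_mconj[OF assms(1) M1] assms(2)])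
  then have "0 < absres d g" using absRes_le_absres[OF M1, of d g] by linarith
  then have "absres d g / 2 < Sup ?S" unfolding absres_def by simp
  moreover have "?S \<noteq> {}" using M1 by blast
  ultimately obtain s where s: "s \<in> ?S" "absres d g / 2 < s" by (rule less_cSupE)
  from s(1) obtain M where "s = absRes d (mconj d M g)" "mob_det M \<noteq> 0" by blast
  then show ?thesis using that s(2) by simp
qed

text \<open>The pair (z0, z1) has the identity as Sylvester matrix, and every linear pair arises
  from it by mixing.\<close>

lemma hres_1_linear: "hres 1 [:b, a:] [:e, c:] = a * e - b * (c :: 'a :: idom)"
proof -
  have "sylvester_mat_sub 1 1 [:0, 1:] [:1:] = (1\<^sub>m 2 :: 'a mat)"
    by (rule eq_matI) (auto simp: sylvester_mat_sub_def coeff_pCons less_2_cases_iff split: nat.splits)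
  then have "hres 1 [:0, 1:] [:1:] = (1 :: 'a)"
    by (simp only: hres_def resultant_sub_def det_one)
  then show ?thesis
    using hres_mix[of 1 a "[:0, 1:]" b "[:1:]" c e] by simp
qed

section \<open>Reduced limits at a scale\<close>

lemma power_powr:
  fixes x :: real
  assumes "0 \<le> x"
  shows "(x ^ n) powr e = (x powr e) ^ n"
  using assms by (induction n) (auto simp: powr_mult)

lemma mconj_add_smult:
  "fst (mconj k N (p + smult t p', q + smult t q')) = fst (mconj k N (p, q)) + smult t (fst (mconj k N (p', q')))"
  "snd (mconj k N (p + smult t p', q + smult t q')) = snd (mconj k N (p, q)) + smult t (snd (mconj k N (p', q')))"
  by (cases N; simp add: Let_def hsubst_add hsubst_smult smult_add_right mult.commute)+

text \<open>The product of L and the adjugate of M represents L M^-1; conjugating M g M^-1 by it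
  gives L g L^-1 up to the scalar det M.\<close>

lemma absRes_mconj_change:
  assumes "mob_det M \<noteq> 0"
  shows "absRes d (mconj d (mob_mul L (mob_adj M)) (mconj d M g)) = absRes d (mconj d L g)"
  using absRes_mconj_scale[OF assms, of d L g]
  by (simp only: mconj_mconj mob_mul_assoc mob_mul_adj_left mob_mul_scalar_commute)

lemma cmax_normalize_map:
  assumes "cmax d g \<noteq> 0"
  shows "cmax d (normalize_map d g) = 1"
  using assms cmax_nonneg[of d g] unfolding normalize_map_def cmax_smult by (simp add: norm_inverse)

lemma absRes_normalize_map:
  assumes "cmax d g \<noteq> 0"
  shows "absRes d (normalize_map d g) = absRes d g"
  using assms absRes_smult[of "inverse (complex_of_real (cmax d g))" d "fst g" "snd g"]
  by (simp add: normalize_map_def)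

lemma cmod_hres_normalize_map:
  assumes "cmax d g \<noteq> 0"
  shows "cmod (hres d (fst (normalize_map d g)) (snd (normalize_map d g))) = absRes d g"
  using absRes_normalize_map[OF assms] cmax_normalize_map[OF assms] by (simp add: absRes_def)

lemma absRes_mconj_normalize_map:
  assumes "cmax d g \<noteq> 0"
  shows "absRes d (mconj d N (normalize_map d g)) = absRes d (mconj d N g)"
  using assms absRes_mconj_smult[of "inverse (complex_of_real (cmax d g))" d N "fst g" "snd g"]
  by (simp add: normalize_map_def)

lemma cmax_mob_pair_pos: "mob_det N \<noteq> 0 \<Longrightarrow> 0 < cmax 1 (mob_pair N)"
  using mob_max_pos unfolding mob_max_def .

lemma absRes_mob_pair: "absRes 1 (mob_pair N) = mob_ndet N"
proof -
  obtain a b c e where N: "N = (a, b, c, e)" by (cases N)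
  have "hres 1 (fst (mob_pair N)) (snd (mob_pair N)) = mob_det N"
    unfolding N mob_pair.simps fst_conv snd_conv hres_1_linear by simp
  then show ?thesis unfolding absRes_def mob_ndet_def mob_max_def by simp
qed

context nat_ultrafilter
begin

lemma Hzero_eventually_cong:
  assumes "eventually (\<lambda>n. x n = y n) \<omega>" "Hzero \<omega> \<epsilon> x"
  shows "Hzero \<omega> \<epsilon> y"
  unfolding Hzero_iff
proof (intro allI impI)
  fix c :: real assume "c > 0"
  then have "eventually (\<lambda>n. cmod (x n) powr \<epsilon> n < c) \<omega>" using assms(2) by (simp add: Hzero_iff)
  with assms(1) show "eventually (\<lambda>n. cmod (y n) powr \<epsilon> n < c) \<omega>"
    by eventually_elim simp
qed

lemma Hring_inverse:
  assumes "\<not> Hzero \<omega> \<epsilon> x"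
  shows "Hring \<omega> \<epsilon> (\<lambda>n. inverse (x n))"
proof -
  obtain c where c: "c > 0" "eventually (\<lambda>n. c \<le> cmod (x n) powr \<epsilon> n) \<omega>" using assms not_Hzero_iff by blast
  from c(2) have "eventually (\<lambda>n. cmod (inverse (x n)) powr \<epsilon> n \<le> inverse c) \<omega>"
  proof eventually_elim
    case (elim n)
    have "cmod (inverse (x n)) powr \<epsilon> n = inverse (cmod (x n) powr \<epsilon> n)"
      by (simp add: norm_inverse inverse_powr)
    then show ?case using elim c(1) by (simp add: le_imp_inverse_le)
  qed
  then show ?thesis unfolding Hring_iff by blast
qed

lemma not_Hzero_power:
  assumes "\<not> Hzero \<omega> \<epsilon> x" "\<not> Hzero \<omega> \<epsilon> (\<lambda>_. 1)"
  shows "\<not> Hzero \<omega> \<epsilon> (\<lambda>n. x n ^ k)"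
  using assms by (induction k) (simp_all add: not_Hzero_mult)

end

context ultrafilter_scale
begin

section \<open>Resultants and coprimality over the field\<close>

lemma not_Hzero_1: "\<not> Hzero \<omega> \<epsilon> (\<lambda>_. 1)"
  unfolding not_Hzero_iff by (auto intro!: exI[of _ 1])

lemma Heqf_trans:
  assumes "Heqf \<omega> \<epsilon> P Q" "Heqf \<omega> \<epsilon> Q R"
  shows "Heqf \<omega> \<epsilon> P R"
  unfolding Heqf_def
proof
  fix i
  have "Hzero \<omega> \<epsilon> (\<lambda>n. (coeff (P n) i - coeff (Q n) i) + (coeff (Q n) i - coeff (R n) i))"
    using assms unfolding Heqf_def by (intro Hzero_add) auto
  then show "Hzero \<omega> \<epsilon> (\<lambda>n. coeff (P n) i - coeff (R n) i)" by simp
qed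

lemma Heqf_refl: "Heqf \<omega> \<epsilon> P P"
  by (simp add: Heqf_def)

lemma Hform_coeff: "Hform \<omega> \<epsilon> k P \<Longrightarrow> Hring \<omega> \<epsilon> (\<lambda>n. coeff (P n) i)"
  by (simp add: Hform_def)

text \<open>The products D A and D B have a genuine common factor for every n, so their complex
  resultants vanish exactly, and the resultant depends only on classes. No root over the field
  itself has to be found.\<close>

lemma Hzero_hres_if_common_factor:
  assumes "Hform \<omega> \<epsilon> k P" "Hform \<omega> \<epsilon> k Q" "0 < j" "j \<le> k"
    "Hform \<omega> \<epsilon> j D" "Hform \<omega> \<epsilon> (k - j) A" "Hform \<omega> \<epsilon> (k - j) B"
    "Heqf \<omega> \<epsilon> P (\<lambda>n. D n * A n)" "Heqf \<omega> \<epsilon> Q (\<lambda>n. D n * B n)"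
  shows "Hzero \<omega> \<epsilon> (\<lambda>n. hres k (P n) (Q n))"
proof -
  have "hres k (D n * A n) (D n * B n) = 0" for n
    using assms(5-7) by (intro hres_common_factor[OF _ _ _ assms(3,4)]) (auto simp: Hform_def)
  moreover have "Hzero \<omega> \<epsilon> (\<lambda>n. hres k (P n) (Q n) - hres k (D n * A n) (D n * B n))"
    by (intro Hzero_diff_hres assms(8,9) Hring_coeff_mult assms(1,2,5-7)[THEN Hform_coeff])
  ultimately show ?thesis by simp
qed

lemma hres_0_0: "0 < k \<Longrightarrow> hres k 0 (0 :: complex poly) = 0"
  using hres_smult[of k 0 0 0] by (simp add: power_0_left)

lemma Hzero_hres_if_Heqf_0:
  assumes "Hform \<omega> \<epsilon> k P" "Hform \<omega> \<epsilon> k Q" "0 < k" "Heqf \<omega> \<epsilon> P (\<lambda>_. 0)" "Heqf \<omega> \<epsilon> Q (\<lambda>_. 0)"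
  shows "Hzero \<omega> \<epsilon> (\<lambda>n. hres k (P n) (Q n))"
proof -
  have "Hzero \<omega> \<epsilon> (\<lambda>n. hres k (P n) (Q n) - hres k 0 0)"
    using Hzero_diff_hres[of P Q "\<lambda>_. 0" "\<lambda>_. 0" k] assms by (simp add: Hform_coeff Hring_0)
  then show ?thesis using hres_0_0[OF assms(3)] by simp
qed

text \<open>A nonzero resultant excludes common factors and simultaneous vanishing, so the pair is
  already reduced, with gcd 1.\<close>

lemma Hreduced_self:
  assumes "Hform \<omega> \<epsilon> k P" "Hform \<omega> \<epsilon> k Q" "0 < k" "\<not> Hzero \<omega> \<epsilon> (\<lambda>n. hres k (P n) (Q n))"
  shows "Hreduced \<omega> \<epsilon> k P Q k P Q"
  unfolding Hreduced_def Hcoprime_def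
proof (intro conjI)
  have "Hform \<omega> \<epsilon> (k - k) (\<lambda>_. 1)" by (simp add: Hform_def Hring_const)
  then show "\<exists>G. Hform \<omega> \<epsilon> (k - k) G \<and> Heqf \<omega> \<epsilon> P (\<lambda>n. G n * P n) \<and> Heqf \<omega> \<epsilon> Q (\<lambda>n. G n * Q n)"
    using Heqf_refl by (intro exI[of _ "\<lambda>_. 1"]) simp
qed (use assms Hzero_hres_if_common_factor[OF assms(1,2)] Hzero_hres_if_Heqf_0 in blast)+

text \<open>A coefficient of P that is nonzero over the field has an inverse in the ring; the factor
  t is the quotient of the corresponding coefficients, and the other coefficient agrees because the
  determinant is null.\<close>

lemma Heqf_smult_of_Hzero_det:
  assumes P: "Hform \<omega> \<epsilon> 1 P" and Q: "Hform \<omega> \<epsilon> 1 Q"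
    and det: "Hzero \<omega> \<epsilon> (\<lambda>n. coeff (P n) 1 * coeff (Q n) 0 - coeff (P n) 0 * coeff (Q n) 1)"
    and nz: "\<not> Heqf \<omega> \<epsilon> P (\<lambda>_. 0)"
  obtains t where "Hring \<omega> \<epsilon> t" "Heqf \<omega> \<epsilon> Q (\<lambda>n. smult (t n) (P n))"
proof -
  have deg: "coeff (P n) l = 0" "coeff (Q n) l = 0" if "l \<noteq> 0" "l \<noteq> 1" for n l
  proof -
    have "degree (P n) \<le> 1" "degree (Q n) \<le> 1" "1 < l" using P Q that by (simp_all add: Hform_def)
    then show "coeff (P n) l = 0" "coeff (Q n) l = 0" by (simp_all add: coeff_eq_0)
  qed
  obtain i where i: "\<not> Hzero \<omega> \<epsilon> (\<lambda>n. coeff (P n) i)"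
    using nz by (auto simp: Heqf_def)
  have i01: "i = 0 \<or> i = 1"
  proof (rule ccontr)
    assume "\<not> (i = 0 \<or> i = 1)"
    then have "(\<lambda>n. coeff (P n) i) = (\<lambda>_. 0)" using deg(1) by blast
    then show False using i by simp
  qed
  define t where "t = (\<lambda>n. coeff (Q n) i * inverse (coeff (P n) i))"
  have "Hring \<omega> \<epsilon> t"
    unfolding t_def by (intro Hring_mult Hring_inverse i Hform_coeff[OF Q])
  moreover have "Hzero \<omega> \<epsilon> (\<lambda>n. coeff (Q n) l - coeff (smult (t n) (P n)) l)" for l
  proof -
    define w where "w = (\<lambda>n. coeff (Q n) l * coeff (P n) i - coeff (Q n) i * coeff (P n) l)"
    have "Hzero \<omega> \<epsilon> w"
    proof -
      consider "l = i" | "i = 0" "l = 1" | "i = 1" "l = 0" | "l \<noteq> 0" "l \<noteq> 1" using i01 by blast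
      then show ?thesis
      proof cases
        case 2
        then have "w = (\<lambda>n. - (coeff (P n) 1 * coeff (Q n) 0 - coeff (P n) 0 * coeff (Q n) 1))"
          by (auto simp: w_def)
        then show ?thesis using Hzero_uminus[OF det] by simp
      next
        case 3
        then have "w = (\<lambda>n. coeff (P n) 1 * coeff (Q n) 0 - coeff (P n) 0 * coeff (Q n) 1)"
          by (auto simp: w_def)
        then show ?thesis using det by simp
      qed (simp_all add: w_def deg)
    qed
    then have "Hzero \<omega> \<epsilon> (\<lambda>n. w n * inverse (coeff (P n) i))"
      by (intro Hzero_mult Hring_inverse i)
    \<comment> \<open>Cancelling the coefficient of P is legitimate only where it is nonzero, which
      holds along the ultrafilter.\<close>
    moreover have "eventually (\<lambda>n. w n * inverse (coeff (P n) i) = coeff (Q n) l - coeff (smult (t n) (P n)) l) \<omega>"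
      using not_Hzero_imp_nonzero[OF i] by eventually_elim (simp add: w_def t_def field_simps)
    ultimately show ?thesis by (rule Hzero_eventually_cong[rotated])
  qed
  ultimately show ?thesis using that by (auto simp: Heqf_def)
qed

lemma hres_1: "degree p \<le> 1 \<Longrightarrow> degree q \<le> 1 \<Longrightarrow> hres 1 p q = coeff p 1 * coeff q 0 - coeff p 0 * coeff (q :: complex poly) 1"
proof -
  have "r = [:coeff r 0, coeff r 1:]" if "degree r \<le> 1" for r :: "complex poly"
  proof (rule poly_eqI)
    fix n show "coeff r n = coeff [:coeff r 0, coeff r 1:] n"
      using that by (cases n; cases "n - 1") (auto simp: coeff_eq_0)
  qed
  then show "degree p \<le> 1 \<Longrightarrow> degree q \<le> 1 \<Longrightarrow> hres 1 p q = coeff p 1 * coeff q 0 - coeff p 0 * coeff q 1"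
    using hres_1_linear by metis
qed

lemma Hcoprime_1_no_common_factor:
  assumes "Hcoprime \<omega> \<epsilon> 1 P Q" "Hform \<omega> \<epsilon> 1 D" "\<not> Heqf \<omega> \<epsilon> D (\<lambda>_. 0)" "Hform \<omega> \<epsilon> 0 A" "Hform \<omega> \<epsilon> 0 B"
    "Heqf \<omega> \<epsilon> P (\<lambda>n. D n * A n)" "Heqf \<omega> \<epsilon> Q (\<lambda>n. D n * B n)"
  shows False
proof -
  have "\<exists>j D A B. 0 < j \<and> j \<le> 1 \<and> Hform \<omega> \<epsilon> j D \<and> \<not> Heqf \<omega> \<epsilon> D (\<lambda>_. 0)
           \<and> Hform \<omega> \<epsilon> (1 - j) A \<and> Hform \<omega> \<epsilon> (1 - j) B
           \<and> Heqf \<omega> \<epsilon> P (\<lambda>n. D n * A n) \<and> Heqf \<omega> \<epsilon> Q (\<lambda>n. D n * B n)"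
    by (rule exI[of _ 1], rule exI[of _ D], rule exI[of _ A], rule exI[of _ B]) (use assms in simp)
  then show False using assms(1) unfolding Hcoprime_def by blast
qed

text \<open>In degree 1 a vanishing resultant makes one form a multiple of the other, and the latter
  is the common factor. If P is zero the roles are exchanged; coprimality excludes that both
  are.\<close>

lemma not_Hcoprime_1:
  assumes P: "Hform \<omega> \<epsilon> 1 P" and Q: "Hform \<omega> \<epsilon> 1 Q" and res: "Hzero \<omega> \<epsilon> (\<lambda>n. hres 1 (P n) (Q n))"
  shows "\<not> Hcoprime \<omega> \<epsilon> 1 P Q"
proof
  assume cop: "Hcoprime \<omega> \<epsilon> 1 P Q"
  have "hres 1 (P n) (Q n) = coeff (P n) 1 * coeff (Q n) 0 - coeff (P n) 0 * coeff (Q n) 1" for n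
    using P Q by (intro hres_1) (auto simp: Hform_def)
  then have det: "Hzero \<omega> \<epsilon> (\<lambda>n. coeff (P n) 1 * coeff (Q n) 0 - coeff (P n) 0 * coeff (Q n) 1)"
    using res by simp
  have const: "Hform \<omega> \<epsilon> 0 (\<lambda>n. [:t n:])" if "Hring \<omega> \<epsilon> t" for t
  proof -
    have "Hring \<omega> \<epsilon> (\<lambda>n. coeff [:t n:] i)" for i
      using that by (cases i) (simp_all add: Hring_0)
    then show ?thesis by (simp add: Hform_def)
  qed
  have one: "Hform \<omega> \<epsilon> 0 (\<lambda>_. [:1:])" by (rule const[OF Hring_const])
  show False
  proof (cases "Heqf \<omega> \<epsilon> P (\<lambda>_. 0)")
    case False
    obtain t where t: "Hring \<omega> \<epsilon> t" "Heqf \<omega> \<epsilon> Q (\<lambda>n. smult (t n) (P n))"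
      by (rule Heqf_smult_of_Hzero_det[OF P Q det False])
    then have "Heqf \<omega> \<epsilon> P (\<lambda>n. P n * [:1:])" "Heqf \<omega> \<epsilon> Q (\<lambda>n. P n * [:t n:])"
      by (simp_all add: Heqf_refl)
    then show False by (rule Hcoprime_1_no_common_factor[OF cop P False one const[OF t(1)]])
  next
    case True
    then have nz: "\<not> Heqf \<omega> \<epsilon> Q (\<lambda>_. 0)" using cop by (auto simp: Hcoprime_def)
    have "Hzero \<omega> \<epsilon> (\<lambda>n. coeff (Q n) 1 * coeff (P n) 0 - coeff (Q n) 0 * coeff (P n) 1)"
      using Hzero_uminus[OF det] by (simp add: mult.commute)
    then obtain t where t: "Hring \<omega> \<epsilon> t" "Heqf \<omega> \<epsilon> P (\<lambda>n. smult (t n) (Q n))"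
      using Heqf_smult_of_Hzero_det[OF Q P _ nz] by blast
    then have "Heqf \<omega> \<epsilon> P (\<lambda>n. Q n * [:t n:])" "Heqf \<omega> \<epsilon> Q (\<lambda>n. Q n * [:1:])"
      by (simp_all add: Heqf_refl)
    then show False by (rule Hcoprime_1_no_common_factor[OF cop Q nz const[OF t(1)] one])
  qed
qed

lemma Hform_normalize_map:
  assumes "\<And>n. degree (fst (g n)) \<le> d" "\<And>n. degree (snd (g n)) \<le> d" "\<And>n. cmax d (g n) \<noteq> 0"
  shows "Hform \<omega> \<epsilon> d (\<lambda>n. fst (normalize_map d (g n)))" "Hform \<omega> \<epsilon> d (\<lambda>n. snd (normalize_map d (g n)))"
proof -
  have deg: "degree (fst (normalize_map d (g n))) \<le> d" "degree (snd (normalize_map d (g n))) \<le> d" for n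
    using assms by (auto simp: normalize_map_def intro: order_trans[OF degree_smult_le])
  have "cmod (coeff (fst (normalize_map d (g n))) i) \<le> 1" "cmod (coeff (snd (normalize_map d (g n))) i) \<le> 1" for n i
    using cmax_ge[of i d "normalize_map d (g n)"] cmax_normalize_map[OF assms(3), of n] deg[of n]
    by (cases "i \<le> d"; simp add: coeff_eq_0)+
  then show "Hform \<omega> \<epsilon> d (\<lambda>n. fst (normalize_map d (g n)))" "Hform \<omega> \<epsilon> d (\<lambda>n. snd (normalize_map d (g n)))"
    using deg by (auto simp: Hform_def intro!: Hring_bounded)
qed

lemma Hform_0_mult:
  assumes "Hform \<omega> \<epsilon> 0 G"
  shows "G n * p = smult (coeff (G n) 0) p"
proof -
  have "degree (G n) = 0" using assms by (simp add: Hform_def)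
  then have "G n = [:coeff (G n) 0:]" by (rule degree_eq_zeroE) simp
  then show "G n * p = smult (coeff (G n) 0) p" by (metis mult_pCons_left mult_zero_left pCons_0_0 add_0_right)
qed

text \<open>The largest coefficient is 1, and so are its powers, whereas null coefficients would
  force these powers to tend to 0.\<close>

lemma not_Heqf_0_both:
  assumes "\<And>n. degree (fst (g n)) \<le> d" "\<And>n. degree (snd (g n)) \<le> d" "\<And>n. cmax d (g n) = 1"
  shows "\<not> (Heqf \<omega> \<epsilon> (\<lambda>n. fst (g n)) (\<lambda>_. 0) \<and> Heqf \<omega> \<epsilon> (\<lambda>n. snd (g n)) (\<lambda>_. 0))"
proof
  assume "Heqf \<omega> \<epsilon> (\<lambda>n. fst (g n)) (\<lambda>_. 0) \<and> Heqf \<omega> \<epsilon> (\<lambda>n. snd (g n)) (\<lambda>_. 0)"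
  then have z: "Hzero \<omega> \<epsilon> (\<lambda>n. coeff (fst (g n)) i - 0)" "Hzero \<omega> \<epsilon> (\<lambda>n. coeff (snd (g n)) i - 0)" for i
    by (simp_all add: Heqf_def)
  have "((\<lambda>n. cmod ((\<lambda>_. 0) n) powr \<epsilon> n) \<longlongrightarrow> 0) \<omega>" by simp
  note lim = Hnorm_tendsto_cong[OF z(1) this] Hnorm_tendsto_cong[OF z(2) this]
  have "((\<lambda>n. cmax d (g n) powr \<epsilon> n) \<longlongrightarrow> Max ((\<lambda>_. 0) ` {..d} \<union> (\<lambda>_. 0) ` {..d})) \<omega>"
    by (rule cmax_powr_tendsto) (rule lim)+
  then have "((\<lambda>n. 1) \<longlongrightarrow> (0 :: real)) \<omega>" by (simp add: assms(3) image_constant_conv)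
  then show False using uf_neq_bot tendsto_unique[OF uf_neq_bot tendsto_const] by fastforce
qed

text \<open>The resultant of the normalised pair has modulus \<open>mob_ndet\<close>, so the limit
  has degree 1 exactly when that class is nonzero. As an arbitrary reduced pair may witness the
  degree, it is compared with the given one through G.\<close>

lemma limit_degree_1_iff:
  assumes "\<And>n. mob_det (K n) \<noteq> 0"
  shows "limit_degree_is \<omega> \<epsilon> 1 (\<lambda>n. mob_pair (K n)) 1
    \<longleftrightarrow> (\<exists>c>0. eventually (\<lambda>n. c \<le> mob_ndet (K n) powr \<epsilon> n) \<omega>)"
proof -
  define P where "P = (\<lambda>n. fst (normalize_map 1 (mob_pair (K n))))"
  define Q where "Q = (\<lambda>n. snd (normalize_map 1 (mob_pair (K n))))"
  have cm: "cmax 1 (mob_pair (K n)) \<noteq> 0" for n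
    using cmax_mob_pair_pos[OF assms] by (metis less_irrefl)
  have deg: "degree (fst (mob_pair (K n))) \<le> 1" "degree (snd (mob_pair (K n))) \<le> 1" for n
    by (cases "K n", use degree_linear in fastforce)+
  have P: "Hform \<omega> \<epsilon> 1 P" and Q: "Hform \<omega> \<epsilon> 1 Q"
    unfolding P_def Q_def by (intro Hform_normalize_map deg cm)+
  have "cmod (hres 1 (P n) (Q n)) = mob_ndet (K n)" for n
    unfolding P_def Q_def cmod_hres_normalize_map[OF cm] absRes_mob_pair ..
  then have iff: "(\<exists>c>0. eventually (\<lambda>n. c \<le> mob_ndet (K n) powr \<epsilon> n) \<omega>) \<longleftrightarrow> \<not> Hzero \<omega> \<epsilon> (\<lambda>n. hres 1 (P n) (Q n))"
    by (simp only: not_Hzero_iff)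
  have "limit_degree_is \<omega> \<epsilon> 1 (\<lambda>n. mob_pair (K n)) 1 \<longleftrightarrow> (\<exists>P' Q'. Hreduced \<omega> \<epsilon> 1 P Q 1 P' Q')"
    by (simp add: limit_degree_is_def limit_map_def P_def Q_def)
  also have "\<dots> \<longleftrightarrow> \<not> Hzero \<omega> \<epsilon> (\<lambda>n. hres 1 (P n) (Q n))"
  proof
    show "\<not> Hzero \<omega> \<epsilon> (\<lambda>n. hres 1 (P n) (Q n)) \<Longrightarrow> \<exists>P' Q'. Hreduced \<omega> \<epsilon> 1 P Q 1 P' Q'"
      using Hreduced_self[OF P Q] by auto
    assume "\<exists>P' Q'. Hreduced \<omega> \<epsilon> 1 P Q 1 P' Q'"
    then obtain P' Q' G where F: "Hform \<omega> \<epsilon> 1 P'" "Hform \<omega> \<epsilon> 1 Q'" and cop: "Hcoprime \<omega> \<epsilon> 1 P' Q'"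
      and G: "Hform \<omega> \<epsilon> 0 G" and eq: "Heqf \<omega> \<epsilon> P (\<lambda>n. G n * P' n)" "Heqf \<omega> \<epsilon> Q (\<lambda>n. G n * Q' n)"
      unfolding Hreduced_def by auto
    define \<gamma> where "\<gamma> n = coeff (G n) 0" for n
    have \<gamma>: "Hring \<omega> \<epsilon> \<gamma>" "G n * p = smult (\<gamma> n) p" for n p
      using Hform_coeff[OF G, of 0] Hform_0_mult[OF G] by (simp_all add: \<gamma>_def[abs_def])
    \<comment> \<open>The formal degree of G is 1 - 1 = 0. A null constant would make the normalised
      pair null.\<close>
    have \<gamma>nz: "\<not> Hzero \<omega> \<epsilon> \<gamma>"
    proof
      assume z: "Hzero \<omega> \<epsilon> \<gamma>"
      have "Heqf \<omega> \<epsilon> (\<lambda>n. G n * P' n) (\<lambda>_. 0)" "Heqf \<omega> \<epsilon> (\<lambda>n. G n * Q' n) (\<lambda>_. 0)"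
        using Hzero_mult[OF z Hform_coeff[OF F(1)]] Hzero_mult[OF z Hform_coeff[OF F(2)]]
        by (simp_all add: Heqf_def \<gamma>(2))
      then have "Heqf \<omega> \<epsilon> P (\<lambda>_. 0)" "Heqf \<omega> \<epsilon> Q (\<lambda>_. 0)"
        using Heqf_trans eq by blast+
      then show False
        using not_Heqf_0_both[of "\<lambda>n. normalize_map 1 (mob_pair (K n))" 1] cmax_normalize_map[OF cm] P Q
        by (simp add: P_def Q_def Hform_def)
    qed
    have nz: "\<not> Hzero \<omega> \<epsilon> (\<lambda>n. hres 1 (P' n) (Q' n))"
      using not_Hcoprime_1[OF F] cop by blast
    have "Hzero \<omega> \<epsilon> (\<lambda>n. hres 1 (P n) (Q n) - hres 1 (G n * P' n) (G n * Q' n))"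
      by (intro Hzero_diff_hres eq Hring_coeff_mult Hform_coeff[OF P] Hform_coeff[OF Q] Hform_coeff[OF G] Hform_coeff[OF F(1)] Hform_coeff[OF F(2)])
    moreover have "hres 1 (G n * P' n) (G n * Q' n) = \<gamma> n ^ 2 * hres 1 (P' n) (Q' n)" for n
      using hres_smult[of 1 "\<gamma> n" "P' n" "Q' n"] by (simp add: \<gamma>(2))
    ultimately have diff: "Hzero \<omega> \<epsilon> (\<lambda>n. hres 1 (P n) (Q n) - \<gamma> n ^ 2 * hres 1 (P' n) (Q' n))" by simp
    show "\<not> Hzero \<omega> \<epsilon> (\<lambda>n. hres 1 (P n) (Q n))"
    proof
      assume "Hzero \<omega> \<epsilon> (\<lambda>n. hres 1 (P n) (Q n))"
      from Hzero_diff[OF this diff] have "Hzero \<omega> \<epsilon> (\<lambda>n. \<gamma> n ^ 2 * hres 1 (P' n) (Q' n))" by simp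
      then show False using not_Hzero_mult[OF not_Hzero_power[OF \<gamma>nz not_Hzero_1] nz] by blast
    qed
  qed
  finally show ?thesis using iff by simp
qed

end

context nat_ultrafilter
begin

lemma ultrafilter_scale_eps:
  assumes "\<And>n. is_ratmap d (g n)" "0 < d"
  shows "ultrafilter_scale \<omega> (eps d g)"
  by unfold_locales (simp_all add: eps_def theta_pos theta_le_1 absRes_pos assms)

lemma not_scale_trivial_iff:
  assumes "\<And>n. \<epsilon> n \<le> 1"
  shows "\<not> scale_trivial \<omega> \<epsilon> \<longleftrightarrow> (\<forall>c>0. eventually (\<lambda>n. \<epsilon> n < c) \<omega>)"
proof -
  have "eventually (\<lambda>n. \<epsilon> n / 1 \<le> 1) \<omega>" using assms by simp
  then have "scale_trivial \<omega> \<epsilon> \<longleftrightarrow> (\<exists>c>0. eventually (\<lambda>n. c \<le> \<epsilon> n / 1) \<omega>)"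
    unfolding scale_trivial_def scale_eq_iff by blast
  then show ?thesis by (auto simp: not_eventually_uf not_le)
qed

end

section \<open>Comparing resultants at one scale\<close>

context ultrafilter_scale
begin

lemma mob_ndet_powr_ge:
  assumes g: "\<And>n. is_ratmap d (g n)" and K: "\<And>n. mob_det (K n) \<noteq> 0" and d: "2 \<le> d"
    and "0 < a" "eventually (\<lambda>n. a \<le> absRes d (mconj d (K n) (g n)) powr \<epsilon> n) \<omega>"
    and "0 < b" "eventually (\<lambda>n. b \<le> absRes d (g n) powr \<epsilon> n) \<omega>"
  shows "\<exists>c>0. eventually (\<lambda>n. c \<le> mob_ndet (K n) powr \<epsilon> n) \<omega>"
proof -
  define C where "C = (4 * real d * fact (2 * d - 1)) ^ (2 * d)"
  define k where "k = d * d - d"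
  define c where "c = a * b ^ (2 * d - 1) / max 1 C"
  have C: "0 \<le> C" by (simp add: C_def)
  have c: "0 < c" using assms(4,6) by (simp add: c_def less_max_iff_disj)
  \<comment> \<open>This is where d \<ge> 2 enters: for d = 1 the exponent d^2 - d is 0 and the
    inequality says nothing about K.\<close>
  have k: "0 < k" using d by (cases d) (auto simp: k_def)
  from assms(5,7) have "eventually (\<lambda>n. min 1 c \<le> mob_ndet (K n) powr \<epsilon> n) \<omega>"
  proof eventually_elim
    case (elim n)
    define x where "x = mob_ndet (K n) powr \<epsilon> n"
    have pos: "0 < absRes d (g n)" "0 < absRes d (mconj d (K n) (g n))" "0 < mob_ndet (K n)"
      using absRes_pos[OF g] absRes_pos[OF is_ratmap_mconj[OF g K]] mob_ndet_pos[OF K] d by auto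
    have "a * b ^ (2 * d - 1) \<le> absRes d (mconj d (K n) (g n)) powr \<epsilon> n * (absRes d (g n) powr \<epsilon> n) ^ (2 * d - 1)"
      using elim assms(4,6) by (intro mult_mono power_mono) auto
    also have "\<dots> = (absRes d (mconj d (K n) (g n)) * absRes d (g n) ^ (2 * d - 1)) powr \<epsilon> n"
      using pos by (simp add: powr_mult power_powr)
    also have "\<dots> \<le> (C * mob_ndet (K n) ^ k) powr \<epsilon> n"
      using pos d eps_pos[of n] absRes_mconj_le_mob_ndet[OF g K, of n n]
      by (intro powr_mono2) (auto simp: C_def k_def)
    also have "\<dots> = C powr \<epsilon> n * x ^ k"
      using pos C by (simp add: powr_mult power_powr x_def)
    also have "\<dots> \<le> max 1 C * x ^ k"
      using powr_eps_le[OF C order_refl] by (intro mult_right_mono) (auto simp: x_def)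
    finally have "c \<le> x ^ k" by (simp add: c_def divide_le_eq less_max_iff_disj mult.commute)
    \<comment> \<open>A lower bound for x^k is one for x when x \<le> 1; a larger x exceeds 1. Hence
      the minimum with 1.\<close>
    show ?case
    proof (cases "x \<le> 1")
      case True
      then have "x ^ k \<le> x" using power_decreasing[of 1 k x] k by (simp add: x_def)
      then show ?thesis using \<open>c \<le> x ^ k\<close> by (simp add: x_def)
    qed (simp add: x_def)
  qed
  then show ?thesis using c by (intro exI[of _ "min 1 c"]) auto
qed

lemma absRes_powr_ge:
  assumes g: "\<And>n. is_ratmap d (g n)" and K: "\<And>n. mob_det (K n) \<noteq> 0" and d: "0 < d"
    and "0 < a" "eventually (\<lambda>n. a \<le> absRes d (mconj d (K n) (g n)) powr \<epsilon> n) \<omega>"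
    and "0 < b" "eventually (\<lambda>n. b \<le> mob_ndet (K n) powr \<epsilon> n) \<omega>"
  shows "\<exists>c>0. eventually (\<lambda>n. c \<le> absRes d (g n) powr \<epsilon> n) \<omega>"
proof -
  define C where "C = (2 * (real d + 1) * 2 ^ d) ^ (2 * d)"
  define k where "k = d * d + d"
  define c where "c = a * b ^ k / max 1 C"
  have C: "0 \<le> C" by (simp add: C_def)
  have c: "0 < c" using assms(4,6) by (simp add: c_def less_max_iff_disj)
  from assms(5,7) have "eventually (\<lambda>n. c \<le> absRes d (g n) powr \<epsilon> n) \<omega>"
  proof eventually_elim
    case (elim n)
    have pos: "0 < absRes d (g n)" "0 < absRes d (mconj d (K n) (g n))" "0 < mob_ndet (K n)"
      using absRes_pos[OF g] absRes_pos[OF is_ratmap_mconj[OF g K]] mob_ndet_pos[OF K] d by auto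
    have "a * b ^ k \<le> absRes d (mconj d (K n) (g n)) powr \<epsilon> n * (mob_ndet (K n) powr \<epsilon> n) ^ k"
      using elim assms(4,6) by (intro mult_mono power_mono) auto
    also have "\<dots> = (absRes d (mconj d (K n) (g n)) * mob_ndet (K n) ^ k) powr \<epsilon> n"
      using pos by (simp add: powr_mult power_powr)
    also have "\<dots> \<le> (C * absRes d (g n)) powr \<epsilon> n"
      using pos eps_pos[of n] absRes_ge_mconj_mob_ndet[OF g K d, of n n]
      by (intro powr_mono2) (auto simp: C_def k_def)
    also have "\<dots> = C powr \<epsilon> n * absRes d (g n) powr \<epsilon> n"
      using pos C by (simp add: powr_mult)
    also have "\<dots> \<le> max 1 C * absRes d (g n) powr \<epsilon> n"
      using powr_eps_le[OF C order_refl] by (intro mult_right_mono) auto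
    finally show ?case by (simp add: c_def divide_le_eq less_max_iff_disj mult.commute)
  qed
  then show ?thesis using c by blast
qed

lemma limit_HabsRes:
  assumes "\<And>i. Hring \<omega> \<epsilon> (\<lambda>n. coeff (fst (X n)) i)" "\<And>i. Hring \<omega> \<epsilon> (\<lambda>n. coeff (snd (X n)) i)"
  shows "\<exists>A B. ((\<lambda>n. cmod (hres k (fst (X n)) (snd (X n))) powr \<epsilon> n) \<longlongrightarrow> A) \<omega>
    \<and> ((\<lambda>n. cmax k (X n) powr \<epsilon> n) \<longlongrightarrow> B) \<omega>
    \<and> HabsRes \<omega> \<epsilon> k (\<lambda>n. fst (X n)) (\<lambda>n. snd (X n)) = A / B ^ (2 * k)"
proof (intro exI conjI)
  show "((\<lambda>n. cmod (hres k (fst (X n)) (snd (X n))) powr \<epsilon> n) \<longlongrightarrow> Hnorm \<omega> \<epsilon> (\<lambda>n. hres k (fst (X n)) (snd (X n)))) \<omega>"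
    by (intro Hnorm_tendsto Hring_hres assms)
  show "((\<lambda>n. cmax k (X n) powr \<epsilon> n) \<longlongrightarrow> Max ((\<lambda>i. Hnorm \<omega> \<epsilon> (\<lambda>n. coeff (fst (X n)) i)) ` {..k}
      \<union> (\<lambda>i. Hnorm \<omega> \<epsilon> (\<lambda>n. coeff (snd (X n)) i)) ` {..k})) \<omega>"
    by (intro cmax_powr_tendsto Hnorm_tendsto assms)
qed (simp add: HabsRes_def)

lemma absRes_powr_tendsto:
  assumes "((\<lambda>n. cmod (hres k (fst (X n)) (snd (X n))) powr \<epsilon> n) \<longlongrightarrow> A) \<omega>"
    "((\<lambda>n. cmax k (X n) powr \<epsilon> n) \<longlongrightarrow> B) \<omega>" "B \<noteq> 0"
  shows "((\<lambda>n. absRes k (X n) powr \<epsilon> n) \<longlongrightarrow> A / B ^ (2 * k)) \<omega>"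
proof -
  have "absRes k (X n) powr \<epsilon> n = cmod (hres k (fst (X n)) (snd (X n))) powr \<epsilon> n / (cmax k (X n) powr \<epsilon> n) ^ (2 * k)" for n
    unfolding absRes_def by (simp add: powr_divide cmax_nonneg power_powr)
  then show ?thesis using assms by (simp only:) (intro tendsto_intros; simp)
qed

text \<open>Closeness over the field at this scale, coefficient by coefficient up to a common factor,
  determines the limit of the normalized resultant, although the sequences themselves may differ a lot.\<close>
lemma absRes_powr_tendsto_cong:
  assumes X: "\<And>i. Hring \<omega> \<epsilon> (\<lambda>n. coeff (fst (X n)) i)" "\<And>i. Hring \<omega> \<epsilon> (\<lambda>n. coeff (snd (X n)) i)"
    and \<gamma>: "Hring \<omega> \<epsilon> \<gamma>" "\<not> Hzero \<omega> \<epsilon> \<gamma>"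
    and eq: "Heqf \<omega> \<epsilon> (\<lambda>n. fst (Y n)) (\<lambda>n. smult (\<gamma> n) (fst (X n)))"
      "Heqf \<omega> \<epsilon> (\<lambda>n. snd (Y n)) (\<lambda>n. smult (\<gamma> n) (snd (X n)))"
    and Y: "\<And>i. Hring \<omega> \<epsilon> (\<lambda>n. coeff (fst (Y n)) i)" "\<And>i. Hring \<omega> \<epsilon> (\<lambda>n. coeff (snd (Y n)) i)"
    and one: "HabsRes \<omega> \<epsilon> k (\<lambda>n. fst (X n)) (\<lambda>n. snd (X n)) = 1"
  shows "((\<lambda>n. absRes k (Y n) powr \<epsilon> n) \<longlongrightarrow> 1) \<omega>"
proof -
  define \<Gamma> where "\<Gamma> = Hnorm \<omega> \<epsilon> \<gamma>"
  have \<Gamma>: "0 < \<Gamma>" "((\<lambda>n. cmod (\<gamma> n) powr \<epsilon> n) \<longlongrightarrow> \<Gamma>) \<omega>"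
    unfolding \<Gamma>_def using Hnorm_pos[OF \<gamma>] Hnorm_tendsto[OF \<gamma>(1)] by simp_all
  obtain A B where A: "((\<lambda>n. cmod (hres k (fst (X n)) (snd (X n))) powr \<epsilon> n) \<longlongrightarrow> A) \<omega>"
    and B: "((\<lambda>n. cmax k (X n) powr \<epsilon> n) \<longlongrightarrow> B) \<omega>"
    and "HabsRes \<omega> \<epsilon> k (\<lambda>n. fst (X n)) (\<lambda>n. snd (X n)) = A / B ^ (2 * k)"
    using limit_HabsRes[OF X, of k] by blast
  then have AB: "A / B ^ (2 * k) = 1" using one by metis
  define u where "u = (\<lambda>i. \<Gamma> * Hnorm \<omega> \<epsilon> (\<lambda>n. coeff (fst (X n)) i))"
  define v where "v = (\<lambda>i. \<Gamma> * Hnorm \<omega> \<epsilon> (\<lambda>n. coeff (snd (X n)) i))"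
  define Z where "Z = (\<lambda>n. (smult (\<gamma> n) (fst (X n)), smult (\<gamma> n) (snd (X n))))"
  have Z_lim: "((\<lambda>n. cmod (coeff (fst (Z n)) i) powr \<epsilon> n) \<longlongrightarrow> u i) \<omega>"
      "((\<lambda>n. cmod (coeff (snd (Z n)) i) powr \<epsilon> n) \<longlongrightarrow> v i) \<omega>" for i
    unfolding Z_def u_def v_def fst_conv snd_conv coeff_smult norm_mult powr_mult
    by (intro tendsto_mult \<Gamma>(2) Hnorm_tendsto X)+
  have Y_lim: "((\<lambda>n. cmod (coeff (fst (Y n)) i) powr \<epsilon> n) \<longlongrightarrow> u i) \<omega>"
      "((\<lambda>n. cmod (coeff (snd (Y n)) i) powr \<epsilon> n) \<longlongrightarrow> v i) \<omega>" for i
    using eq Z_lim by (auto simp: Heqf_def Z_def intro: Hnorm_tendsto_cong)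
  have "((\<lambda>n. cmax k (Z n) powr \<epsilon> n) \<longlongrightarrow> Max (u ` {..k} \<union> v ` {..k})) \<omega>"
    by (rule cmax_powr_tendsto) (rule Z_lim)+
  moreover have "((\<lambda>n. cmax k (Z n) powr \<epsilon> n) \<longlongrightarrow> \<Gamma> * B) \<omega>"
    unfolding Z_def cmax_smult powr_mult
    using tendsto_mult[OF \<Gamma>(2) B] by simp
  \<comment> \<open>The limit of \<open>cmax\<close> for the scaled pair is computed twice, from its
    coefficients and by homogeneity. As Y has the same coefficient limits, this gives the limit of
    \<open>cmax\<close> for Y.\<close>
  ultimately have "Max (u ` {..k} \<union> v ` {..k}) = \<Gamma> * B"
    by (rule tendsto_unique[OF uf_neq_bot])
  then have cmaxY: "((\<lambda>n. cmax k (Y n) powr \<epsilon> n) \<longlongrightarrow> \<Gamma> * B) \<omega>"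
    using cmax_powr_tendsto[of Y u v k] Y_lim by simp
  have "Hzero \<omega> \<epsilon> (\<lambda>n. hres k (fst (Y n)) (snd (Y n)) - hres k (smult (\<gamma> n) (fst (X n))) (smult (\<gamma> n) (snd (X n))))"
  proof (rule Hzero_diff_hres[OF Y _ _ eq])
    show "Hring \<omega> \<epsilon> (\<lambda>n. coeff (smult (\<gamma> n) (fst (X n))) i)" "Hring \<omega> \<epsilon> (\<lambda>n. coeff (smult (\<gamma> n) (snd (X n))) i)" for i
      by (simp_all add: Hring_mult \<gamma> X)
  qed
  moreover have "((\<lambda>n. cmod (hres k (smult (\<gamma> n) (fst (X n))) (smult (\<gamma> n) (snd (X n)))) powr \<epsilon> n) \<longlongrightarrow> \<Gamma> ^ (2 * k) * A) \<omega>"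
  proof -
    have "cmod (hres k (smult (\<gamma> n) (fst (X n))) (smult (\<gamma> n) (snd (X n)))) powr \<epsilon> n
        = (cmod (\<gamma> n) powr \<epsilon> n) ^ (2 * k) * cmod (hres k (fst (X n)) (snd (X n))) powr \<epsilon> n" for n
      by (simp add: hres_smult norm_mult norm_power powr_mult power_powr)
    then show ?thesis by (simp only:) (intro tendsto_mult tendsto_power \<Gamma>(2) A)
  qed
  ultimately have resY: "((\<lambda>n. cmod (hres k (fst (Y n)) (snd (Y n))) powr \<epsilon> n) \<longlongrightarrow> \<Gamma> ^ (2 * k) * A) \<omega>"
    by (rule Hnorm_tendsto_cong)
  show ?thesis
  proof (cases "k = 0")
    case True
    have "hres 0 p q = (1 :: complex)" for p q
      by (simp add: hres_def resultant_sub_def sylvester_mat_sub_def)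
    then show ?thesis by (simp add: True absRes_def)
  next
    case False
    \<comment> \<open>With B = 0 and k > 0 the quotient would be a division by zero, with value 0
      instead of 1.\<close>
    then have "B \<noteq> 0" using AB by (auto simp: power_0_left)
    then show ?thesis using absRes_powr_tendsto[OF resY cmaxY] \<Gamma>(1) AB by (simp add: power_mult_distrib)
  qed
qed

text \<open>The entries of K need not lie in the ring. Divided by the largest modulus they do, and
  the modulus of the determinant becomes \<open>mob_ndet\<close>, here bounded away from 0.\<close>

lemma HPGL_normalized:
  assumes K: "\<And>n. mob_det (K n) \<noteq> 0" and c: "0 < c" "eventually (\<lambda>n. c \<le> mob_ndet (K n) powr \<epsilon> n) \<omega>"
  shows "HPGL \<omega> \<epsilon> (\<lambda>n. mob_mul (inverse (complex_of_real (mob_max (K n))), 0, 0, inverse (complex_of_real (mob_max (K n)))) (K n))"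
    (is "HPGL \<omega> \<epsilon> (\<lambda>n. mob_mul (?t n, 0, 0, ?t n) (K n))")
proof -
  have entries: "cmod (inverse (complex_of_real (mob_max (a, b, c, e))) * x) \<le> 1"
    if "x \<in> {a, b, c, e}" "0 < mob_max (a, b, c, e)" for a b c e x
  proof -
    have "cmod x \<le> mob_max (a, b, c, e)" using that(1) unfolding mob_max_eq by (auto simp: le_max_iff_disj)
    then show ?thesis using that(2) by (simp add: norm_mult norm_divide norm_inverse field_simps)
  qed
  have "cmod (fst (mob_mul (?t n, 0, 0, ?t n) (K n))) \<le> 1
    \<and> cmod (fst (snd (mob_mul (?t n, 0, 0, ?t n) (K n)))) \<le> 1
    \<and> cmod (fst (snd (snd (mob_mul (?t n, 0, 0, ?t n) (K n))))) \<le> 1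
    \<and> cmod (snd (snd (snd (mob_mul (?t n, 0, 0, ?t n) (K n))))) \<le> 1" for n
  proof -
    obtain a b c e where Kn: "K n = (a, b, c, e)" by (cases "K n")
    have m: "0 < mob_max (a, b, c, e)" using mob_max_pos[OF K, of n] by (simp add: Kn)
    show ?thesis unfolding Kn mob_mul_scalar fst_conv snd_conv
      by (intro conjI entries) (simp_all add: m)
  qed
  moreover have "\<not> Hzero \<omega> \<epsilon> (\<lambda>n. mob_det (mob_mul (?t n, 0, 0, ?t n) (K n)))"
  proof -
    have "cmod (mob_det (mob_mul (?t n, 0, 0, ?t n) (K n))) = mob_ndet (K n)" for n
      using mob_max_pos[OF K, of n]
      by (simp add: mob_det_mul norm_mult norm_inverse mob_ndet_def power2_eq_square divide_inverse)
    then show ?thesis using c by (auto simp: not_Hzero_iff)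
  qed
  ultimately show ?thesis unfolding HPGL_def by (auto intro: Hring_bounded)
qed

end

section \<open>Potential good reduction at the scale of the map itself\<close>

context
  fixes \<omega> :: "nat filter" and d :: nat and g :: "nat \<Rightarrow> complex poly \<times> complex poly"
  assumes uf: "nonprincipal_ultrafilter \<omega>" and d: "2 \<le> d" and g: "\<And>n. is_ratmap d (g n)"
begin

interpretation nat_ultrafilter \<omega> by unfold_locales (rule uf)
interpretation ultrafilter_scale \<omega> "eps d g" using ultrafilter_scale_eps[OF g] d by simp

lemma cmax_g: "cmax d (g n) \<noteq> 0"
  using cmax_pos[OF g, of n] d by auto

lemma Hform_g: "Hform \<omega> (eps d g) d (\<lambda>n. fst (normalize_map d (g n)))" "Hform \<omega> (eps d g) d (\<lambda>n. snd (normalize_map d (g n)))"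
  using g by (intro Hform_normalize_map cmax_g; simp add: is_ratmap_def)+

lemma absRes_powr_eps_ge: "exp (-1) \<le> absRes d (g n) powr eps d g n"
  using exp_le_powr_theta[of "absRes d (g n)" "eps d g n"] absRes_pos[OF g, of n] eps_pos[of n] d
  by (simp add: eps_def)

text \<open>At its own scale the map loses no degree in the limit: its normalised pair is already
  reduced.\<close>

lemma not_Hzero_hres_g:
  "\<not> Hzero \<omega> (eps d g) (\<lambda>n. hres d (fst (normalize_map d (g n))) (snd (normalize_map d (g n))))"
  unfolding not_Hzero_iff cmod_hres_normalize_map[OF cmax_g]
  using absRes_powr_eps_ge by (intro exI[of _ "exp (-1)"]) simp

text \<open>The reduced pair witnessing good reduction is unknown, but it must have degree d and
  agree with the normalised pair up to a nonzero constant \<gamma> over the field. Conjugation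
  preserves this, so the resultants of the complex conjugates inherit the limit 1. Over the field N
  is invertible, so its complex determinants are nonzero along the ultrafilter only.\<close>

lemma limit_PGR_imp_absRes_tendsto_1:
  assumes "limit_PGR \<omega> (eps d g) d g"
  obtains N where "eventually (\<lambda>n. mob_det (N n) \<noteq> 0) \<omega>"
    "((\<lambda>n. absRes d (mconj d (N n) (g n)) powr eps d g n) \<longlongrightarrow> 1) \<omega>"
proof -
  define P Q where "P = (\<lambda>n. fst (normalize_map d (g n)))" and "Q = (\<lambda>n. snd (normalize_map d (g n)))"
  have PQ: "Hform \<omega> (eps d g) d P" "Hform \<omega> (eps d g) d Q" unfolding P_def Q_def by (rule Hform_g)+
  have nz: "\<not> Hzero \<omega> (eps d g) (\<lambda>n. hres d (P n) (Q n))" unfolding P_def Q_def by (rule not_Hzero_hres_g)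
  obtain k P' Q' N G where k: "k \<le> d" and F: "Hform \<omega> (eps d g) k P'" "Hform \<omega> (eps d g) k Q'"
    and G: "Hform \<omega> (eps d g) (d - k) G" and eq: "Heqf \<omega> (eps d g) P (\<lambda>n. G n * P' n)" "Heqf \<omega> (eps d g) Q (\<lambda>n. G n * Q' n)"
    and N: "HPGL \<omega> (eps d g) N"
    and one: "HabsRes \<omega> (eps d g) k (\<lambda>n. fst (mconj k (N n) (P' n, Q' n))) (\<lambda>n. snd (mconj k (N n) (P' n, Q' n))) = 1"
    using assms unfolding limit_PGR_def limit_map_def Hreduced_def P_def Q_def by blast
  \<comment> \<open>Otherwise G would be a common factor of positive formal degree d - k, against
    the nonzero resultant.\<close>
  have kd: "k = d"
  proof (rule ccontr)
    assume "k \<noteq> d"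
    then have "d - (d - k) = k" "0 < d - k" using k by auto
    then show False
      using Hzero_hres_if_common_factor[OF PQ, of "d - k" G P' Q'] G F eq nz by simp
  qed
  define \<gamma> where "\<gamma> n = coeff (G n) 0" for n
  have \<gamma>: "Hring \<omega> (eps d g) \<gamma>" "G n * p = smult (\<gamma> n) p" for n p
    using Hform_coeff[OF G, of 0] Hform_0_mult[of G] G kd by (simp_all add: \<gamma>_def[abs_def])
  have \<gamma>nz: "\<not> Hzero \<omega> (eps d g) \<gamma>"
  proof
    assume z: "Hzero \<omega> (eps d g) \<gamma>"
    have "Heqf \<omega> (eps d g) (\<lambda>n. G n * P' n) (\<lambda>_. 0)" "Heqf \<omega> (eps d g) (\<lambda>n. G n * Q' n) (\<lambda>_. 0)"
      using Hzero_mult[OF z Hform_coeff[OF F(1)]] Hzero_mult[OF z Hform_coeff[OF F(2)]]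
      by (simp_all add: Heqf_def \<gamma>(2))
    then have "Heqf \<omega> (eps d g) P (\<lambda>_. 0)" "Heqf \<omega> (eps d g) Q (\<lambda>_. 0)"
      using Heqf_trans eq by blast+
    then show False using Hzero_hres_if_Heqf_0[OF PQ] nz d by auto
  qed
  define X Y where "X = (\<lambda>n. mconj d (N n) (P' n, Q' n))" and "Y = (\<lambda>n. mconj d (N n) (P n, Q n))"
  have diff: "Hzero \<omega> (eps d g) (\<lambda>n. coeff (P n + smult (- \<gamma> n) (P' n)) i)"
    "Hzero \<omega> (eps d g) (\<lambda>n. coeff (Q n + smult (- \<gamma> n) (Q' n)) i)" for i
    using eq by (simp_all add: Heqf_def \<gamma>(2))
  have "((\<lambda>n. absRes d (Y n) powr eps d g n) \<longlongrightarrow> 1) \<omega>"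
  proof (rule absRes_powr_tendsto_cong[of X \<gamma> Y d])
    show "Heqf \<omega> (eps d g) (\<lambda>n. fst (Y n)) (\<lambda>n. smult (\<gamma> n) (fst (X n)))"
      "Heqf \<omega> (eps d g) (\<lambda>n. snd (Y n)) (\<lambda>n. smult (\<gamma> n) (snd (X n)))"
      using Hzero_coeff_mconj[OF N diff, of d, unfolded mconj_add_smult] by (simp_all add: Heqf_def X_def Y_def)
    show "HabsRes \<omega> (eps d g) d (\<lambda>n. fst (X n)) (\<lambda>n. snd (X n)) = 1"
      using one by (simp add: X_def kd)
  qed (unfold X_def Y_def, (rule \<gamma> \<gamma>nz Hring_coeff_mconj[OF N] PQ[THEN Hform_coeff] F[THEN Hform_coeff])+)
  moreover have "absRes d (Y n) = absRes d (mconj d (N n) (g n))" for n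
    using absRes_mconj_normalize_map[OF cmax_g] by (simp add: Y_def P_def Q_def)
  moreover have "eventually (\<lambda>n. mob_det (N n) \<noteq> 0) \<omega>"
    using N not_Hzero_imp_nonzero unfolding HPGL_def by blast
  ultimately show ?thesis using that by simp
qed

text \<open>The complex conjugations K need not define a transformation over the field. The
  resultants before and after conjugation are bounded below at this scale, so
  \<open>mob_ndet_powr_ge\<close> shows that K, once normalised, does not degenerate.\<close>

lemma limit_PGR_if_absRes_tendsto_1:
  assumes triv: "\<not> scale_trivial \<omega> (eps d g)" and K: "\<And>n. mob_det (K n) \<noteq> 0"
    and lim: "((\<lambda>n. absRes d (mconj d (K n) (g n)) powr eps d g n) \<longlongrightarrow> 1) \<omega>"
  shows "limit_PGR \<omega> (eps d g) d g"
proof -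
  define P Q where "P = (\<lambda>n. fst (normalize_map d (g n)))" and "Q = (\<lambda>n. snd (normalize_map d (g n)))"
  have PQ: "Hform \<omega> (eps d g) d P" "Hform \<omega> (eps d g) d Q" unfolding P_def Q_def by (rule Hform_g)+
  have nz: "\<not> Hzero \<omega> (eps d g) (\<lambda>n. hres d (P n) (Q n))" unfolding P_def Q_def by (rule not_Hzero_hres_g)
  have "limit_map \<omega> (eps d g) d g d P Q"
    unfolding limit_map_def P_def[symmetric] Q_def[symmetric]
    using d by (intro Hreduced_self PQ nz) auto
  moreover have "eventually (\<lambda>n. 1 / 2 \<le> absRes d (mconj d (K n) (g n)) powr eps d g n) \<omega>"
    using order_tendstoD(1)[OF lim, of "1 / 2"] by (auto elim!: eventually_mono)
  then obtain c where c: "0 < c" "eventually (\<lambda>n. c \<le> mob_ndet (K n) powr eps d g n) \<omega>"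
    using mob_ndet_powr_ge[where g = g and K = K and a = "1 / 2" and b = "exp (-1)", OF g K d] absRes_powr_eps_ge by auto
  define t where "t = (\<lambda>n. inverse (complex_of_real (mob_max (K n))))"
  define N where "N = (\<lambda>n. mob_mul (t n, 0, 0, t n) (K n))"
  have N: "HPGL \<omega> (eps d g) N"
    unfolding N_def t_def by (rule HPGL_normalized[OF K c])
  have t: "t n \<noteq> 0" for n using mob_max_pos[OF K, of n] by (simp add: t_def)
  define X where "X = (\<lambda>n. mconj d (N n) (P n, Q n))"
  have Nnz: "mob_det (N n) \<noteq> 0" for n
    using K t by (simp add: N_def mob_det_mul)
  have X: "absRes d (X n) = absRes d (mconj d (K n) (g n))" for n
    using absRes_mconj_normalize_map[OF cmax_g] absRes_mconj_scale[OF t] by (simp add: X_def P_def Q_def N_def)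
  have HX: "Hring \<omega> (eps d g) (\<lambda>n. coeff (fst (X n)) i)" "Hring \<omega> (eps d g) (\<lambda>n. coeff (snd (X n)) i)" for i
    unfolding X_def by (intro Hring_coeff_mconj[OF N] PQ[THEN Hform_coeff])+
  obtain A B where A: "((\<lambda>n. cmod (hres d (fst (X n)) (snd (X n))) powr eps d g n) \<longlongrightarrow> A) \<omega>"
    and B: "((\<lambda>n. cmax d (X n) powr eps d g n) \<longlongrightarrow> B) \<omega>"
    and AB: "HabsRes \<omega> (eps d g) d (\<lambda>n. fst (X n)) (\<lambda>n. snd (X n)) = A / B ^ (2 * d)"
    using limit_HabsRes[OF HX, of d] by blast
  have ratX: "is_ratmap d (X n)" for n
    unfolding X_def using Nnz cmod_hres_normalize_map[OF cmax_g, of n] absRes_pos[OF g, of n] d PQ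
    by (intro is_ratmap_mconj) (auto simp: is_ratmap_def P_def Q_def Hform_def)
  have "A = B ^ (2 * d)"
  proof (rule tendsto_unique[OF uf_neq_bot A])
    have "cmod (hres d (fst (X n)) (snd (X n))) powr eps d g n
        = absRes d (X n) powr eps d g n * (cmax d (X n) powr eps d g n) ^ (2 * d)" for n
    proof -
      have cX: "0 < cmax d (X n)" using cmax_pos[OF ratX] d by simp
      then have "cmod (hres d (fst (X n)) (snd (X n))) = absRes d (X n) * cmax d (X n) ^ (2 * d)"
        by (simp add: absRes_def)
      then show ?thesis using cX by (simp add: powr_mult power_powr)
    qed
    then have eq: "(\<lambda>n. cmod (hres d (fst (X n)) (snd (X n))) powr eps d g n)
        = (\<lambda>n. absRes d (mconj d (K n) (g n)) powr eps d g n * (cmax d (X n) powr eps d g n) ^ (2 * d))"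
      by (simp add: X)
    show "((\<lambda>n. cmod (hres d (fst (X n)) (snd (X n))) powr eps d g n) \<longlongrightarrow> B ^ (2 * d)) \<omega>"
      unfolding eq using tendsto_mult[OF lim tendsto_power[OF B, of "2 * d"]] by simp
  qed
  \<comment> \<open>Both limits could still vanish, and then A / B^(2d) would be 0 rather than
    1.\<close>
  moreover have "A \<noteq> 0"
  proof -
    have "hres d (fst (X n)) (snd (X n)) = mob_det (N n) ^ (d * d + d) * hres d (P n) (Q n)" for n
      unfolding X_def using hres_mconj[of "(P n, Q n)" d "N n"] PQ Nnz by (simp add: Hform_def)
    then have "\<not> Hzero \<omega> (eps d g) (\<lambda>n. hres d (fst (X n)) (snd (X n)))"
      using N by (simp add: not_Hzero_mult not_Hzero_power not_Hzero_1 nz HPGL_def)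
    then have "0 < Hnorm \<omega> (eps d g) (\<lambda>n. hres d (fst (X n)) (snd (X n)))"
      by (intro Hnorm_pos Hring_hres HX)
    moreover have "A = Hnorm \<omega> (eps d g) (\<lambda>n. hres d (fst (X n)) (snd (X n)))"
      by (intro tendsto_unique[OF uf_neq_bot A] Hnorm_tendsto Hring_hres HX)
    ultimately show ?thesis by simp
  qed
  ultimately have "HabsRes \<omega> (eps d g) d (\<lambda>n. fst (X n)) (\<lambda>n. snd (X n)) = 1"
    using AB by simp
  then show ?thesis using triv N \<open>limit_map \<omega> (eps d g) d g d P Q\<close>
    unfolding limit_PGR_def X_def by blast
qed

end

section \<open>The three equivalent conditions\<close>

theorem mainTheorem5:
  fixes \<omega> :: "nat filter" and d :: nat
    and f :: "nat \<Rightarrow> complex poly \<times> complex poly" and M :: "nat \<Rightarrow> complex mob"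
  assumes "nonprincipal_ultrafilter \<omega>"
    and "d \<ge> 2"
    and "\<forall>n. is_ratmap d (f n)"
    and "\<forall>n. mob_det (M n) \<noteq> 0"
  shows "(scale_eq \<omega> (eps d (mconjs d M f)) (eps_star d f)
            \<longleftrightarrow> \<not> limit_PGR \<omega> (eps d (mconjs d M f)) d (mconjs d M f))
       \<and> (\<not> limit_PGR \<omega> (eps d (mconjs d M f)) d (mconjs d M f)
            \<longleftrightarrow> (\<forall>L. (\<forall>n. mob_det (L n) \<noteq> (0::complex)) \<longrightarrow>
                   limit_degree_is \<omega> (eps d (mconjs d L f)) 1
                     (\<lambda>n. mob_pair (mob_mul (L n) (mob_adj (M n)))) 1))"
proof -
  interpret nat_ultrafilter \<omega> by unfold_locales (rule assms(1))
  define g where "g = mconjs d M f"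
  define \<epsilon> where "\<epsilon> = eps d g"
  define \<epsilon>\<^sub>s where "\<epsilon>\<^sub>s = eps_star d f"
  have d: "0 < d" using assms(2) by simp
  have f: "is_ratmap d (f n)" and M: "mob_det (M n) \<noteq> 0" for n using assms by auto
  have g: "is_ratmap d (g n)" for n
    unfolding g_def mconjs_def by (intro is_ratmap_mconj f M)
  have \<rho>: "0 < absRes d (g n)" for n by (rule absRes_pos[OF g d])
  interpret E: ultrafilter_scale \<omega> \<epsilon> unfolding \<epsilon>_def by (rule ultrafilter_scale_eps[OF g d])
  have le_star: "theta (absRes d (mconj d N (f n))) \<le> \<epsilon>\<^sub>s n" if "mob_det N \<noteq> 0" for N n
    unfolding \<epsilon>\<^sub>s_def eps_star_def
    by (rule theta_mono[OF absRes_pos[OF is_ratmap_mconj[OF f that] d] absRes_le_absres[OF that]])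
  have star_pos: "0 < \<epsilon>\<^sub>s n" for n
    using le_star[OF M, of n n] theta_pos[OF absRes_pos[OF is_ratmap_mconj[OF f M] d], of n n] by linarith
  have "\<epsilon> n / \<epsilon>\<^sub>s n \<le> 1" for n
    using le_star[OF M, of n n] star_pos[of n] by (simp add: \<epsilon>_def g_def eps_def mconjs_def)
  then have "eventually (\<lambda>n. \<epsilon> n / \<epsilon>\<^sub>s n \<le> 1) \<omega>" by simp
  \<comment> \<open>The scale of one conjugate never exceeds the fundamental one, so only a lower
    bound for the ratio is at stake.\<close>
  then have eq_iff: "scale_eq \<omega> \<epsilon> \<epsilon>\<^sub>s \<longleftrightarrow> (\<exists>c>0. eventually (\<lambda>n. c \<le> \<epsilon> n / \<epsilon>\<^sub>s n) \<omega>)"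
    unfolding scale_eq_iff by blast
  have change: "absRes d (mconj d (mob_mul (L n) (mob_adj (M n))) (g n)) = absRes d (mconj d (L n) (f n))" for L n
    unfolding g_def mconjs_def by (rule absRes_mconj_change[OF M])
  have Kdet: "mob_det (mob_mul (L n) (mob_adj (M n))) \<noteq> 0" if "\<And>n. mob_det (L n) \<noteq> 0" for L n
    using that M by (simp add: mob_det_mul)
  have degree_iff: "limit_degree_is \<omega> (eps d (mconjs d L f)) 1 (\<lambda>n. mob_pair (mob_mul (L n) (mob_adj (M n)))) 1
      \<longleftrightarrow> (\<exists>c>0. eventually (\<lambda>n. c \<le> mob_ndet (mob_mul (L n) (mob_adj (M n))) powr eps d (mconjs d L f) n) \<omega>)"
    if "\<And>n. mob_det (L n) \<noteq> 0" for L
    using that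
    by (intro ultrafilter_scale.limit_degree_1_iff ultrafilter_scale_eps d Kdet)
      (simp add: mconjs_def is_ratmap_mconj f)
  have \<sigma>ge: "exp (-1) \<le> absRes d (mconj d (L n) (f n)) powr eps d (mconjs d L f) n" if "\<And>n. mob_det (L n) \<noteq> 0" for L n
  proof -
    have "0 < absRes d (mconj d (L n) (f n))" by (rule absRes_pos[OF is_ratmap_mconj[OF f that] d])
    then show ?thesis
      using exp_le_powr_theta[of "absRes d (mconj d (L n) (f n))" "eps d (mconjs d L f) n"]
        theta_pos[of "absRes d (mconj d (L n) (f n))"]
      by (simp add: eps_def mconjs_def)
  qed

  have one_three: "limit_degree_is \<omega> (eps d (mconjs d L f)) 1 (\<lambda>n. mob_pair (mob_mul (L n) (mob_adj (M n)))) 1"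
    if eq: "scale_eq \<omega> \<epsilon> \<epsilon>\<^sub>s" and L: "\<And>n. mob_det (L n) \<noteq> 0" for L
  proof -
    define \<delta> where "\<delta> = eps d (mconjs d L f)"
    have "is_ratmap d (mconjs d L f n)" for n by (simp add: mconjs_def is_ratmap_mconj f L)
    then interpret D: ultrafilter_scale \<omega> \<delta> unfolding \<delta>_def by (rule ultrafilter_scale_eps[OF _ d])
    obtain c where c: "0 < c" "eventually (\<lambda>n. c \<le> \<epsilon> n / \<epsilon>\<^sub>s n) \<omega>" using eq eq_iff by blast
    \<comment> \<open>The scale \<delta> of any conjugate is at most the fundamental scale, hence at
      most \<epsilon>/c, which bounds the exponent \<delta>/\<epsilon> by 1/c.\<close>
    from c(2) have \<rho>ge: "eventually (\<lambda>n. exp (- 1 / c) \<le> absRes d (g n) powr \<delta> n) \<omega>"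
    proof eventually_elim
      case (elim n)
      have "\<delta> n * c \<le> \<epsilon>\<^sub>s n * c"
        using le_star[OF L, of n n] c(1) by (simp add: \<delta>_def eps_def mconjs_def)
      also have "\<dots> \<le> \<epsilon> n" using elim star_pos[of n] by (simp add: field_simps)
      finally have "exp (- 1 / c) \<le> exp (- \<delta> n / \<epsilon> n)" using E.eps_pos[of n] c(1) by (simp add: field_simps)
      also have "\<dots> \<le> absRes d (g n) powr \<delta> n"
        using exp_le_powr_theta[OF \<rho>, of "\<delta> n" n] D.eps_pos[of n] by (simp add: \<epsilon>_def eps_def)
      finally show ?case .
    qed
    have "\<exists>c>0. eventually (\<lambda>n. c \<le> mob_ndet (mob_mul (L n) (mob_adj (M n))) powr \<delta> n) \<omega>"
    proof (rule D.mob_ndet_powr_ge[OF g Kdet[of L, OF L] assms(2) _ _ _ \<rho>ge])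
      show "eventually (\<lambda>n. exp (-1) \<le> absRes d (mconj d (mob_mul (L n) (mob_adj (M n))) (g n)) powr \<delta> n) \<omega>"
        unfolding change \<delta>_def using \<sigma>ge[of L, OF L] by simp
    qed simp_all
    then show ?thesis using degree_iff[of L, OF L] by (simp add: \<delta>_def)
  qed

  text \<open>When the scales differ, a nearly optimal conjugation witnesses the failure of both other conditions.\<close>
  have optimal: "\<exists>L. (\<forall>n. mob_det (L n) \<noteq> 0) \<and> (\<forall>c>0. eventually (\<lambda>n. \<epsilon> n < c * eps d (mconjs d L f) n) \<omega>)"
    if neq: "\<not> scale_eq \<omega> \<epsilon> \<epsilon>\<^sub>s"
  proof -
    have "\<exists>L. mob_det L \<noteq> 0 \<and> absres d (f n) / 2 < absRes d (mconj d L (f n))" for n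
      using absres_attained_half[OF f d] by blast
    then obtain L where L: "\<And>n. mob_det (L n) \<noteq> 0" "\<And>n. absres d (f n) / 2 < absRes d (mconj d (L n) (f n))"
      by metis
    have half: "\<epsilon>\<^sub>s n \<le> 2 * eps d (mconjs d L f) n" for n
    proof -
      have "0 < absres d (f n)"
        using absRes_le_absres[OF M[of n], of d "f n"] absRes_pos[OF is_ratmap_mconj[OF f[of n] M[of n]] d] by linarith
      from theta_half[OF this L(2)] show ?thesis by (simp add: \<epsilon>\<^sub>s_def eps_star_def eps_def mconjs_def)
    qed
    have "eventually (\<lambda>n. \<epsilon> n < c * eps d (mconjs d L f) n) \<omega>" if c: "0 < c" for c
    proof -
      \<comment> \<open>The half compensates for the near-optimal conjugation reaching the
        fundamental scale only up to the factor 2.\<close>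
      have "eventually (\<lambda>n. \<epsilon> n / \<epsilon>\<^sub>s n < c / 2) \<omega>"
        using neq half_gt_zero[OF c] unfolding eq_iff not_le[symmetric] not_eventually_uf[symmetric] by blast
      then show ?thesis
      proof eventually_elim
        case (elim n)
        then have "\<epsilon> n < c / 2 * \<epsilon>\<^sub>s n" using star_pos[of n] by (simp add: divide_less_eq)
        also have "\<dots> \<le> c / 2 * (2 * eps d (mconjs d L f) n)" using half c by (intro mult_left_mono) auto
        finally show ?case by simp
      qed
    qed
    then show ?thesis using L(1) by blast
  qed

  have three_one: "scale_eq \<omega> \<epsilon> \<epsilon>\<^sub>s"
    if three: "\<And>L. (\<And>n. mob_det (L n) \<noteq> 0) \<Longrightarrow>
      limit_degree_is \<omega> (eps d (mconjs d L f)) 1 (\<lambda>n. mob_pair (mob_mul (L n) (mob_adj (M n)))) 1"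
  proof (rule ccontr)
    assume "\<not> scale_eq \<omega> \<epsilon> \<epsilon>\<^sub>s"
    then obtain L where L: "\<And>n. mob_det (L n) \<noteq> 0"
      and small: "\<And>c. 0 < c \<Longrightarrow> eventually (\<lambda>n. \<epsilon> n < c * eps d (mconjs d L f) n) \<omega>"
      using optimal by blast
    define \<delta> where "\<delta> = eps d (mconjs d L f)"
    have "is_ratmap d (mconjs d L f n)" for n by (simp add: mconjs_def is_ratmap_mconj f L)
    then interpret D: ultrafilter_scale \<omega> \<delta> unfolding \<delta>_def by (rule ultrafilter_scale_eps[OF _ d])
    obtain b where b: "0 < b" "eventually (\<lambda>n. b \<le> mob_ndet (mob_mul (L n) (mob_adj (M n))) powr \<delta> n) \<omega>"
      using three[of L, OF L] degree_iff[of L, OF L] unfolding \<delta>_def by blast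
    have "\<exists>c>0. eventually (\<lambda>n. c \<le> absRes d (g n) powr \<delta> n) \<omega>"
    proof (rule D.absRes_powr_ge[OF g Kdet[of L, OF L] d _ _ b])
      show "eventually (\<lambda>n. exp (-1) \<le> absRes d (mconj d (mob_mul (L n) (mob_adj (M n))) (g n)) powr \<delta> n) \<omega>"
        unfolding change \<delta>_def using \<sigma>ge[of L, OF L] by simp
    qed simp
    then obtain c where c: "0 < c" "eventually (\<lambda>n. c \<le> absRes d (g n) powr \<delta> n) \<omega>" by blast
    \<comment> \<open>If exp(-\<delta>/\<epsilon>) \<ge> c then \<delta>/\<epsilon> is at most |ln
      c|. Taking the reciprocal of a larger number makes \<epsilon> < r \<delta> contradict this,
      and the summand 1 also gives r \<le> 1.\<close>
    define r where "r = 1 / (1 + \<bar>ln c\<bar>)"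
    have r: "0 < r" "r \<le> 1" by (simp_all add: r_def)
    from c(2) small[OF r(1)] have "eventually (\<lambda>n. False) \<omega>"
    proof eventually_elim
      case (elim n)
      have lt: "\<epsilon> n < r * \<delta> n" using elim(2) by (simp add: \<delta>_def)
      \<comment> \<open>A scale strictly below 1 puts the resultant in the range where
        \<open>theta\<close> is inverted by an exponential, turning the bound into an
        equality.\<close>
      also have "\<dots> \<le> 1" using r D.eps_pos[of n] D.eps_le_1[of n] by (simp add: mult_le_one)
      finally have "absRes d (g n) \<le> exp (-1)" by (intro theta_less_1_imp) (simp add: \<epsilon>_def eps_def)
      then have "absRes d (g n) powr \<delta> n = exp (- \<delta> n / \<epsilon> n)"
        using powr_theta_small[OF \<rho>] by (simp add: \<epsilon>_def eps_def)
      then have "exp (ln c) \<le> exp (- \<delta> n / \<epsilon> n)" using elim(1) c(1) by simp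
      then have "\<delta> n / \<epsilon> n \<le> \<bar>ln c\<bar>" by simp
      then have "\<delta> n \<le> \<bar>ln c\<bar> * \<epsilon> n" using E.eps_pos[of n] by (simp add: divide_le_eq)
      moreover have "(1 + \<bar>ln c\<bar>) * \<epsilon> n < \<delta> n" using lt by (simp add: r_def field_simps)
      ultimately show ?case using E.eps_pos[of n] by (simp add: algebra_simps)
    qed
    then show False using uf_neq_bot by (simp add: trivial_limit_def)
  qed

  have one_two: "\<not> limit_PGR \<omega> \<epsilon> d g" if eq: "scale_eq \<omega> \<epsilon> \<epsilon>\<^sub>s"
  proof
    assume PGR: "limit_PGR \<omega> \<epsilon> d g"
    obtain N where N: "eventually (\<lambda>n. mob_det (N n) \<noteq> 0) \<omega>"
      and lim: "((\<lambda>n. absRes d (mconj d (N n) (g n)) powr \<epsilon> n) \<longlongrightarrow> 1) \<omega>"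
      using limit_PGR_imp_absRes_tendsto_1[where g = g, OF assms(1,2) g] PGR unfolding \<epsilon>_def by blast
    obtain c where c: "0 < c" "eventually (\<lambda>n. c \<le> \<epsilon> n / \<epsilon>\<^sub>s n) \<omega>" using eq eq_iff by blast
    \<comment> \<open>Potential good reduction excludes the trivial scale, so \<epsilon> tends to 0.
      This will force \<open>theta\<close> of the conjugate below 1, where it determines the
      resultant exactly.\<close>
    have "eventually (\<lambda>n. \<epsilon> n < c) \<omega>"
      using PGR c(1) not_scale_trivial_iff[of \<epsilon>, OF E.eps_le_1] by (simp add: limit_PGR_def)
    moreover have "eventually (\<lambda>n. exp (- c) < absRes d (mconj d (N n) (g n)) powr \<epsilon> n) \<omega>"
      using order_tendstoD(1)[OF lim, of "exp (- c)"] c(1) by simp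
    ultimately have "eventually (\<lambda>n. False) \<omega>" using N c(2)
    proof eventually_elim
      case (elim n)
      define \<sigma> where "\<sigma> = absRes d (mconj d (N n) (g n))"
      have \<sigma>: "0 < \<sigma>" unfolding \<sigma>_def by (rule absRes_pos[OF is_ratmap_mconj[OF g elim(3)] d])
      \<comment> \<open>The conjugation of g by N is one of f by N M, so its scale is bounded by the
        fundamental one, hence by \<epsilon>/c. Then \<sigma>^\<epsilon> is at most exp(-c), against
        the limit 1.\<close>
      have "theta \<sigma> \<le> \<epsilon>\<^sub>s n"
        using le_star[of "mob_mul (N n) (M n)" n] elim(3) M[of n]
        by (simp add: \<sigma>_def g_def mconjs_def mconj_mconj mob_det_mul)
      then have "c * theta \<sigma> \<le> c * \<epsilon>\<^sub>s n" using c(1) by simp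
      also have "\<dots> \<le> \<epsilon> n" using elim(4) star_pos[of n] by (simp add: field_simps)
      finally have le: "c * theta \<sigma> \<le> \<epsilon> n" .
      then have "c * theta \<sigma> < c * 1" using elim(1) by simp
      then have "theta \<sigma> < 1" using c(1) by simp
      then have "\<sigma> powr \<epsilon> n = exp (- \<epsilon> n / theta \<sigma>)"
        by (intro powr_theta_small[OF \<sigma>] theta_less_1_imp)
      also have "\<dots> \<le> exp (- c)" using le theta_pos[OF \<sigma>] by (simp add: field_simps)
      finally show ?case using elim(2) by (simp add: \<sigma>_def)
    qed
    then show False using uf_neq_bot by (simp add: trivial_limit_def)
  qed

  have two_one: "limit_PGR \<omega> \<epsilon> d g" if neq: "\<not> scale_eq \<omega> \<epsilon> \<epsilon>\<^sub>s"
  proof -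
    obtain L where L: "\<And>n. mob_det (L n) \<noteq> 0"
      and small: "\<And>c. 0 < c \<Longrightarrow> eventually (\<lambda>n. \<epsilon> n < c * eps d (mconjs d L f) n) \<omega>"
      using optimal[OF neq] by blast
    define \<delta> where "\<delta> = eps d (mconjs d L f)"
    have "is_ratmap d (mconjs d L f n)" for n by (simp add: mconjs_def is_ratmap_mconj f L)
    then interpret D: ultrafilter_scale \<omega> \<delta> unfolding \<delta>_def by (rule ultrafilter_scale_eps[OF _ d])
    have ratio: "((\<lambda>n. \<epsilon> n / \<delta> n) \<longlongrightarrow> 0) \<omega>"
    proof (rule order_tendstoI)
      fix a :: real assume "a < 0"
      then show "eventually (\<lambda>n. a < \<epsilon> n / \<delta> n) \<omega>"
        using E.eps_pos D.eps_pos by (intro always_eventually allI) (meson divide_pos_pos less_trans)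
    next
      fix a :: real assume "0 < a"
      from small[OF this] show "eventually (\<lambda>n. \<epsilon> n / \<delta> n < a) \<omega>"
        unfolding \<delta>_def[symmetric] using D.eps_pos by (auto simp: divide_less_eq elim!: eventually_mono)
    qed
    \<comment> \<open>As \<delta> is at most 1, \<epsilon> itself tends to 0. Hence the scale is
      nontrivial and the upper bound (2d)! for resultants becomes harmless in the limit.\<close>
    have le_ratio: "\<epsilon> n \<le> \<epsilon> n / \<delta> n" for n
      using E.eps_pos[of n] D.eps_pos[of n] D.eps_le_1[of n] by (simp add: le_divide_eq mult_left_le)
    have "eventually (\<lambda>n. \<epsilon> n < c) \<omega>" if "0 < c" for c
      using order_tendstoD(2)[OF ratio that] by eventually_elim (use le_ratio order_le_less_trans in blast)
    then have triv: "\<not> scale_trivial \<omega> \<epsilon>"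
      using not_scale_trivial_iff[of \<epsilon>, OF E.eps_le_1] by simp
    define C :: real where "C = fact (2 * d)"
    have C: "1 \<le> C" unfolding C_def by (rule fact_ge_1)
    have "((\<lambda>n. absRes d (mconj d (L n) (f n)) powr \<epsilon> n) \<longlongrightarrow> 1) \<omega>"
    \<comment> \<open>From below, the resultant is at least exp(-1/\<delta>) by definition of its
      scale, so its power is at least exp(-\<epsilon>/\<delta>); from above it is at most the
      constant C.\<close>
    proof (rule tendsto_sandwich)
      show "((\<lambda>n. exp (- (\<epsilon> n / \<delta> n))) \<longlongrightarrow> 1) \<omega>"
        using tendsto_exp[OF tendsto_minus[OF ratio]] by simp
      show "((\<lambda>n. C powr (\<epsilon> n / \<delta> n)) \<longlongrightarrow> 1) \<omega>"
        using tendsto_powr[OF tendsto_const[of C] ratio] C by simp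
      have pos: "0 < absRes d (mconj d (L n) (f n))" for n by (rule absRes_pos[OF is_ratmap_mconj[OF f L] d])
      show "eventually (\<lambda>n. exp (- (\<epsilon> n / \<delta> n)) \<le> absRes d (mconj d (L n) (f n)) powr \<epsilon> n) \<omega>"
        using exp_le_powr_theta[OF pos] E.eps_pos
        by (intro always_eventually allI) (simp add: \<delta>_def eps_def mconjs_def order_less_imp_le)
      have "absRes d (mconj d (L n) (f n)) powr \<epsilon> n \<le> C powr (\<epsilon> n / \<delta> n)" for n
      proof -
        have "absRes d (mconj d (L n) (f n)) powr \<epsilon> n \<le> C powr \<epsilon> n"
          using pos[of n] E.eps_pos[of n] absRes_le unfolding C_def by (intro powr_mono2) auto
        also have "\<dots> \<le> C powr (\<epsilon> n / \<delta> n)" using C le_ratio by (intro powr_mono) auto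
        finally show ?thesis .
      qed
      then show "eventually (\<lambda>n. absRes d (mconj d (L n) (f n)) powr \<epsilon> n \<le> C powr (\<epsilon> n / \<delta> n)) \<omega>" by simp
    qed
    then have "((\<lambda>n. absRes d (mconj d (mob_mul (L n) (mob_adj (M n))) (g n)) powr \<epsilon> n) \<longlongrightarrow> 1) \<omega>"
      unfolding change .
    then show ?thesis
      unfolding \<epsilon>_def using triv
      by (intro limit_PGR_if_absRes_tendsto_1[where K = "\<lambda>n. mob_mul (L n) (mob_adj (M n))"] assms(1,2) g Kdet L)
        (simp_all add: \<epsilon>_def)
  qed

  show ?thesis
    using one_two two_one one_three three_one unfolding \<epsilon>_def g_def \<epsilon>\<^sub>s_def by blast
qed

end
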